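(* Let $q$ be any large integer and let $\log N = \tau \sqrt{\log q \log\log q}$ with $\tau = (\log\log q)^{O(1)}$. Define $A$ and $\tau'$ by \[\tau = \int_{A}^\infty e^{-x}\frac{dx}{x}, \qquad \tau' = \int_{A}^\infty e^{-x} \frac{dx}{x^2}.\] Then \[\Delta(N,q) \geq \sqrt{N} \exp\left((1 + o(1))A(\tau + \tau')\sqrt{\frac{\log q}{\log\log q}}\right).\] If $q$ is prime, define instead $A$ and $\tau'$ by \[\sqrt{2}\,\tau = \int_A^\infty e^{-x}\frac{dx}{x}, \qquad \tau' = \int_{A}^\infty e^{-x}\frac{dx}{x^2};\] with this definition, \[\Delta\!\left(\frac{q}{N}, q\right) \geq \sqrt{\frac{q}{N}} \exp\left((1 + o(1))A\left(\tau + \frac{\tau'}{\sqrt{2}}\right)\sqrt{\frac{\log q}{\log\log q}}\right).\] Here $o(1)$ denotes quantities tending to $0$ as $q\to\infty$.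
   Context: For a positive integer $q$ and real $N\ge 1$, $\Delta(N,q) = \sup_{\chi \neq \chi_0 \bmod q} \left| \sum_{n \leq N}\chi(n)\right|$, the supremum over non-principal Dirichlet characters $\chi$ modulo $q$. *)

theory Defs
  imports "HOL-Analysis.Analysis"
begin

definition dirichlet_char :: "nat \<Rightarrow> (nat \<Rightarrow> complex) \<Rightarrow> bool" where
  "dirichlet_char q chi \<longleftrightarrow>
     (\<forall>n. chi (n + q) = chi n) \<and>
     (\<forall>m n. chi (m * n) = chi m * chi n) \<and>
     chi 1 = 1 \<and>
     (\<forall>n. chi n = 0 \<longleftrightarrow> \<not> coprime n q)"

definition principal_char :: "nat \<Rightarrow> nat \<Rightarrow> complex" where
  "principal_char q n = (if coprime n q then 1 else 0)"

definition Delta :: "real \<Rightarrow> nat \<Rightarrow> real" where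
  "Delta N q = Sup {cmod (\<Sum>n\<in>{1..nat \<lfloor>N\<rfloor>}. chi n) | chi.
                     dirichlet_char q chi \<and> chi \<noteq> principal_char q}"

end

theory Submission
  imports Defs "HOL-Number_Theory.Number_Theory" "HOL-Real_Asymp.Real_Asymp"
begin

text \<open>
  This is Hough's resonance method. Put \<open>R\<^sub>X(\<chi>) = (\<Sum>x\<in>X. \<chi> x)\<close>. For finite sets \<open>X\<close>, \<open>Y\<close> of integers
  coprime to \<open>q\<close>, orthogonality bounds the sum of \<open>S\<^sub>N(\<chi>) R\<^sub>Y(\<chi>) cnj (R\<^sub>X(\<chi>))\<close> over all \<open>\<chi>\<close> from below by
  \<open>totient q\<close> times the number of factorizations \<open>x = y z\<close> with \<open>z \<le> N\<close>, while by Cauchy-Schwarz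
  the sum of \<open>\<bar>R\<^sub>X R\<^sub>Y\<bar>\<close> is at most \<open>totient q * sqrt (\<bar>X\<bar> \<bar>Y\<bar>)\<close>. If every \<open>x\<close> has \<open>K\<close> factorizations,
  some non-principal sum is therefore essentially at least \<open>K * sqrt (\<bar>X\<bar> / \<bar>Y\<bar>)\<close>.

  The sets are made of square-free products: cut the primes not dividing \<open>q\<close> into short blocks
  around \<open>e\<^sup>u\<close>, and let \<open>x\<close>, \<open>y\<close>, \<open>z\<close> have exactly \<open>k\<close>, \<open>k - m\<close>, \<open>m\<close> factors in a block
  with \<open>s\<close> primes. A block contributes about \<open>(e sqrt (k s) / m)\<^sup>m\<close> to the gain. The length of the
  resonator suggests \<open>k \<approx> \<lambda>\<^sup>2 s e\<^sup>-\<^sup>u / u\<^sup>2\<close> with \<open>\<lambda>\<^sup>2 = log q log log q\<close>, and the constraint \<open>z \<le> N\<close>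
  suggests \<open>m \<approx> \<lambda> s e\<^sup>-\<^sup>u e\<^sup>-\<^sup>\<alpha>\<^sup>u / u\<close> with \<open>\<alpha> = A / log log q\<close>. By Mertens' theorem the sums over blocks become
  integrals; the logarithm of the gain is \<open>log N / 2\<close> plus \<open>\<lambda>\<close> times the integral of
  \<open>e\<^sup>-\<^sup>\<alpha>\<^sup>u (1 + \<alpha> u) / u\<^sup>2\<close>, whose antiderivative is \<open>- e\<^sup>-\<^sup>\<alpha>\<^sup>u / u\<close>, in accordance with
  \<open>A (\<tau> + \<tau>') = e\<^sup>-\<^sup>A\<close>. The part of \<open>log N\<close> lost by truncating at a multiple of \<open>log log q\<close> is restored by
  one additional large prime, which costs only a factor polynomial in \<open>\<lambda>\<close>.

  For prime \<open>q\<close> and sums of length \<open>q / N\<close> a Gauss sum replaces \<open>S\<close> by \<open>\<Sum>t. \<chi> t * c t\<close>, where \<open>c\<close> is an odd sine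
  kernel which is non-negative below \<open>q / 2\<close> and of size \<open>q z / N\<^sup>2\<close> at \<open>z \<le> N\<close>. The negative values of \<open>c\<close>
  occur in congruences \<open>t y \<equiv> - x\<close>, which force \<open>t \<ge> q / (2 y)\<close>; these are harmless as long as the elements
  of \<open>X\<close> and \<open>Y\<close> are smaller than \<open>sqrt q\<close>, which is where the factor \<open>sqrt 2\<close> comes from.
\<close>

section \<open>Mertens' first theorem\<close>

lemma prod_dvd_of_pairwise_coprime:
  fixes f :: "'a \<Rightarrow> nat"
  assumes "finite S" "\<And>i j. i \<in> S \<Longrightarrow> j \<in> S \<Longrightarrow> i \<noteq> j \<Longrightarrow> coprime (f i) (f j)"
    "\<And>i. i \<in> S \<Longrightarrow> f i dvd n"
  shows "prod f S dvd n"
  using assms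
proof (induction S rule: finite_induct)
  case (insert x S)
  have "coprime (f x) (prod f S)"
    by (rule prod_coprime_right) (use insert in auto)
  then show ?case using insert by (auto intro!: divides_mult)
qed auto

lemma ln_prime_nonneg: "prime p \<Longrightarrow> 0 \<le> ln (real p)"
  using prime_ge_1_nat[of p] by simp

section \<open>Chebyshev's bound for the product of the primes up to \<open>n\<close>\<close>

text \<open>Row \<open>2 * m + 1\<close> has two equal central entries, which share the row sum
  \<open>2 ^ (2 * m + 1)\<close>.\<close>

lemma binomial_odd_central_le: "(2 * m + 1 choose m) \<le> 4 ^ m"
proof -
  have "(2 * m + 1 choose m) + (2 * m + 1 choose Suc m) = (\<Sum>k\<in>{m, Suc m}. 2 * m + 1 choose k)"
    by simp
  also have "\<dots> \<le> (\<Sum>k\<le>2 * m + 1. 2 * m + 1 choose k)"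
    by (rule sum_mono2) auto
  also have "\<dots> = 2 ^ (2 * m + 1)"
    by (rule choose_row_sum)
  finally have "(2 * m + 1 choose m) + (2 * m + 1 choose Suc m) \<le> 2 * 4 ^ m"
    by (simp add: power_mult)
  moreover have "(2 * m + 1 choose Suc m) = (2 * m + 1 choose m)"
    by (subst binomial_symmetric) auto
  ultimately show ?thesis by simp
qed

text \<open>Erdos's induction. An even \<open>n > 2\<close> adds no prime; for
  \<open>n = 2 * m + 1\<close> every prime in \<open>(m + 1, n]\<close> divides
  \<open>n choose m\<close>, because it divides \<open>fact n\<close> but neither
  \<open>fact m\<close> nor \<open>fact (m + 1)\<close>.\<close>

lemma primorial_le: "(\<Prod>p | prime p \<and> p \<le> n. p) \<le> (4::nat) ^ n"
proof (induction n rule: less_induct)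
  case (less n)
  have fin: "finite {p. prime p \<and> p \<le> (k::nat)}" for k by (rule finite_subset[of _ "{..k}"]) auto
  consider "n \<le> 1" | "n = 2" | "n > 2" "even n" | m where "n = 2 * m + 1" "m \<ge> 1"
  proof -
    have "n \<le> 1 \<or> n = 2 \<or> (n > 2 \<and> even n) \<or> (\<exists>m. n = 2 * m + 1 \<and> m \<ge> 1)" by presburger
    then show ?thesis using that by blast
  qed
  then show ?case
  proof cases
    case 1
    then have "{p. prime p \<and> p \<le> n} = {}" by (auto dest!: prime_gt_1_nat)
    then show ?thesis by (simp only: prod.empty) simp
  next
    case 2
    then have "{p. prime p \<and> p \<le> n} = {2}" by (auto dest: prime_ge_2_nat)
    then show ?thesis using 2 by (simp only:) simp
  next
    case 3
    then have "{p. prime p \<and> p \<le> n} = {p. prime p \<and> p \<le> n - 1}"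
      using prime_odd_nat[of n] by (auto simp: le_less)
    moreover have "(\<Prod>p | prime p \<and> p \<le> n - 1. p) \<le> (4::nat) ^ (n - 1)"
      by (rule less) (use 3 in auto)
    moreover have "(4::nat) ^ (n - 1) \<le> 4 ^ n" by (rule power_increasing) auto
    ultimately show ?thesis by (metis order.trans)
  next
    case (4 m)
    have split: "{p. prime p \<and> p \<le> n} = {p. prime p \<and> p \<le> m + 1} \<union> {p. prime p \<and> m + 1 < p \<and> p \<le> n}"
      using 4 by auto
    have "(\<Prod>p | prime p \<and> m + 1 < p \<and> p \<le> n. p) dvd (n choose m)"
    proof (rule prod_dvd_of_pairwise_coprime)
      fix p assume p: "p \<in> {p. prime p \<and> m + 1 < p \<and> p \<le> n}"
      have eq: "fact m * fact (m + 1) * (n choose m) = (fact n :: nat)"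
        using binomial_fact_lemma[of m n] 4 by simp
      have "p dvd fact n" using p by (simp add: prime_dvd_fact_iff)
      then have "p dvd fact m \<or> p dvd fact (m + 1) \<or> p dvd (n choose m)"
        using p prime_dvd_mult_iff unfolding eq[symmetric] by blast
      then show "p dvd (n choose m)"
        using p by (auto simp: prime_dvd_fact_iff simp del: fact_Suc)
    qed (auto intro!: primes_coprime finite_subset[OF _ fin[of n]])
    then have "(\<Prod>p | prime p \<and> m + 1 < p \<and> p \<le> n. p) \<le> (n choose m)"
      by (rule dvd_imp_le) (use 4 in auto)
    also have "\<dots> \<le> 4 ^ m" using binomial_odd_central_le 4 by simp
    finally have "(\<Prod>p | prime p \<and> m + 1 < p \<and> p \<le> n. p) \<le> 4 ^ m" .
    moreover have "(\<Prod>p | prime p \<and> p \<le> m + 1. p) \<le> (4::nat) ^ (m + 1)"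
      by (rule less) (use 4 in auto)
    ultimately have "(\<Prod>p | prime p \<and> p \<le> n. p) \<le> 4 ^ (m + 1) * 4 ^ m"
      unfolding split by (subst prod.union_disjoint) (auto intro!: mult_mono fin finite_subset[OF _ fin[of n]])
    also have "\<dots> = 4 ^ n" using 4 by (simp add: power_add mult_2)
    finally show ?thesis .
  qed
qed

section \<open>Prime powers in factorials and elementary logarithmic sums\<close>

lemma power_div_dvd_fact: "p > 0 \<Longrightarrow> p ^ (n div p) dvd (fact n :: nat)"
proof -
  assume p: "p > 0"
  have "(\<Prod>i\<in>{1..n div p}. p * i) = p ^ (n div p) * fact (n div p)"
    by (simp add: prod.distrib fact_prod)
  moreover have "(\<Prod>i\<in>{1..n div p}. p * i) = \<Prod>((\<lambda>i. p * i) ` {1..n div p})"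
    using p by (subst prod.reindex) (auto simp: inj_on_def)
  moreover have "\<Prod>((\<lambda>i. p * i) ` {1..n div p}) dvd \<Prod>{1..n}"
    using p by (intro prod_dvd_prod_subset) (auto simp: less_eq_div_iff_mult_less_eq mult.commute)
  ultimately show ?thesis
    by (metis dvd_mult_left fact_prod of_nat_id)
qed

text \<open>Legendre's formula, obtained by counting the pairs \<open>(m, i)\<close> with
  \<open>p ^ i dvd m\<close> in both orders, and then compared with a geometric series.\<close>

lemma multiplicity_fact_le:
  assumes "prime p"
  shows "real (multiplicity p (fact n :: nat)) \<le> real n / (real p - 1)"
proof -
  have p2: "p \<ge> 2" using assms prime_ge_2_nat by blast
  have v: "multiplicity p m = card {i\<in>{1..n}. p ^ i dvd m}" if "m \<in> {1..n}" for m
  proof -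
    \<comment> \<open>The exponent is smaller than \<open>p ^ multiplicity p m \<le> m\<close>, so
      restricting \<open>i\<close> to \<open>{1..n}\<close> loses nothing.\<close>
    have "multiplicity p m < p ^ multiplicity p m"
      using p2 by (intro power_gt_expt) auto
    also have "\<dots> \<le> m" using that by (intro dvd_imp_le multiplicity_dvd) auto
    finally have "{i\<in>{1..n}. p ^ i dvd m} = {1..multiplicity p m}"
      using that p2 by (subst power_dvd_iff_le_multiplicity) auto
    then show ?thesis by simp
  qed
  have c: "card {m\<in>{1..n}. d dvd m} = n div d" if "d > 0" for d
  proof -
    have "{m\<in>{1..n}. d dvd m} = (\<lambda>i. d * i) ` {1..n div d}"
      using that by (auto simp: less_eq_div_iff_mult_less_eq mult.commute elim!: dvdE)
    then show ?thesis using that by (simp add: card_image inj_on_def)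
  qed
  have "multiplicity p (fact n :: nat) = (\<Sum>m\<in>{1..n}. multiplicity p m)"
    unfolding fact_prod of_nat_id using assms
    by (subst prime_elem_multiplicity_prod_distrib) auto
  also have "\<dots> = (\<Sum>m\<in>{1..n}. card {i\<in>{1..n}. p ^ i dvd m})"
    using v by (intro sum.cong) auto
  also have "\<dots> = (\<Sum>m\<in>{1..n}. \<Sum>i\<in>{1..n}. if p ^ i dvd m then 1 else 0)"
    by (simp add: sum.inter_filter[symmetric])
  also have "\<dots> = (\<Sum>i\<in>{1..n}. \<Sum>m\<in>{1..n}. if p ^ i dvd m then 1 else 0)"
    by (rule sum.swap)
  also have "\<dots> = (\<Sum>i\<in>{1..n}. card {m\<in>{1..n}. p ^ i dvd m})"
    by (simp add: sum.inter_filter[symmetric])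
  also have "\<dots> = (\<Sum>i\<in>{1..n}. n div p ^ i)"
    using p2 by (intro sum.cong refl c) auto
  finally have "real (multiplicity p (fact n :: nat)) = (\<Sum>i\<in>{1..n}. real (n div p ^ i))"
    by simp
  also have "\<dots> \<le> (\<Sum>i\<in>{1..n}. real n * (1 / real p) ^ i)"
  proof (rule sum_mono)
    fix i
    have "real (n div p ^ i) \<le> real n / real (p ^ i)" using of_nat_div_le_of_nat[of n "p ^ i", where 'a = real] .
    then show "real (n div p ^ i) \<le> real n * (1 / real p) ^ i" by (simp add: power_divide)
  qed
  also have "\<dots> = real n * (\<Sum>i\<in>{1..n}. (1 / real p) ^ i)"
    by (simp add: sum_distrib_left)
  also have "(\<Sum>i\<in>{1..n}. (1 / real p) ^ i) \<le> 1 / (real p - 1)"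
  proof -
    have x: "real p * (1 / real p) = 1" using p2 by simp
    have "(real p - 1) * (\<Sum>i\<in>{1..k}. (1 / real p) ^ i) = 1 - (1 / real p) ^ k" for k
    proof (induction k)
      case (Suc k)
      have "(real p - 1) * (1 / real p) ^ Suc k = (1 / real p) ^ k - (1 / real p) ^ Suc k"
        unfolding power_Suc by (metis left_diff_distrib mult.assoc mult_1 x)
      then show ?case using Suc by (simp add: distrib_left)
    qed simp
    then have "(real p - 1) * (\<Sum>i\<in>{1..n}. (1 / real p) ^ i) \<le> 1" by simp
    then show ?thesis using p2 by (simp add: pos_le_divide_eq mult.commute)
  qed
  finally show ?thesis by (simp add: mult_left_mono)
qed

lemma ln_fact_ge: "n \<ge> 1 \<Longrightarrow> real n * ln (real n) - real n \<le> ln (fact n)"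
proof (induction n rule: nat_induct_at_least)
  case (Suc n)
  have "ln ((real n + 1) / real n) \<le> (real n + 1) / real n - 1"
    using Suc by (intro ln_le_minus_one) auto
  then have "real n * (ln (real n + 1) - ln (real n)) \<le> 1"
    using Suc by (simp add: ln_div field_simps)
  moreover have "ln (fact (Suc n) :: real) = ln (real n + 1) + ln (fact n)"
    by (simp add: ln_mult add.commute)
  ultimately show ?case using Suc by (simp add: algebra_simps)
qed auto

text \<open>The subtracted term makes the induction telescope; what is used later is the bound
  2.\<close>

lemma sum_ln_over_mult_pred_le:
  "n \<ge> 1 \<Longrightarrow> (\<Sum>m=2..n. ln (real m) / (real m * (real m - 1))) \<le> 2 - (ln (real n) + 2) / real n"
proof (induction n rule: nat_induct_at_least)
  case (Suc n)
  have "ln ((real n + 1) / real n) \<le> (real n + 1) / real n - 1"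
    using Suc by (intro ln_le_minus_one) auto
  then have "real n * ln (real n + 1) \<le> real n * ln (real n) + 1"
    using Suc by (simp add: ln_div field_simps)
  moreover have "ln (real n + 1) - ln (real n) \<le> 1"
  proof -
    have "ln ((real n + 1) / real n) \<le> (real n + 1) / real n - 1"
      using Suc by (intro ln_le_minus_one) auto
    also have "\<dots> \<le> 1" using Suc by (simp add: field_simps)
    finally show ?thesis using Suc by (simp add: ln_div)
  qed
  ultimately have "ln (real n + 1) / ((real n + 1) * real n) + (ln (real n + 1) + 2) / (real n + 1)
     \<le> (ln (real n) + 2) / real n"
    using Suc by (simp add: divide_simps) (simp add: algebra_simps)
  then show ?case using Suc by (simp add: algebra_simps)
qed auto

section \<open>The two halves of Mertens' theorem and its form on logarithmic intervals\<close>

text \<open>The product of the \<open>p ^ (n div p)\<close> divides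
  \<open>fact n \<le> n ^ n\<close>. Replacing \<open>n div p\<close> by \<open>n / p\<close> adds
  at most one \<open>ln p\<close> per prime, and these add up to at most \<open>n * ln 4\<close> by
  \<open>primorial_le\<close>.\<close>

lemma mertens_upper:
  assumes "n \<ge> 1"
  shows "(\<Sum>p | prime p \<and> p \<le> n. ln (real p) / real p) \<le> ln (real n) + ln 4"
proof -
  let ?P = "{p. prime p \<and> p \<le> n}"
  have fin: "finite ?P" by (rule finite_subset[of _ "{..n}"]) auto
  have pos: "p > 0" if "p \<in> ?P" for p using that prime_gt_0_nat by auto
  have "(\<Prod>p\<in>?P. p ^ (n div p)) dvd fact n"
    by (rule prod_dvd_of_pairwise_coprime)
      (auto intro!: fin primes_coprime power_div_dvd_fact prime_gt_0_nat)
  then have "(\<Prod>p\<in>?P. p ^ (n div p)) \<le> (fact n :: nat)"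
    by (rule dvd_imp_le) auto
  also have "(fact n :: nat) \<le> n ^ n" unfolding fact_prod of_nat_id
    using prod_mono[of "{1..n}" "\<lambda>i. i" "\<lambda>_. n"] by simp
  finally have "(\<Prod>p\<in>?P. p ^ (n div p)) \<le> n ^ n" .
  moreover have "0 < (\<Prod>p\<in>?P. p ^ (n div p))" using pos by (intro prod_pos) simp
  ultimately have "ln (real (\<Prod>p\<in>?P. p ^ (n div p))) \<le> ln (real (n ^ n))"
    by (intro ln_mono) (simp_all only: of_nat_le_iff of_nat_0_less_iff)
  also have "ln (real (n ^ n)) = real n * ln (real n)" by (simp add: ln_realpow)
  also have "ln (real (\<Prod>p\<in>?P. p ^ (n div p))) = (\<Sum>p\<in>?P. real (n div p) * ln (real p))"
    using pos unfolding of_nat_prod of_nat_power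
    by (subst ln_prod) (auto simp: ln_realpow fin)
  finally have 1: "(\<Sum>p\<in>?P. real (n div p) * ln (real p)) \<le> real n * ln (real n)" .
  have "(\<Sum>p\<in>?P. ln (real p)) = ln (real (\<Prod>p\<in>?P. p))"
    unfolding of_nat_prod by (subst ln_prod) (auto simp: fin prime_gt_0_nat)
  also have "\<dots> \<le> ln (real (4 ^ n))"
  proof -
    have "0 < (\<Prod>p\<in>?P. p)" using pos by (intro prod_pos) simp
    then show ?thesis using primorial_le[of n]
      by (intro ln_mono) (simp_all only: of_nat_le_iff of_nat_0_less_iff)
  qed
  also have "\<dots> = real n * ln 4" by (simp add: ln_realpow)
  finally have 2: "(\<Sum>p\<in>?P. ln (real p)) \<le> real n * ln 4" .
  have "real n * (\<Sum>p\<in>?P. ln (real p) / real p) = (\<Sum>p\<in>?P. real n / real p * ln (real p))"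
    by (simp add: sum_distrib_left)
  also have "\<dots> \<le> (\<Sum>p\<in>?P. real (n div p) * ln (real p) + ln (real p))"
  proof (rule sum_mono)
    fix p assume p: "p \<in> ?P"
    have "real n / real p \<le> real (n div p) + 1"
    proof -
      have "real n = real (n div p) * real p + real (n mod p)"
        by (metis div_mult_mod_eq of_nat_add of_nat_mult)
      moreover have "real (n mod p) \<le> real p" using pos[OF p] by (simp add: less_imp_le)
      ultimately show ?thesis using pos[OF p] by (simp add: field_simps)
    qed
    then have "real n / real p * ln (real p) \<le> (real (n div p) + 1) * ln (real p)"
      using pos[OF p] by (intro mult_right_mono) auto
    then show "real n / real p * ln (real p) \<le> real (n div p) * ln (real p) + ln (real p)"
      by (simp add: algebra_simps)
  qed
  also have "\<dots> \<le> real n * (ln (real n) + ln 4)"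
    using 1 2 by (simp add: sum.distrib algebra_simps)
  finally show ?thesis using assms by simp
qed

text \<open>Take logarithms in the factorization of \<open>fact n\<close> and bound the exponents by
  \<open>n / (p - 1)\<close>. Since \<open>1 / (p - 1) = 1 / p + 1 / (p * (p - 1))\<close>, the
  constant 3 is 1 from \<open>ln_fact_ge\<close> plus 2 from the convergent series.\<close>

lemma mertens_lower:
  assumes "n \<ge> 1"
  shows "(\<Sum>p | prime p \<and> p \<le> n. ln (real p) / real p) \<ge> ln (real n) - 3"
proof -
  let ?P = "{p. prime p \<and> p \<le> n}"
  have fin: "finite ?P" by (rule finite_subset[of _ "{..n}"]) auto
  have p2: "p \<ge> 2" if "p \<in> ?P" for p using that prime_ge_2_nat by auto
  have "(fact n :: nat) = (\<Prod>p\<in>prime_factors (fact n). p ^ multiplicity p (fact n))"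
    by (rule prime_factorization_nat) auto
  also have "prime_factors (fact n :: nat) = ?P"
    by (auto simp: prime_factors_dvd prime_dvd_fact_iff)
  finally have "ln (real (fact n)) = ln (real (\<Prod>p\<in>?P. p ^ multiplicity p (fact n)))"
    by (rule arg_cong)
  moreover have "ln (real (\<Prod>p\<in>?P. p ^ multiplicity p (fact n))) = (\<Sum>p\<in>?P. real (multiplicity p (fact n :: nat)) * ln (real p))"
    unfolding of_nat_prod of_nat_power using p2
    by (subst ln_prod) (fastforce simp: ln_realpow)+
  moreover have "(\<Sum>p\<in>?P. real (multiplicity p (fact n :: nat)) * ln (real p)) \<le> (\<Sum>p\<in>?P. real n / (real p - 1) * ln (real p))"
  proof (rule sum_mono)
    fix p assume "p \<in> ?P"
    then have "prime p" by simp
    show "real (multiplicity p (fact n :: nat)) * ln (real p) \<le> real n / (real p - 1) * ln (real p)"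
      by (rule mult_right_mono[OF multiplicity_fact_le[OF \<open>prime p\<close>] ln_prime_nonneg[OF \<open>prime p\<close>]])
  qed
  moreover have "(\<Sum>p\<in>?P. real n / (real p - 1) * ln (real p))
    = real n * (\<Sum>p\<in>?P. ln (real p) / real p) + real n * (\<Sum>p\<in>?P. ln (real p) / (real p * (real p - 1)))"
    unfolding sum_distrib_left sum.distrib[symmetric]
  proof (intro sum.cong refl)
    fix p assume "p \<in> ?P"
    then have "p > 1" by (simp add: prime_gt_1_nat del: One_nat_def)
    then have "real p > 1" by simp
    then show "real n / (real p - 1) * ln (real p) = real n * (ln (real p) / real p) + real n * (ln (real p) / (real p * (real p - 1)))"
      by (simp add: divide_simps) (simp add: algebra_simps)
  qed
  moreover have "(\<Sum>p\<in>?P. ln (real p) / (real p * (real p - 1))) \<le> 2"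
  proof -
    have "(\<Sum>p\<in>?P. ln (real p) / (real p * (real p - 1))) \<le> (\<Sum>m=2..n. ln (real m) / (real m * (real m - 1)))"
      by (rule sum_mono2) (auto simp: prime_ge_2_nat)
    moreover have "(ln (real n) + 2) / real n \<ge> 0" using assms by simp
    ultimately show ?thesis using sum_ln_over_mult_pred_le[OF assms] by linarith
  qed
  then have "real n * (\<Sum>p\<in>?P. ln (real p) / (real p * (real p - 1))) \<le> real n * 2"
    by (intro mult_left_mono) auto
  ultimately have "ln (fact n) \<le> real n * (\<Sum>p\<in>?P. ln (real p) / real p) + real n * 2"
    unfolding of_nat_fact by linarith
  with ln_fact_ge[OF assms] have "real n * (ln (real n) - 3) \<le> real n * (\<Sum>p\<in>?P. ln (real p) / real p)"
    by (simp add: algebra_simps)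
  then show ?thesis using assms by simp
qed

text \<open>A difference of two Mertens sums. The constant collects 3 and
  \<open>ln 4 \<le> 2\<close> from the two halves and \<open>ln 2 \<le> 1\<close> from rounding an
  endpoint \<open>exp c\<close> to an integer.\<close>

lemma mertens_interval:
  fixes a b :: real
  assumes "0 \<le> a" "a \<le> b"
  shows "\<bar>(\<Sum>p | prime p \<and> a < ln (real p) \<and> ln (real p) \<le> b. ln (real p) / real p) - (b - a)\<bar> \<le> 6"
proof -
  define M where "M = (\<lambda>n. \<Sum>p | prime p \<and> p \<le> n. ln (real p) / real p)"
  define fl where "fl = (\<lambda>c::real. nat \<lfloor>exp c\<rfloor>)"
  have fin: "finite {p. prime p \<and> p \<le> (k::nat)}" for k by (rule finite_subset[of _ "{..k}"]) auto
  have fl_iff: "ln (real p) \<le> c \<longleftrightarrow> p \<le> fl c" if "prime p" for p c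
  proof -
    have "ln (real p) \<le> c \<longleftrightarrow> real p \<le> exp c"
      using prime_gt_0_nat[OF that] by (metis exp_le_cancel_iff exp_ln of_nat_0_less_iff)
    also have "\<dots> \<longleftrightarrow> p \<le> fl c" unfolding fl_def by (simp add: le_nat_floor le_nat_iff le_floor_iff)
    finally show ?thesis .
  qed
  have bd: "fl c \<ge> 1 \<and> c - ln 2 \<le> ln (real (fl c)) \<and> ln (real (fl c)) \<le> c" if "c \<ge> 0" for c
  proof -
    have e: "exp c \<ge> 1" using that by simp
    then have 1: "fl c \<ge> 1" unfolding fl_def by (simp add: le_nat_iff)
    have "real (fl c) \<le> exp c" using e by (simp add: fl_def)
    then have 2: "ln (real (fl c)) \<le> c" using 1 by (metis ln_exp ln_mono of_nat_0_less_iff not_gr_zero not_one_le_zero)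
    have "exp c \<le> real (fl c) + 1" using e unfolding fl_def by linarith
    also have "\<dots> \<le> 2 * real (fl c)" using 1 by simp
    finally have "ln (exp c) \<le> ln (2 * real (fl c))" by (rule ln_mono) auto
    then show ?thesis using 1 2 by (simp add: ln_mult)
  qed
  have "fl a \<le> fl b" unfolding fl_def using assms by (intro nat_mono floor_mono) auto
  then have "{p. prime p \<and> p \<le> fl b} = {p. prime p \<and> a < ln (real p) \<and> ln (real p) \<le> b} \<union> {p. prime p \<and> p \<le> fl a}"
    using fl_iff by (auto simp flip: not_le)
  moreover have "{p. prime p \<and> a < ln (real p) \<and> ln (real p) \<le> b} \<inter> {p. prime p \<and> p \<le> fl a} = {}"
    using fl_iff by (auto simp flip: not_le)
  moreover have "finite {p. prime p \<and> a < ln (real p) \<and> ln (real p) \<le> b}"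
    by (rule finite_subset[OF _ fin[of "fl b"]]) (use fl_iff in auto)
  ultimately have "M (fl b) = (\<Sum>p | prime p \<and> a < ln (real p) \<and> ln (real p) \<le> b. ln (real p) / real p) + M (fl a)"
    unfolding M_def by (simp add: sum.union_disjoint fin)
  moreover have "ln (2::real) \<le> 1" "ln (4::real) \<le> 2"
  proof -
    show "ln (2::real) \<le> 1" using ln_le_minus_one[of 2] by simp
    then show "ln (4::real) \<le> 2" using ln_realpow[of 2 2] by simp
  qed
  moreover have "ln (real (fl a)) - 3 \<le> M (fl a)" "M (fl a) \<le> ln (real (fl a)) + ln 4"
    "ln (real (fl b)) - 3 \<le> M (fl b)" "M (fl b) \<le> ln (real (fl b)) + ln 4"
    unfolding M_def using bd assms by (auto intro!: mertens_lower mertens_upper)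
  moreover have "a - ln 2 \<le> ln (real (fl a))" "ln (real (fl a)) \<le> a"
    "b - ln 2 \<le> ln (real (fl b))" "ln (real (fl b)) \<le> b"
    using bd[of a] bd[of b] assms by auto
  ultimately show ?thesis by linarith
qed

lemma sum_ln_prime_factors_le:
  assumes "n > 0"
  shows "(\<Sum>p\<in>prime_factors n. ln (real p)) \<le> ln (real n)"
proof -
  have pos: "p > 0" if "p \<in> prime_factors n" for p using that by (metis in_prime_factors_iff prime_gt_0_nat)
  have "(\<Prod>p\<in>prime_factors n. p) dvd n"
    by (rule prod_dvd_of_pairwise_coprime) (auto simp: prime_factors_dvd intro: primes_coprime)
  then have "(\<Prod>p\<in>prime_factors n. p) \<le> n" by (rule dvd_imp_le) fact
  then have "ln (real (\<Prod>p\<in>prime_factors n. p)) \<le> ln (real n)"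
    using pos by (intro ln_mono) (simp_all only: of_nat_le_iff of_nat_0_less_iff prod_pos)
  then show ?thesis using pos by (simp add: ln_prod)
qed

text \<open>The omitted primes divide \<open>q\<close> and exceed \<open>exp a\<close>, so their
  terms sum to at most \<open>ln q / exp a \<le> 1\<close>; this raises the error from 6 to
  7.\<close>

lemma mertens_interval_coprime:
  fixes a b :: real
  assumes "0 \<le> a" "a \<le> b" "q > 0" "ln (real q) \<le> exp a"
  shows "finite {p. prime p \<and> \<not> p dvd q \<and> a < ln (real p) \<and> ln (real p) \<le> b}"
    "\<bar>(\<Sum>p | prime p \<and> \<not> p dvd q \<and> a < ln (real p) \<and> ln (real p) \<le> b. ln (real p) / real p) - (b - a)\<bar> \<le> 7"
proof -
  let ?P = "{p. prime p \<and> a < ln (real p) \<and> ln (real p) \<le> b}"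
  let ?Q = "{p. prime p \<and> \<not> p dvd q \<and> a < ln (real p) \<and> ln (real p) \<le> b}"
  let ?R = "{p. prime p \<and> p dvd q \<and> a < ln (real p) \<and> ln (real p) \<le> b}"
  have finP: "finite ?P"
  proof (rule finite_subset)
    show "?P \<subseteq> {..nat \<lfloor>exp b\<rfloor>}"
    proof
      fix p assume p: "p \<in> ?P"
      then have "real p > 0" "ln (real p) \<le> b" by (auto simp: prime_gt_0_nat)
      then have "real p \<le> exp b" by (metis exp_ln exp_le_cancel_iff)
      then show "p \<in> {..nat \<lfloor>exp b\<rfloor>}" by (simp add: le_nat_iff le_floor_iff)
    qed
  qed auto
  then show "finite ?Q" by (rule rev_finite_subset) auto
  have fin: "finite ?Q" "finite ?R" by (rule finite_subset[OF _ finP], auto)+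
  have "?P = ?Q \<union> ?R" by auto
  then have "(\<Sum>p\<in>?P. ln (real p) / real p) = (\<Sum>p\<in>?Q \<union> ?R. ln (real p) / real p)"
    by (rule arg_cong)
  also have "\<dots> = (\<Sum>p\<in>?Q. ln (real p) / real p) + (\<Sum>p\<in>?R. ln (real p) / real p)"
    by (rule sum.union_disjoint[OF fin]) auto
  finally have "(\<Sum>p\<in>?P. ln (real p) / real p) = (\<Sum>p\<in>?Q. ln (real p) / real p) + (\<Sum>p\<in>?R. ln (real p) / real p)" .
  moreover have "(\<Sum>p\<in>?R. ln (real p) / real p) \<ge> 0"
    by (rule sum_nonneg) (auto simp: ln_prime_nonneg)
  moreover have "(\<Sum>p\<in>?R. ln (real p) / real p) \<le> 1"
  proof -
    have "(\<Sum>p\<in>?R. ln (real p) / real p) \<le> (\<Sum>p\<in>?R. ln (real p) / exp a)"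
    proof (intro sum_mono divide_left_mono)
      fix p assume p: "p \<in> ?R"
      then have p0: "real p > 0" "a \<le> ln (real p)" by (auto simp: prime_gt_0_nat)
      then show "exp a \<le> real p" by (metis exp_ln exp_le_cancel_iff)
      show "0 \<le> ln (real p)" using p assms by simp
      show "0 < real p * exp a" using p0 by auto
    qed
    also have "\<dots> = (\<Sum>p\<in>?R. ln (real p)) / exp a" by (simp add: sum_divide_distrib)
    also have "(\<Sum>p\<in>?R. ln (real p)) \<le> (\<Sum>p\<in>prime_factors q. ln (real p))"
      using assms by (intro sum_mono2) (auto simp: prime_factors_dvd ln_prime_nonneg)
    also have "\<dots> \<le> exp a" using sum_ln_prime_factors_le[OF assms(3)] assms(4) by simp
    finally show ?thesis by (simp add: divide_right_mono)
  qed
  ultimately show "\<bar>(\<Sum>p\<in>?Q. ln (real p) / real p) - (b - a)\<bar> \<le> 7"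
    using mertens_interval[OF assms(1,2)] by linarith
qed

section \<open>Dirichlet characters\<close>

lemma coprime_add_self_iff: "coprime (n + q) q \<longleftrightarrow> coprime n (q::nat)"
  unfolding coprime_iff_gcd_eq_1 by (simp only: gcd_add1)

text \<open>A character of a subgroup of the units modulo \<open>q\<close>, the subgroup being represented by the set \<open>H\<close>
  of all natural numbers whose residue lies in it.\<close>

definition partial_char :: "nat \<Rightarrow> nat set \<Rightarrow> (nat \<Rightarrow> complex) \<Rightarrow> bool" where
  "partial_char q H f \<longleftrightarrow>
     (\<forall>m\<in>H. coprime m q) \<and> 1 \<in> H \<and> f 1 = 1 \<and>
     (\<forall>m\<in>H. \<forall>n\<in>H. m * n \<in> H \<and> f (m * n) = f m * f n) \<and>
     (\<forall>m\<in>H. \<forall>n. [m = n] (mod q) \<longrightarrow> n \<in> H \<and> f n = f m)"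

lemma partial_charD:
  assumes "partial_char q H f"
  shows "1 \<in> H" "f 1 = 1" "m \<in> H \<Longrightarrow> coprime m q"
    "m \<in> H \<Longrightarrow> n \<in> H \<Longrightarrow> m * n \<in> H" "m \<in> H \<Longrightarrow> n \<in> H \<Longrightarrow> f (m * n) = f m * f n"
    "m \<in> H \<Longrightarrow> [m = n] (mod q) \<Longrightarrow> n \<in> H" "m \<in> H \<Longrightarrow> [m = n] (mod q) \<Longrightarrow> f n = f m"
  using assms unfolding partial_char_def by blast+

lemma partial_char_power:
  assumes "partial_char q H f" "h \<in> H"
  shows "h ^ k \<in> H \<and> f (h ^ k) = f h ^ k"
proof (induction k)
  case 0
  show ?case using partial_charD(1,2)[OF assms(1)] by simp
next
  case (Suc k)
  then show ?case using partial_charD(4,5)[OF assms(1,2)] by simp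
qed

text \<open>For \<open>q > 0\<close> the power \<open>h ^ (totient q - 1)\<close> lies in
  \<open>H\<close> and inverts \<open>h\<close> modulo \<open>q\<close>.\<close>

lemma partial_char_cancel:
  assumes "partial_char q H f" "h \<in> H" "h * x \<in> H"
  shows "x \<in> H"
proof -
  note D = partial_charD[OF assms(1)]
  have "coprime h q" by (rule D) fact
  show ?thesis
  proof (cases "q = 0")
    case True
    then have "h = 1" using \<open>coprime h q\<close> by simp
    then show ?thesis using assms by simp
  next
    case False
    have "h ^ (totient q - 1) * (h * x) \<in> H"
      using partial_char_power[OF assms(1,2)] D(4) assms(3) by blast
    moreover have "h ^ (totient q - 1) * (h * x) = h ^ totient q * x"
      using False by (cases "totient q") auto
    moreover have "[h ^ totient q * x = 1 * x] (mod q)"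
      by (intro cong_mult euler_theorem \<open>coprime h q\<close> cong_refl)
    ultimately show ?thesis by (metis D(6) mult_1)
  qed
qed

text \<open>Adjoins \<open>a\<close>, whose order modulo the subgroup is \<open>d\<close>. Sending
  \<open>h * a ^ i\<close> to \<open>f h * z ^ i\<close> is consistent because \<open>a ^ e\<close>
  lies in \<open>H\<close> only for multiples \<open>e\<close> of \<open>d\<close>, and there
  \<open>f\<close> already takes the value \<open>z ^ e\<close>.\<close>

lemma partial_char_extend:
  assumes pc: "partial_char q H f" and a: "coprime a q" and d: "d > 0" "a ^ d \<in> H"
    and least: "\<And>e. 0 < e \<Longrightarrow> e < d \<Longrightarrow> a ^ e \<notin> H" and z: "z ^ d = f (a ^ d)"
  obtains H' f' where "partial_char q H' f'" "H \<subseteq> H'" "a \<in> H'" "f' a = z" "\<And>h. h \<in> H \<Longrightarrow> f' h = f h"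
proof -
  note D = partial_charD[OF pc]
  have pow: "f (a ^ e) = z ^ e" if e: "a ^ e \<in> H" for e
  proof -
    have eq: "a ^ e = (a ^ d) ^ (e div d) * a ^ (e mod d)"
      by (metis mult_div_mod_eq power_add power_mult)
    have "a ^ (e mod d) \<in> H"
      using partial_char_cancel[OF pc] partial_char_power[OF pc d(2)] e eq by metis
    then have "e mod d = 0" using least d(1) by (metis mod_less_divisor neq0_conv)
    then have "e = d * (e div d)" by (metis add.right_neutral mult_div_mod_eq)
    then show ?thesis
      using partial_char_power[OF pc d(2)] z by (metis power_mult)
  qed
  \<comment> \<open>By symmetry it is enough to treat \<open>i \<le> j\<close>, where cancelling
    \<open>a ^ i\<close> puts \<open>a ^ (j - i)\<close> into \<open>H\<close>.\<close>
  have wd1: "f h * z ^ i = f h' * z ^ j"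
    if h: "h \<in> H" "h' \<in> H" and c: "[h * a ^ i = h' * a ^ j] (mod q)" and ij: "i \<le> j" for h h' i j
  proof -
    have "[a ^ i * h = a ^ i * (h' * a ^ (j - i))] (mod q)"
      using c ij by (simp add: mult_ac flip: power_add)
    then have hc: "[h = h' * a ^ (j - i)] (mod q)"
      using a by (metis cong_mult_lcancel_nat coprime_power_left_iff)
    then have "h' * a ^ (j - i) \<in> H" and 1: "f (h' * a ^ (j - i)) = f h"
      using D(6,7)[OF h(1)] by blast+
    then have aH: "a ^ (j - i) \<in> H" using partial_char_cancel[OF pc] h by blast
    then have "f (h' * a ^ (j - i)) = f h' * z ^ (j - i)"
      using pow[OF aH] D(5)[OF h(2) aH] by simp
    then show ?thesis using 1 ij by (simp add: mult.assoc flip: power_add)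
  qed
  have wd: "f h * z ^ i = f h' * z ^ j"
    if "h \<in> H" "h' \<in> H" "[h * a ^ i = h' * a ^ j] (mod q)" for h h' i j
    using wd1[of h h' i j] wd1[of h' h j i] that by (metis cong_sym nle_le)
  define H' where "H' = {n. \<exists>h\<in>H. \<exists>i. [n = h * a ^ i] (mod q)}"
  define f' where "f' = (\<lambda>n. SOME w. \<exists>h\<in>H. \<exists>i. [n = h * a ^ i] (mod q) \<and> w = f h * z ^ i)"
  have f': "f' n = f h * z ^ i" if h: "h \<in> H" and c: "[n = h * a ^ i] (mod q)" for n h i
    unfolding f'_def
  proof (rule some_equality)
    show "\<exists>h'\<in>H. \<exists>j. [n = h' * a ^ j] (mod q) \<and> f h * z ^ i = f h' * z ^ j" using h c by blast
  next
    fix w assume "\<exists>h'\<in>H. \<exists>j. [n = h' * a ^ j] (mod q) \<and> w = f h' * z ^ j"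
    then obtain h' j where "h' \<in> H" "[n = h' * a ^ j] (mod q)" "w = f h' * z ^ j" by blast
    then show "w = f h * z ^ i" using wd[OF h, of h' i j] c by (metis cong_sym cong_trans)
  qed
  note one = D(1,2)
  have HH: "h \<in> H' \<and> f' h = f h" if "h \<in> H" for h
    using f'[OF that, of h 0] that unfolding H'_def by (auto intro!: bexI[of _ h] exI[of _ 0])
  have aa: "a \<in> H' \<and> f' a = z"
    using f'[OF one(1), of a 1] one unfolding H'_def by (auto intro!: bexI[of _ 1] exI[of _ 1])
  have "partial_char q H' f'"
    unfolding partial_char_def
  proof (intro conjI ballI allI impI)
    fix m assume "m \<in> H'"
    then obtain h i where h: "h \<in> H" "[m = h * a ^ i] (mod q)" unfolding H'_def by blast
    moreover have "coprime (h * a ^ i) q" using D(3)[OF h(1)] a by simp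
    ultimately show "coprime m q" using cong_imp_coprime cong_sym by blast
  next
    show "1 \<in> H'" "f' 1 = 1" using HH one by auto
  next
    fix m n assume "m \<in> H'" "n \<in> H'"
    then obtain h i h' j where h: "h \<in> H" "[m = h * a ^ i] (mod q)" "h' \<in> H" "[n = h' * a ^ j] (mod q)"
      unfolding H'_def by blast
    have hh: "h * h' \<in> H" "f (h * h') = f h * f h'" using h D(4,5) by blast+
    have "[m * n = (h * a ^ i) * (h' * a ^ j)] (mod q)" by (rule cong_mult) (use h in auto)
    then have c: "[m * n = (h * h') * a ^ (i + j)] (mod q)" by (simp add: power_add mult_ac)
    then show "m * n \<in> H'" unfolding H'_def using hh by blast
    show "f' (m * n) = f' m * f' n"
      using f'[OF hh(1) c] f'[OF h(1,2)] f'[OF h(3,4)] hh by (simp add: power_add)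
  next
    fix m n assume "m \<in> H'" and c: "[m = n] (mod q)"
    then obtain h i where h: "h \<in> H" "[m = h * a ^ i] (mod q)" unfolding H'_def by blast
    then have c': "[n = h * a ^ i] (mod q)" using c cong_sym cong_trans by blast
    then show "n \<in> H'" "f' n = f' m" unfolding H'_def using h f' by auto
  qed
  with HH aa show ?thesis using that by blast
qed

lemma complex_root_exists: "d > 0 \<Longrightarrow> \<exists>z::complex. z ^ d = w"
proof (cases "w = 0")
  case False
  assume "d > 0"
  then have "exp (Ln w / of_nat d) ^ d = w"
    using False by (simp flip: exp_of_nat_mult)
  then show ?thesis by blast
qed (auto simp: power_0_left intro!: exI[of _ 0])

lemma dirichlet_char_cong:
  assumes "dirichlet_char q chi" "[m = n] (mod q)"
  shows "chi m = chi n"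
proof -
  have "chi (m + k * q) = chi m" for m k
  proof (induction k)
    case (Suc k)
    have "chi (m + k * q + q) = chi (m + k * q)" using assms(1) unfolding dirichlet_char_def by blast
    then show ?case using Suc by (simp add: algebra_simps)
  qed auto
  then show ?thesis using assms(2) by (metis cong_iff_lin_nat)
qed

text \<open>Induction on the number of reduced residues outside \<open>H\<close>: adjoin a missing
  unit, with any \<open>d\<close>-th root as its value. Once \<open>H\<close> contains all units,
  extend by 0.\<close>

lemma partial_char_complete:
  assumes "partial_char q H f" "q > 0"
  obtains chi where "dirichlet_char q chi" "\<And>h. h \<in> H \<Longrightarrow> chi h = f h"
proof -
  have "\<exists>chi. dirichlet_char q chi \<and> (\<forall>h\<in>H. chi h = f h)"
    using assms(1)
  proof (induction "card (totatives q - H)" arbitrary: H f rule: less_induct)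
    case less
    note pc = less.prems
    note D = partial_charD[OF pc]
    show ?case
    proof (cases "\<exists>a. coprime a q \<and> a \<notin> H")
      case False
      define chi where "chi = (\<lambda>n. if coprime n q then f n else 0)"
      \<comment> \<open>A Dirichlet character must vanish exactly off the units; on a unit the
        \<open>totient q\<close>-th power of the value is 1 by Euler's theorem.\<close>
      have nz: "f n \<noteq> 0" if "coprime n q" for n
      proof -
        have "n \<in> H" using that False by blast
        then have "f n ^ totient q = f (n ^ totient q)" using partial_char_power[OF pc] by simp
        also have "\<dots> = f 1"
          using euler_theorem[OF that] D(1,7) by (metis cong_sym)
        finally show ?thesis using D(2) \<open>q > 0\<close> by (auto simp: power_0_left)
      qed
      have "chi (n + q) = chi n" for n
      proof -
        have "coprime (n + q) q \<longleftrightarrow> coprime n q" by (rule coprime_add_self_iff)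
        moreover have "f (n + q) = f n" if "coprime n q"
          by (rule D(7)) (use that False in \<open>auto simp: cong_def\<close>)
        ultimately show ?thesis by (auto simp: chi_def)
      qed
      moreover have "chi (m * n) = chi m * chi n" for m n
        using D(5)[of m n] False unfolding chi_def by auto
      moreover have "chi 1 = 1" using D(2) by (simp add: chi_def)
      moreover have "chi n = 0 \<longleftrightarrow> \<not> coprime n q" for n using nz by (auto simp: chi_def)
      moreover have "chi h = f h" if "h \<in> H" for h using D(3) that by (simp add: chi_def)
      ultimately show ?thesis unfolding dirichlet_char_def by blast
    next
      case True
      then obtain a where a: "coprime a q" "a \<notin> H" by blast
      have ex: "totient q > 0 \<and> a ^ totient q \<in> H"
        using euler_theorem[OF a(1)] \<open>q > 0\<close> D(1,6) by (metis cong_sym totient_gt_0_iff)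
      define d where "d = (LEAST d. d > 0 \<and> a ^ d \<in> H)"
      have d: "d > 0" "a ^ d \<in> H" unfolding d_def using LeastI[of "\<lambda>d. d > 0 \<and> a ^ d \<in> H", OF ex] by auto
      have least: "a ^ e \<notin> H" if "0 < e" "e < d" for e
        using not_less_Least[of e "\<lambda>d. d > 0 \<and> a ^ d \<in> H"] that unfolding d_def by auto
      obtain z where z: "z ^ d = f (a ^ d)" using complex_root_exists[OF d(1)] by blast
      obtain H' f' where H': "partial_char q H' f'" "H \<subseteq> H'" "a \<in> H'" "\<And>h. h \<in> H \<Longrightarrow> f' h = f h"
        using partial_char_extend[OF pc a(1) d least z] by metis
      \<comment> \<open>The induction counts representatives in \<open>totatives q\<close>, so
        \<open>a\<close> is replaced by its residue; for \<open>q = 1\<close> the representative is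
        1 and not \<open>a mod q = 0\<close>.\<close>
      obtain b where b: "b \<in> totatives q" "[a = b] (mod q)"
      proof (cases "q = 1")
        case True
        then show ?thesis using that[of 1] by simp
      next
        case False
        have "coprime (a mod q) q" using a(1) \<open>q > 0\<close> by (simp add: coprime_mod_left_iff)
        moreover from this have "a mod q \<noteq> 0" using False by (intro notI) simp
        ultimately have "a mod q \<in> totatives q"
          using \<open>q > 0\<close> by (simp add: in_totatives_iff less_imp_le)
        then show ?thesis using that by simp
      qed
      have "b \<notin> H" using a(2) b(2) D(6) by (metis cong_sym)
      moreover have "b \<in> H'" using partial_charD(6)[OF H'(1,3) b(2)] .
      ultimately have "totatives q - H' \<subset> totatives q - H" using b(1) H'(2) by blast
      then have "card (totatives q - H') < card (totatives q - H)"
        by (intro psubset_card_mono) auto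
      from less.hyps[OF this H'(1)] H' show ?thesis by (metis subset_iff)
    qed
  qed
  then show ?thesis using that by blast
qed

text \<open>Start from the trivial subgroup and send \<open>a\<close> to a primitive root of unity of its order.\<close>

lemma dirichlet_char_separates:
  assumes "q > 0" "coprime a q" "\<not> [a = 1] (mod q)"
  obtains chi where "dirichlet_char q chi" "chi a \<noteq> 1"
proof -
  define H where "H = {n. [n = 1] (mod q)}"
  have pc: "partial_char q H (\<lambda>_. 1)"
    unfolding partial_char_def H_def mem_Collect_eq Ball_def
  proof (intro conjI allI impI)
    fix m n assume m: "[m = 1] (mod q)"
    then show "coprime m q" using cong_imp_coprime[OF cong_sym[OF m]] by simp
    show "[m * n = 1] (mod q)" if "[n = 1] (mod q)" using cong_mult[OF m that] by simp
    show "[n = 1] (mod q)" if "[m = n] (mod q)" using cong_trans[OF cong_sym[OF that] m] .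
  qed auto
  have ex: "totient q > 0 \<and> a ^ totient q \<in> H"
    using euler_theorem[OF assms(2)] assms(1) by (auto simp: H_def)
  define d where "d = (LEAST d. d > 0 \<and> a ^ d \<in> H)"
  have d: "d > 0" "a ^ d \<in> H" unfolding d_def using LeastI[of "\<lambda>d. d > 0 \<and> a ^ d \<in> H", OF ex] by auto
  have least: "a ^ e \<notin> H" if "0 < e" "e < d" for e
    using not_less_Least[of e "\<lambda>d. d > 0 \<and> a ^ d \<in> H"] that unfolding d_def by auto
  have "d \<noteq> 1" using d(2) assms(3) by (auto simp: H_def)
  then have d2: "d \<ge> 2" using d(1) by simp
  define z where "z = cis (2 * pi / real d)"
  have zd: "z ^ d = 1" unfolding z_def Complex.DeMoivre using d(1) by simp
  have "z \<noteq> 1"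
  proof
    assume "z = 1"
    then have "cos (2 * pi / real d) = 1" by (simp add: z_def complex_eq_iff)
    moreover have "cos (2 * pi / real d) < cos 0"
    proof (rule cos_monotone_0_pi)
      show "2 * pi / real d \<le> pi" using d2 by (simp add: field_simps)
    qed (use d2 in auto)
    ultimately show False by simp
  qed
  obtain H' f' where H': "partial_char q H' f'" "a \<in> H'" "f' a = z"
    using partial_char_extend[OF pc assms(2) d least, of z] zd by metis
  obtain chi where "dirichlet_char q chi" "\<And>h. h \<in> H' \<Longrightarrow> chi h = f' h"
    using partial_char_complete[OF H'(1) assms(1)] by metis
  then show ?thesis using that H' \<open>z \<noteq> 1\<close> by metis
qed

section \<open>Values of characters and finiteness of the character group\<close>

lemma dirichlet_char_power_totient:
  assumes "dirichlet_char q chi" "coprime a q"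
  shows "chi a ^ totient q = 1"
proof -
  have "chi (a ^ k) = chi a ^ k" for k
    using assms(1) by (induction k) (auto simp: dirichlet_char_def)
  then show ?thesis
    using dirichlet_char_cong[OF assms(1) euler_theorem[OF assms(2)]] assms(1) by (simp add: dirichlet_char_def)
qed

lemma norm_dirichlet_char:
  assumes "dirichlet_char q chi" "coprime a q" "q > 0"
  shows "cmod (chi a) = 1"
proof -
  have "cmod (chi a) ^ totient q = 1"
    using dirichlet_char_power_totient[OF assms(1,2)] by (metis norm_one norm_power)
  then show ?thesis using assms(3) by (intro power_eq_imp_eq_base[of _ "totient q" 1]) auto
qed

lemma norm_dirichlet_char_le:
  assumes "dirichlet_char q chi" "q > 0"
  shows "cmod (chi a) \<le> 1"
proof (cases "coprime a q")
  case False
  then have "chi a = 0" using assms(1) by (simp add: dirichlet_char_def)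
  then show ?thesis by simp
qed (simp add: norm_dirichlet_char[OF assms(1) _ assms(2)])

lemma dirichlet_char_mult_cnj:
  assumes "dirichlet_char q chi" "coprime a q" "q > 0"
  shows "cnj (chi a) * chi a = 1"
  using norm_dirichlet_char[OF assms] by (simp add: complex_norm_square[symmetric] mult.commute)

lemma dirichlet_char_times:
  "dirichlet_char q chi \<Longrightarrow> dirichlet_char q psi \<Longrightarrow> dirichlet_char q (\<lambda>n. chi n * psi n)"
  by (auto simp: dirichlet_char_def)

lemma dirichlet_char_cnj: "dirichlet_char q chi \<Longrightarrow> dirichlet_char q (\<lambda>n. cnj (chi n))"
  by (auto simp: dirichlet_char_def)

lemma dirichlet_char_principal: "dirichlet_char q (principal_char q)"
  by (auto simp: dirichlet_char_def principal_char_def coprime_add_self_iff)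

text \<open>A character is determined by its values below \<open>q\<close>, each of which is 0 or a
  \<open>totient q\<close>-th root of unity.\<close>

lemma finite_dirichlet_chars:
  assumes "q > 0"
  shows "finite {chi. dirichlet_char q chi}"
proof (rule inj_on_finite)
  show "inj_on (\<lambda>chi. restrict chi {..<q}) {chi. dirichlet_char q chi}"
  proof (rule inj_onI)
    fix chi psi assume c: "chi \<in> {chi. dirichlet_char q chi}" "psi \<in> {chi. dirichlet_char q chi}"
      and e: "restrict chi {..<q} = restrict psi {..<q}"
    show "chi = psi"
    proof
      fix n
      have "chi n = chi (n mod q)" using c by (intro dirichlet_char_cong) auto
      also have "\<dots> = psi (n mod q)" using fun_cong[OF e, of "n mod q"] assms by simp
      also have "\<dots> = psi n" using c by (intro dirichlet_char_cong) auto
      finally show "chi n = psi n" .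
    qed
  qed
  show "(\<lambda>chi. restrict chi {..<q}) ` {chi. dirichlet_char q chi} \<subseteq> (\<Pi>\<^sub>E n\<in>{..<q}. insert 0 {z. z ^ totient q = 1})"
  proof (intro image_subsetI restrict_PiE_iff[THEN iffD2] ballI)
    fix chi n assume "chi \<in> {chi. dirichlet_char q chi}"
    then show "chi n \<in> insert 0 {z. z ^ totient q = 1}"
      using dirichlet_char_power_totient[of q chi n] by (cases "coprime n q") (auto simp: dirichlet_char_def)
  qed
  show "finite (\<Pi>\<^sub>E n\<in>{..<q}. insert 0 {z::complex. z ^ totient q = 1})"
    using assms by (intro finite_PiE) (auto intro!: finite_roots_unity simp: Suc_le_eq)
qed

section \<open>Orthogonality relations\<close>

lemma sum_totatives_mult:
  fixes g :: "nat \<Rightarrow> 'a :: comm_monoid_add"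
  assumes "q > 1" "coprime b q"
  shows "(\<Sum>n\<in>totatives q. g (b * n mod q)) = (\<Sum>n\<in>totatives q. g n)"
proof -
  have inj: "inj_on (\<lambda>n. b * n mod q) (totatives q)"
  proof (rule inj_onI)
    fix m n assume mn: "m \<in> totatives q" "n \<in> totatives q" "b * m mod q = b * n mod q"
    then have "[b * m = b * n] (mod q)" by (simp add: cong_def)
    then have "[m = n] (mod q)" using assms(2) by (simp add: cong_mult_lcancel_nat)
    then show "m = n" using mn totatives_less[OF _ assms(1)] by (simp add: cong_less_modulus_unique_nat)
  qed
  have "(\<lambda>n. b * n mod q) ` totatives q \<subseteq> totatives q"
  proof (rule image_subsetI)
    fix n assume n: "n \<in> totatives q"
    have c: "coprime (b * n mod q) q" using n assms by (simp add: in_totatives_iff)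
    then have "b * n mod q \<noteq> 0" using assms(1) by (intro notI) simp
    then show "b * n mod q \<in> totatives q" using c assms(1) by (simp add: in_totatives_iff less_imp_le)
  qed
  then have "bij_betw (\<lambda>n. b * n mod q) (totatives q) (totatives q)"
    using inj by (simp add: bij_betw_def endo_inj_surj)
  then show ?thesis by (rule sum.reindex_bij_betw)
qed

lemma sum_dirichlet_char:
  assumes "q > 1" "dirichlet_char q chi" "chi \<noteq> principal_char q"
  shows "(\<Sum>n\<in>totatives q. chi n) = 0"
proof -
  obtain b where b: "chi b \<noteq> principal_char q b" using assms(3) by blast
  then have cb: "coprime b q" "chi b \<noteq> 1" using assms(2) by (auto simp: dirichlet_char_def principal_char_def split: if_splits)
  have "(\<Sum>n\<in>totatives q. chi n) = (\<Sum>n\<in>totatives q. chi (b * n mod q))"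
    by (rule sum_totatives_mult[symmetric]) (use assms cb in auto)
  also have "\<dots> = (\<Sum>n\<in>totatives q. chi b * chi n)"
  proof (rule sum.cong[OF refl])
    fix n
    have "chi (b * n mod q) = chi (b * n)" using assms(2) by (intro dirichlet_char_cong) auto
    then show "chi (b * n mod q) = chi b * chi n" using assms(2) by (simp add: dirichlet_char_def)
  qed
  also have "\<dots> = chi b * (\<Sum>n\<in>totatives q. chi n)" by (simp add: sum_distrib_left)
  finally have "(1 - chi b) * (\<Sum>n\<in>totatives q. chi n) = 0" by (simp add: algebra_simps)
  then show ?thesis using cb by simp
qed

text \<open>Multiplying all characters by some \<open>psi\<close> with
  \<open>psi a \<noteq> 1\<close> permutes them, so the sum equals \<open>psi a\<close> times
  itself.\<close>

lemma sum_over_dirichlet_chars: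
  assumes "q > 0" "coprime a q" "\<not> [a = 1] (mod q)"
  shows "(\<Sum>chi | dirichlet_char q chi. chi a) = 0"
proof -
  obtain psi where psi: "dirichlet_char q psi" "psi a \<noteq> 1" using dirichlet_char_separates[OF assms] by blast
  \<comment> \<open>Multiplication by \<open>cnj psi\<close> undoes multiplication by
    \<open>psi\<close> at non-units as well, because \<open>chi\<close> vanishes there.\<close>
  have c: "psi n * (cnj (psi n) * chi n) = chi n" "cnj (psi n) * (psi n * chi n) = chi n"
    if "dirichlet_char q chi" for chi n
  proof -
    have "chi n = 0 \<or> cnj (psi n) * psi n = 1"
      using dirichlet_char_mult_cnj[OF psi(1) _ assms(1), of n] that by (auto simp: dirichlet_char_def)
    then show "psi n * (cnj (psi n) * chi n) = chi n" "cnj (psi n) * (psi n * chi n) = chi n"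
      by (metis mult.assoc mult.commute mult_1 mult_zero_right)+
  qed
  have "(\<Sum>chi | dirichlet_char q chi. chi a) = (\<Sum>chi | dirichlet_char q chi. psi a * chi a)"
    by (rule sum.reindex_bij_witness[of _ "\<lambda>chi n. psi n * chi n" "\<lambda>chi n. cnj (psi n) * chi n"])
      (auto simp: c fun_eq_iff intro: dirichlet_char_times[OF psi(1)] dirichlet_char_times[OF dirichlet_char_cnj[OF psi(1)]])
  also have "\<dots> = psi a * (\<Sum>chi | dirichlet_char q chi. chi a)" by (simp add: sum_distrib_left)
  finally have "(1 - psi a) * (\<Sum>chi | dirichlet_char q chi. chi a) = 0" by (simp add: algebra_simps)
  then show ?thesis using psi by simp
qed

text \<open>Double counting of the sum of \<open>chi n\<close> over all \<open>chi\<close> and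
  \<open>n\<close>: in one order only \<open>n = 1\<close> survives, in the other only the principal
  character.\<close>

lemma card_dirichlet_chars:
  assumes "q > 1"
  shows "card {chi. dirichlet_char q chi} = totient q"
proof -
  let ?D = "{chi. dirichlet_char q chi}"
  have fin: "finite ?D" using assms by (intro finite_dirichlet_chars) auto
  have one: "1 \<in> totatives q" using assms by (simp add: in_totatives_iff)
  have "(\<Sum>n\<in>totatives q. \<Sum>chi\<in>?D. chi n) = (\<Sum>n\<in>{1}. \<Sum>chi\<in>?D. chi n)"
  proof (rule sum.mono_neutral_right)
    show "\<forall>n\<in>totatives q - {1}. (\<Sum>chi\<in>?D. chi n) = 0"
    proof
      fix n assume n: "n \<in> totatives q - {1}"
      then have "\<not> [n = 1] (mod q)"
        using cong_less_modulus_unique_nat[of n 1 q] totatives_less[of n q] assms by auto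
      then show "(\<Sum>chi\<in>?D. chi n) = 0"
        using n assms by (intro sum_over_dirichlet_chars) (auto simp: in_totatives_iff)
    qed
  qed (use one in auto)
  also have "\<dots> = of_nat (card ?D)" by (simp add: dirichlet_char_def)
  finally have 1: "(\<Sum>n\<in>totatives q. \<Sum>chi\<in>?D. chi n) = of_nat (card ?D)" .
  have "(\<Sum>chi\<in>?D. \<Sum>n\<in>totatives q. chi n) = (\<Sum>chi\<in>{principal_char q}. \<Sum>n\<in>totatives q. chi n)"
    using fin sum_dirichlet_char[OF assms] dirichlet_char_principal by (intro sum.mono_neutral_right) auto
  also have "\<dots> = of_nat (totient q)"
  proof -
    have "(\<Sum>n\<in>totatives q. principal_char q n) = (\<Sum>n\<in>totatives q. 1)"
      by (rule sum.cong) (auto simp: principal_char_def in_totatives_iff)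
    then show ?thesis by (simp add: totient_def)
  qed
  finally have "of_nat (card ?D) = (of_nat (totient q) :: complex)"
    using 1 by (subst (asm) sum.swap) simp
  then show ?thesis by (simp only: of_nat_eq_iff)
qed

lemma dirichlet_char_orthogonality:
  assumes "q > 1" "coprime a q" "coprime b q"
  shows "(\<Sum>chi | dirichlet_char q chi. chi a * cnj (chi b)) = (if [a = b] (mod q) then of_nat (totient q) else 0)"
proof (cases "[a = b] (mod q)")
  case True
  have "(\<Sum>chi | dirichlet_char q chi. chi a * cnj (chi b)) = (\<Sum>chi | dirichlet_char q chi. 1)"
  proof (rule sum.cong[OF refl])
    fix chi assume chi: "chi \<in> {chi. dirichlet_char q chi}"
    then have "chi a = chi b" using True by (auto intro: dirichlet_char_cong)
    then show "chi a * cnj (chi b) = 1"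
      using dirichlet_char_mult_cnj[of q chi b] chi assms by (simp add: mult.commute)
  qed
  then show ?thesis using True card_dirichlet_chars[OF assms(1)] by simp
next
  case False
  \<comment> \<open>An inverse of \<open>b\<close> modulo \<open>q\<close>, so that
    \<open>chi b'\<close> is the conjugate of \<open>chi b\<close>.\<close>
  define b' where "b' = b ^ (totient q - 1)"
  have tq: "totient q > 0" using assms(1) by simp
  then have b'b: "b' * b = b ^ totient q" unfolding b'_def by (cases "totient q") auto
  have bb: "[b' * b = 1] (mod q)" unfolding b'b by (rule euler_theorem) fact
  have "(\<Sum>chi | dirichlet_char q chi. chi a * cnj (chi b)) = (\<Sum>chi | dirichlet_char q chi. chi (a * b'))"
  proof (rule sum.cong[OF refl])
    fix chi assume "chi \<in> {chi. dirichlet_char q chi}"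
    then have chi: "dirichlet_char q chi" by simp
    have "chi b' * chi b = 1"
      using dirichlet_char_cong[OF chi bb] chi by (simp add: dirichlet_char_def)
    moreover have "cnj (chi b) * chi b = 1" by (rule dirichlet_char_mult_cnj) (use chi assms in auto)
    ultimately have "cnj (chi b) = chi b'" by (metis mult.commute mult.left_commute mult_1)
    then show "chi a * cnj (chi b) = chi (a * b')" using chi by (simp add: dirichlet_char_def)
  qed
  also have "\<dots> = 0"
  proof (rule sum_over_dirichlet_chars)
    show "coprime (a * b') q" using assms by (simp add: b'_def)
    show "\<not> [a * b' = 1] (mod q)"
    proof
      assume "[a * b' = 1] (mod q)"
      then have 1: "[a * b' * b = 1 * b] (mod q)" by (rule cong_scalar_right)
      have "[a * (b' * b) = a * 1] (mod q)" using bb by (rule cong_scalar_left)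
      with 1 have "[a = b] (mod q)" by (metis cong_sym cong_trans mult.assoc mult_1 mult_1_right)
      then show False using False by contradiction
    qed
  qed (use assms in auto)
  finally show ?thesis using False by simp
qed

section \<open>The resonance inequality\<close>

text \<open>Elements below \<open>q\<close> are congruent only if they are equal, so orthogonality
  leaves just the diagonal.\<close>

lemma second_moment_dirichlet_chars:
  assumes "q > 1" "finite Y" "\<And>y. y \<in> Y \<Longrightarrow> coprime y q \<and> y < q"
  shows "(\<Sum>chi | dirichlet_char q chi. (cmod (\<Sum>y\<in>Y. chi y))\<^sup>2) = real (totient q) * real (card Y)"
proof -
  have "complex_of_real (\<Sum>chi | dirichlet_char q chi. (cmod (\<Sum>y\<in>Y. chi y))\<^sup>2)
    = (\<Sum>chi | dirichlet_char q chi. \<Sum>y\<in>Y. \<Sum>y'\<in>Y. chi y * cnj (chi y'))"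
    unfolding of_real_sum by (intro sum.cong refl) (simp only: complex_norm_square cnj_sum sum_product)
  also have "\<dots> = (\<Sum>y\<in>Y. \<Sum>y'\<in>Y. \<Sum>chi | dirichlet_char q chi. chi y * cnj (chi y'))"
    by (subst sum.swap, rule sum.cong[OF refl], rule sum.swap)
  also have "\<dots> = (\<Sum>y\<in>Y. \<Sum>y'\<in>Y. if y = y' then of_nat (totient q) else 0)"
  proof (intro sum.cong refl)
    fix y y' assume yy: "y \<in> Y" "y' \<in> Y"
    then have "[y = y'] (mod q) \<longleftrightarrow> y = y'" using assms(3) by (auto simp: cong_less_modulus_unique_nat)
    then show "(\<Sum>chi | dirichlet_char q chi. chi y * cnj (chi y')) = (if y = y' then of_nat (totient q) else 0)"
      using dirichlet_char_orthogonality[OF assms(1), of y y'] assms(3) yy by simp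
  qed
  also have "\<dots> = of_nat (totient q) * of_nat (card Y)" using assms(2) by (simp add: sum.delta)
  also have "\<dots> = complex_of_real (real (totient q) * real (card Y))" by simp
  finally show ?thesis by (simp only: of_real_eq_iff)
qed

text \<open>The sum of \<open>V * RY * cnj RX\<close> over all characters is computed by
  orthogonality. In the upper bound the principal character is estimated trivially; for the others
  \<open>V\<close> is at most \<open>D\<close> and Cauchy-Schwarz brings in the second
  moments.\<close>

lemma resonance_bound:
  fixes c :: "nat \<Rightarrow> real"
  assumes q: "q > 1" and fin: "finite X" "finite Y"
    and X: "\<And>x. x \<in> X \<Longrightarrow> coprime x q \<and> x < q" and Y: "\<And>y. y \<in> Y \<Longrightarrow> coprime y q \<and> y < q"
    and D: "\<And>chi. dirichlet_char q chi \<Longrightarrow> chi \<noteq> principal_char q \<Longrightarrow> cmod (\<Sum>t\<in>totatives q. of_real (c t) * chi t) \<le> D" "D \<ge> 0"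
  shows "real (totient q) * (\<Sum>x\<in>X. \<Sum>y\<in>Y. \<Sum>t\<in>totatives q. if [t * y = x] (mod q) then c t else 0)
    \<le> real (totient q) * (D * sqrt (real (card X) * real (card Y))) + \<bar>\<Sum>t\<in>totatives q. c t\<bar> * (real (card X) * real (card Y))"
    (is "real ?phi * ?S \<le> _")
proof -
  let ?D = "{chi. dirichlet_char q chi}" and ?T = "totatives q"
  define V where "V = (\<lambda>chi :: nat \<Rightarrow> complex. \<Sum>t\<in>?T. of_real (c t) * chi t)"
  define RX where "RX = (\<lambda>chi :: nat \<Rightarrow> complex. \<Sum>x\<in>X. chi x)"
  define RY where "RY = (\<lambda>chi :: nat \<Rightarrow> complex. \<Sum>y\<in>Y. chi y)"
  have finD: "finite ?D" using q by (intro finite_dirichlet_chars) auto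
  have "(\<Sum>chi\<in>?D. V chi * RY chi * cnj (RX chi)) = (\<Sum>chi\<in>?D. \<Sum>x\<in>X. \<Sum>y\<in>Y. \<Sum>t\<in>?T. of_real (c t) * (chi (t * y) * cnj (chi x)))"
  proof (rule sum.cong[OF refl])
    fix chi assume "chi \<in> ?D"
    then have m: "chi (t * y) = chi t * chi y" for t y by (simp add: dirichlet_char_def)
    have "V chi * RY chi * cnj (RX chi) = cnj (RX chi) * (RY chi * V chi)" by (simp add: mult_ac)
    also have "\<dots> = (\<Sum>x\<in>X. \<Sum>y\<in>Y. \<Sum>t\<in>?T. cnj (chi x) * (chi y * (of_real (c t) * chi t)))"
      unfolding V_def RX_def RY_def cnj_sum
      by (simp only: sum_product) (simp only: sum_distrib_left)
    finally show "V chi * RY chi * cnj (RX chi) = (\<Sum>x\<in>X. \<Sum>y\<in>Y. \<Sum>t\<in>?T. of_real (c t) * (chi (t * y) * cnj (chi x)))"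
      by (simp add: m mult_ac)
  qed
  also have "\<dots> = (\<Sum>x\<in>X. \<Sum>y\<in>Y. \<Sum>t\<in>?T. of_real (c t) * (\<Sum>chi\<in>?D. chi (t * y) * cnj (chi x)))"
    unfolding sum_distrib_left
    by (subst sum.swap, intro sum.cong refl, subst sum.swap, intro sum.cong refl, rule sum.swap)
  also have "\<dots> = (\<Sum>x\<in>X. \<Sum>y\<in>Y. \<Sum>t\<in>?T. of_real (c t) * (if [t * y = x] (mod q) then of_nat ?phi else 0))"
  proof (intro sum.cong refl arg_cong2[where f = "(*)"])
    fix x y t assume "x \<in> X" "y \<in> Y" "t \<in> ?T"
    then show "(\<Sum>chi\<in>?D. chi (t * y) * cnj (chi x)) = (if [t * y = x] (mod q) then of_nat ?phi else 0)"
      using X Y q by (intro dirichlet_char_orthogonality) (auto simp: in_totatives_iff)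
  qed
  also have "\<dots> = of_real (real ?phi * ?S)"
    unfolding of_real_mult of_real_sum sum_distrib_left
    by (intro sum.cong refl) auto
  finally have eq: "(\<Sum>chi\<in>?D. V chi * RY chi * cnj (RX chi)) = of_real (real ?phi * ?S)" .
  have nX: "cmod (RX chi) \<le> card X" and nY: "cmod (RY chi) \<le> card Y" if "dirichlet_char q chi" for chi
  proof -
    have "cmod (chi n) \<le> 1" for n using norm_dirichlet_char_le[OF that] q by simp
    then show "cmod (RX chi) \<le> card X" "cmod (RY chi) \<le> card Y"
      unfolding RX_def RY_def using sum_norm_bound[of X chi 1] sum_norm_bound[of Y chi 1] by auto
  qed
  have V0: "cmod (V (principal_char q)) = \<bar>\<Sum>t\<in>?T. c t\<bar>"
  proof -
    have "V (principal_char q) = (\<Sum>t\<in>?T. of_real (c t))"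
      unfolding V_def by (rule sum.cong) (auto simp: principal_char_def in_totatives_iff)
    also have "\<dots> = of_real (\<Sum>t\<in>?T. c t)" by simp
    finally show ?thesis by (simp only: norm_of_real)
  qed
  have "real ?phi * ?S \<le> cmod (of_real (real ?phi * ?S))" by (simp only: norm_of_real abs_ge_self)
  also have "\<dots> \<le> (\<Sum>chi\<in>?D. cmod (V chi * RY chi * cnj (RX chi)))"
    unfolding eq[symmetric] by (rule norm_sum)
  also have "\<dots> = cmod (V (principal_char q)) * (cmod (RY (principal_char q)) * cmod (RX (principal_char q)))
    + (\<Sum>chi\<in>?D - {principal_char q}. cmod (V chi) * (cmod (RY chi) * cmod (RX chi)))"
    using finD dirichlet_char_principal by (subst sum.remove[of _ "principal_char q"]) (auto simp: norm_mult mult.assoc)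
  also have "\<dots> \<le> \<bar>\<Sum>t\<in>?T. c t\<bar> * (real (card Y) * real (card X))
     + (\<Sum>chi\<in>?D - {principal_char q}. D * (cmod (RY chi) * cmod (RX chi)))"
    unfolding V0 using D nX nY dirichlet_char_principal
    by (intro add_mono mult_left_mono mult_mono sum_mono mult_right_mono) (auto simp: V_def)
  also have "(\<Sum>chi\<in>?D - {principal_char q}. D * (cmod (RY chi) * cmod (RX chi))) \<le> (\<Sum>chi\<in>?D. D * (cmod (RY chi) * cmod (RX chi)))"
    using D(2) finD by (intro sum_mono2) auto
  also have "\<dots> = D * (\<Sum>chi\<in>?D. \<bar>cmod (RY chi)\<bar> * \<bar>cmod (RX chi)\<bar>)"
    by (simp add: sum_distrib_left)
  also have "\<dots> \<le> D * (L2_set (\<lambda>chi. cmod (RY chi)) ?D * L2_set (\<lambda>chi. cmod (RX chi)) ?D)"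
    using D(2) by (intro mult_left_mono L2_set_mult_ineq)
  also have "L2_set (\<lambda>chi. cmod (RY chi)) ?D * L2_set (\<lambda>chi. cmod (RX chi)) ?D = real ?phi * sqrt (real (card X) * real (card Y))"
    unfolding L2_set_def RX_def RY_def
    by (simp add: second_moment_dirichlet_chars[OF q] fin X Y real_sqrt_mult)
  finally show ?thesis by (simp add: mult_ac)
qed

text \<open>For a pair \<open>(x, y)\<close> at most one \<open>t\<close> solves
  \<open>t * y = x\<close> modulo \<open>q\<close>. It stems from a factorization and has weight at
  least \<open>wt\<close>, or costs at most \<open>B\<close>, or does not exist; summing over
  \<open>y\<close> gives at least \<open>wt * K - B * card Y\<close> for every
  \<open>x\<close>.\<close>

lemma resonance:
  fixes c :: "nat \<Rightarrow> real"
  assumes q: "q > 1" and fin: "finite X" "finite Y" "X \<noteq> {}" "Y \<noteq> {}"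
    and X: "\<And>x. x \<in> X \<Longrightarrow> coprime x q \<and> x < q" and Y: "\<And>y. y \<in> Y \<Longrightarrow> coprime y q \<and> y < q"
    and Z: "\<And>z. z \<in> Z \<Longrightarrow> z \<in> totatives q \<and> wt \<le> c z" and wt: "wt \<ge> 0" and B: "B \<ge> 0"
    and neg: "\<And>x y t. x \<in> X \<Longrightarrow> y \<in> Y \<Longrightarrow> t \<in> totatives q \<Longrightarrow> [t * y = x] (mod q) \<Longrightarrow> - B \<le> c t"
    and K: "\<And>x. x \<in> X \<Longrightarrow> K \<le> real (card {y\<in>Y. \<exists>z\<in>Z. x = y * z})"
    and pos: "R > 0"
    and R: "R \<le> wt * (K * sqrt (real (card X) / real (card Y)))
       - (B + \<bar>\<Sum>t\<in>totatives q. c t\<bar> / real (totient q)) * sqrt (real (card X) * real (card Y))"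
  shows "\<exists>chi. dirichlet_char q chi \<and> chi \<noteq> principal_char q \<and> R \<le> cmod (\<Sum>t\<in>totatives q. of_real (c t) * chi t)"
proof (rule ccontr)
  assume neg_concl: "\<not> ?thesis"
  let ?T = "totatives q" and ?phi = "real (totient q)" and ?x = "real (card X)" and ?y = "real (card Y)"
  let ?D = "{chi. dirichlet_char q chi}"
  define V where "V = (\<lambda>chi :: nat \<Rightarrow> complex. cmod (\<Sum>t\<in>?T. of_real (c t) * chi t))"
  \<comment> \<open>The inserted 0 keeps the maximum meaningful if there is no non-principal
    character; \<open>R > 0\<close> then still gives \<open>D < R\<close>.\<close>
  define D where "D = Max (insert 0 (V ` (?D - {principal_char q})))"
  have finD: "finite ?D" using q by (intro finite_dirichlet_chars) auto
  have phi: "?phi > 0" using q by simp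
  have xy: "?x > 0" "?y > 0" using fin by (auto simp: card_gt_0_iff)
  have D0: "D \<ge> 0" unfolding D_def using finD by (intro Max_ge) auto
  have DV: "V chi \<le> D" if "dirichlet_char q chi" "chi \<noteq> principal_char q" for chi
    unfolding D_def using finD that by (intro Max_ge) auto
  have "D < R" unfolding D_def using finD neg_concl pos by (subst Max_less_iff) (auto simp: V_def not_le)
  define W where "W = (\<lambda>x y. \<Sum>t\<in>?T. if [t * y = x] (mod q) then c t else 0)"
  have W: "(if \<exists>z\<in>Z. x = y * z then wt else 0) - B \<le> W x y" if xy: "x \<in> X" "y \<in> Y" for x y
  proof -
    have uniq: "t = t'" if t: "t \<in> ?T" "t' \<in> ?T" "[t * y = x] (mod q)" "[t' * y = x] (mod q)" for t t'
    proof -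
      have "[y * t = y * t'] (mod q)" using t by (metis cong_sym cong_trans mult.commute)
      then have "[t = t'] (mod q)" using Y[OF xy(2)] by (simp add: cong_mult_lcancel_nat)
      then show ?thesis using t totatives_less[OF _ q] by (simp add: cong_less_modulus_unique_nat)
    qed
    have val: "W x y = c t" if t: "t \<in> ?T" "[t * y = x] (mod q)" for t
    proof -
      have "W x y = (\<Sum>t'\<in>?T. if t' = t then c t' else 0)"
        unfolding W_def using t uniq by (intro sum.cong) auto
      then show ?thesis using t by simp
    qed
    show ?thesis
    proof (cases "\<exists>t\<in>?T. [t * y = x] (mod q)")
      case True
      then obtain t where t: "t \<in> ?T" "[t * y = x] (mod q)" by blast
      show ?thesis
      proof (cases "\<exists>z\<in>Z. x = y * z")
        case True
        then obtain z where "z \<in> Z" "x = y * z" by blast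
        then have "W x y = c z" using val[of z] Z by (simp add: mult.commute)
        then show ?thesis using Z[OF \<open>z \<in> Z\<close>] True B by simp
      next
        case False
        then show ?thesis using val[OF t] neg[OF xy t] by simp
      qed
    next
      case False
      then have "\<not> (\<exists>z\<in>Z. x = y * z)" using Z by (metis cong_refl mult.commute)
      moreover have "W x y = 0" unfolding W_def using False by (intro sum.neutral) auto
      ultimately show ?thesis using B by simp
    qed
  qed
  have "?x * (wt * K - B * ?y) = (\<Sum>x\<in>X. wt * K - B * ?y)" by simp
  also have "\<dots> \<le> (\<Sum>x\<in>X. \<Sum>y\<in>Y. W x y)"
  proof (rule sum_mono)
    fix x assume x: "x \<in> X"
    have "wt * K - B * ?y \<le> wt * real (card {y\<in>Y. \<exists>z\<in>Z. x = y * z}) - B * ?y"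
      using K[OF x] wt by (simp add: mult_left_mono)
    also have "\<dots> = (\<Sum>y\<in>Y. (if \<exists>z\<in>Z. x = y * z then wt else 0) - B)"
      using fin by (simp add: sum_subtractf mult.commute sum.inter_filter[symmetric])
    also have "\<dots> \<le> (\<Sum>y\<in>Y. W x y)" using W[OF x] by (rule sum_mono)
    finally show "wt * K - B * ?y \<le> (\<Sum>y\<in>Y. W x y)" .
  qed
  finally have "?phi * (?x * (wt * K - B * ?y)) \<le> ?phi * (\<Sum>x\<in>X. \<Sum>y\<in>Y. W x y)"
    using phi by simp
  also have "\<dots> \<le> ?phi * (D * sqrt (?x * ?y)) + \<bar>\<Sum>t\<in>?T. c t\<bar> * (?x * ?y)"
    unfolding W_def using q fin X Y D0 DV by (intro resonance_bound) (auto simp: V_def)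
  finally have main: "?phi * (?x * (wt * K - B * ?y)) \<le> ?phi * (D * sqrt (?x * ?y)) + \<bar>\<Sum>t\<in>?T. c t\<bar> * (?x * ?y)" .
  \<comment> \<open>Dividing by the geometric mean of the set sizes turns \<open>card X * K\<close>
    into the gain \<open>K * sqrt (card X / card Y)\<close>.\<close>
  define s where "s = sqrt (?x * ?y)"
  have s: "s > 0" "s * s = ?x * ?y" using xy by (auto simp: s_def)
  have xs: "?x = s * sqrt (?x / ?y)"
    using xy by (simp add: s_def real_sqrt_mult real_sqrt_divide)
  have "?phi * (s * (wt * (K * sqrt (?x / ?y)) - B * s)) = ?phi * (?x * wt * K - B * (s * s))"
    by (subst (2) xs) (simp add: algebra_simps)
  also have "\<dots> = ?phi * (?x * (wt * K - B * ?y))" unfolding s(2) by (simp add: algebra_simps)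
  also have "\<dots> \<le> ?phi * (D * s) + \<bar>\<Sum>t\<in>?T. c t\<bar> * (s * s)" using main unfolding s_def[symmetric] s(2) .
  finally have "(?phi * s) * (wt * (K * sqrt (?x / ?y)) - B * s) \<le> (?phi * s) * (D + \<bar>\<Sum>t\<in>?T. c t\<bar> / ?phi * s)"
    using phi by (simp add: algebra_simps)
  then have "wt * (K * sqrt (?x / ?y)) - B * s \<le> D + \<bar>\<Sum>t\<in>?T. c t\<bar> / ?phi * s"
    using phi s by (simp only: mult_le_cancel_left_pos mult_pos_pos)
  then have "R \<le> D" using R unfolding s_def[symmetric] by (simp add: algebra_simps)
  then show False using \<open>D < R\<close> by simp
qed

section \<open>Products of primes from disjoint blocks\<close>

definition block_subsets :: "'i set \<Rightarrow> ('i \<Rightarrow> 'a set) \<Rightarrow> ('i \<Rightarrow> nat) \<Rightarrow> 'a set set" where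
  "block_subsets I P k = {S. S \<subseteq> (\<Union>i\<in>I. P i) \<and> (\<forall>i\<in>I. card (S \<inter> P i) = k i)}"

lemma finite_block_subsets:
  "finite I \<Longrightarrow> (\<And>i. i \<in> I \<Longrightarrow> finite (P i)) \<Longrightarrow> finite (block_subsets I P k)"
  unfolding block_subsets_def by (rule finite_subset[of _ "Pow (\<Union>i\<in>I. P i)"]) auto

lemma card_block_subsets:
  assumes "finite I" "\<And>i. i \<in> I \<Longrightarrow> finite (P i)" "disjoint_family_on P I"
  shows "card (block_subsets I P k) = (\<Prod>i\<in>I. card (P i) choose k i)"
  using assms
proof (induction I rule: finite_induct)
  case empty
  have "block_subsets {} P k = {{}}" by (auto simp: block_subsets_def)
  then show ?case by simp
next
  case (insert j I)
  have dj: "P i \<inter> P j = {}" if "i \<in> I" for i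
    using insert.prems(2) insert.hyps that by (auto simp: disjoint_family_on_def)
  have "bij_betw (\<lambda>(S, T). S \<union> T) (block_subsets I P k \<times> {T. T \<subseteq> P j \<and> card T = k j}) (block_subsets (insert j I) P k)"
  proof (rule bij_betw_byWitness[where f' = "\<lambda>S. (S - P j, S \<inter> P j)"])
    show "\<forall>a\<in>block_subsets I P k \<times> {T. T \<subseteq> P j \<and> card T = k j}. (\<lambda>S. (S - P j, S \<inter> P j)) ((\<lambda>(S, T). S \<union> T) a) = a"
      using dj by (fastforce simp: block_subsets_def)
    show "\<forall>a'\<in>block_subsets (insert j I) P k. (\<lambda>(S, T). S \<union> T) (a' - P j, a' \<inter> P j) = a'"
      by auto
    show "(\<lambda>(S, T). S \<union> T) ` (block_subsets I P k \<times> {T. T \<subseteq> P j \<and> card T = k j}) \<subseteq> block_subsets (insert j I) P k"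
    proof (rule image_subsetI)
      fix ST assume "ST \<in> block_subsets I P k \<times> {T. T \<subseteq> P j \<and> card T = k j}"
      then obtain S T where ST: "ST = (S, T)" and S: "S \<in> block_subsets I P k" and T: "T \<subseteq> P j" "card T = k j"
        by blast
      have "(S \<union> T) \<inter> P i = S \<inter> P i" if "i \<in> I" for i using dj[OF that] T by blast
      moreover have "(S \<union> T) \<inter> P j = T" using dj S T unfolding block_subsets_def by blast
      ultimately have "S \<union> T \<in> block_subsets (insert j I) P k" using S T by (auto simp: block_subsets_def)
      then show "(\<lambda>(S, T). S \<union> T) ST \<in> block_subsets (insert j I) P k" by (simp add: ST)
    qed
    show "(\<lambda>S. (S - P j, S \<inter> P j)) ` block_subsets (insert j I) P k \<subseteq> block_subsets I P k \<times> {T. T \<subseteq> P j \<and> card T = k j}"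
    proof (rule image_subsetI)
      fix S assume S: "S \<in> block_subsets (insert j I) P k"
      have "(S - P j) \<inter> P i = S \<inter> P i" if "i \<in> I" for i using dj[OF that] by blast
      then show "(S - P j, S \<inter> P j) \<in> block_subsets I P k \<times> {T. T \<subseteq> P j \<and> card T = k j}"
        using S by (auto simp: block_subsets_def)
    qed
  qed
  then have "card (block_subsets (insert j I) P k) = card (block_subsets I P k \<times> {T. T \<subseteq> P j \<and> card T = k j})"
    by (simp add: bij_betw_same_card)
  also have "\<dots> = card (block_subsets I P k) * (card (P j) choose k j)"
    using insert.prems by (simp add: card_cartesian_product n_subsets)
  also have "card (block_subsets I P k) = (\<Prod>i\<in>I. card (P i) choose k i)"
    using insert.prems by (intro insert.IH) (auto simp: disjoint_family_on_def)
  finally show ?case using insert.hyps by (simp add: mult.commute)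
qed

text \<open>Unique factorization: the primes dividing such a product are exactly the members of the
  set.\<close>

lemma inj_on_prod_primes:
  "inj_on (\<lambda>S. \<Prod>S) {S :: nat set. finite S \<and> (\<forall>p\<in>S. prime p)}"
proof (rule inj_onI)
  have *: "S \<subseteq> S'" if "finite S" "finite S'" "\<forall>p\<in>S. prime p" "\<forall>p\<in>S'. prime p" "\<Prod>S = \<Prod>S'" for S S' :: "nat set"
  proof
    fix p assume p: "p \<in> S"
    then have "p dvd \<Prod>S'" using that by (metis dvd_prod_eqI)
    moreover have "prime p" using that(3) p by blast
    ultimately obtain p' where "p' \<in> S'" "p dvd p'"
      using prime_dvd_prod_iff[OF \<open>finite S'\<close>, of p "\<lambda>x. x"] by blast
    then show "p \<in> S'" using that p primes_dvd_imp_eq by blast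
  qed
  fix S S' :: "nat set"
  assume "S \<in> {S. finite S \<and> (\<forall>p\<in>S. prime p)}" "S' \<in> {S. finite S \<and> (\<forall>p\<in>S. prime p)}" "\<Prod>S = \<Prod>S'"
  then show "S = S'" using *[of S S'] *[of S' S] by auto
qed

locale prime_blocks =
  fixes I :: "'i set" and P :: "'i \<Rightarrow> nat set"
  assumes fin_I: "finite I" and fin_P: "i \<in> I \<Longrightarrow> finite (P i)"
    and prime_P: "i \<in> I \<Longrightarrow> p \<in> P i \<Longrightarrow> prime p" and disj: "disjoint_family_on P I"
begin

definition block_products :: "('i \<Rightarrow> nat) \<Rightarrow> nat set" where
  "block_products k = (\<lambda>S. \<Prod>S) ` block_subsets I P k"

lemma block_subsets_primes:
  assumes "S \<in> block_subsets I P k"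
  shows "finite S" "\<And>p. p \<in> S \<Longrightarrow> prime p"
proof -
  have S: "S \<subseteq> (\<Union>i\<in>I. P i)" using assms by (simp add: block_subsets_def)
  then show "finite S" using fin_I fin_P by (auto intro: finite_subset)
  show "prime p" if "p \<in> S" for p using that S prime_P by blast
qed

lemma inj_on_block: "inj_on (\<lambda>S. \<Prod>S) (block_subsets I P k)"
  by (rule inj_on_subset[OF inj_on_prod_primes]) (auto dest: block_subsets_primes)

lemma finite_block_products: "finite (block_products k)"
  unfolding block_products_def using fin_I fin_P by (intro finite_imageI finite_block_subsets)

lemma card_block_products: "card (block_products k) = (\<Prod>i\<in>I. card (P i) choose k i)"
  unfolding block_products_def
  using card_block_subsets[OF fin_I fin_P disj] by (simp add: card_image[OF inj_on_block])

lemma coprime_block_products: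
  assumes "\<And>i p. i \<in> I \<Longrightarrow> p \<in> P i \<Longrightarrow> \<not> p dvd q" "x \<in> block_products k"
  shows "coprime x q"
proof -
  obtain S where S: "S \<in> block_subsets I P k" "x = \<Prod>S" using assms(2) by (auto simp: block_products_def)
  have "coprime p q" if "p \<in> S" for p
    using that S assms(1) block_subsets_primes[OF S(1)] prime_imp_coprime[of p q] by (auto simp: block_subsets_def)
  then show ?thesis unfolding S(2) by (intro prod_coprime_left) auto
qed

lemma ln_block_product:
  assumes "S \<in> block_subsets I P k"
  shows "ln (real (\<Prod>S)) = (\<Sum>i\<in>I. \<Sum>p\<in>S \<inter> P i. ln (real p))"
proof -
  note pr = block_subsets_primes[OF assms]
  have "ln (real (\<Prod>S)) = (\<Sum>p\<in>S. ln (real p))"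
    unfolding of_nat_prod by (rule ln_prod) (auto simp: pr prime_gt_0_nat)
  also have "S = (\<Union>i\<in>I. S \<inter> P i)" using assms by (auto simp: block_subsets_def)
  also have "(\<Sum>p\<in>(\<Union>i\<in>I. S \<inter> P i). ln (real p)) = (\<Sum>i\<in>I. \<Sum>p\<in>S \<inter> P i. ln (real p))"
    using fin_I pr(1) disj by (intro sum.UNION_disjoint) (auto simp: disjoint_family_on_def)
  finally show ?thesis
    by (metis (no_types, lifting) Int_absorb1 Int_absorb2 \<open>S = (\<Union>i\<in>I. S \<inter> P i)\<close>)
qed

lemma block_product_pos: "x \<in> block_products k \<Longrightarrow> x > 0"
  unfolding block_products_def by (auto intro!: prod_pos dest: block_subsets_primes(2) prime_gt_0_nat)

lemma block_product_le:
  assumes "\<And>i p. i \<in> I \<Longrightarrow> p \<in> P i \<Longrightarrow> ln (real p) \<le> u i" "x \<in> block_products k"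
  shows "ln (real x) \<le> (\<Sum>i\<in>I. real (k i) * u i)"
proof -
  obtain S where S: "S \<in> block_subsets I P k" "x = \<Prod>S" using assms(2) by (auto simp: block_products_def)
  have "ln (real x) \<le> (\<Sum>i\<in>I. \<Sum>p\<in>S \<inter> P i. u i)"
    unfolding S(2) ln_block_product[OF S(1)] using assms(1) by (intro sum_mono) auto
  also have "\<dots> = (\<Sum>i\<in>I. real (k i) * u i)" using S by (auto simp: block_subsets_def intro!: sum.cong)
  finally show ?thesis .
qed

lemma block_product_ge:
  assumes "\<And>i p. i \<in> I \<Longrightarrow> p \<in> P i \<Longrightarrow> l i \<le> ln (real p)" "x \<in> block_products k"
  shows "(\<Sum>i\<in>I. real (k i) * l i) \<le> ln (real x)"
proof -
  obtain S where S: "S \<in> block_subsets I P k" "x = \<Prod>S" using assms(2) by (auto simp: block_products_def)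
  have "(\<Sum>i\<in>I. real (k i) * l i) = (\<Sum>i\<in>I. \<Sum>p\<in>S \<inter> P i. l i)" using S by (auto simp: block_subsets_def intro!: sum.cong)
  also have "\<dots> \<le> ln (real x)"
    unfolding S(2) ln_block_product[OF S(1)] using assms(1) by (intro sum_mono) auto
  finally show ?thesis .
qed

text \<open>Choosing \<open>m i\<close> of the \<open>k i\<close> primes of \<open>x\<close> in each
  block yields a factorization, and different choices leave different cofactors
  \<open>y\<close>.\<close>

lemma card_block_factorizations:
  assumes "\<And>i. i \<in> I \<Longrightarrow> m i \<le> k i" "x \<in> block_products k"
  shows "(\<Prod>i\<in>I. k i choose m i) \<le> card {y \<in> block_products (\<lambda>i. k i - m i). \<exists>z\<in>block_products m. x = y * z}"
proof -
  obtain S where S: "S \<in> block_subsets I P k" "x = \<Prod>S" using assms(2) by (auto simp: block_products_def)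
  note pr = block_subsets_primes[OF S(1)]
  define F where "F = block_subsets I (\<lambda>i. S \<inter> P i) m"
  have sub: "W \<subseteq> S" if "W \<in> F" for W using that by (auto simp: F_def block_subsets_def)
  have inj: "inj_on (\<lambda>W. \<Prod>(S - W)) F"
  proof (rule inj_onI)
    fix W W' assume W: "W \<in> F" "W' \<in> F" and eq: "\<Prod>(S - W) = \<Prod>(S - W')"
    have "S - W = S - W'"
      by (rule inj_onD[OF inj_on_prod_primes eq]) (use pr in auto)
    then show "W = W'" using sub[OF W(1)] sub[OF W(2)] by blast
  qed
  have "card F = (\<Prod>i\<in>I. card (S \<inter> P i) choose m i)"
    unfolding F_def using fin_I fin_P disj by (intro card_block_subsets) (auto simp: disjoint_family_on_def)
  also have "\<dots> = (\<Prod>i\<in>I. k i choose m i)" using S by (auto simp: block_subsets_def)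
  finally have "(\<Prod>i\<in>I. k i choose m i) = card ((\<lambda>W. \<Prod>(S - W)) ` F)" by (simp add: card_image[OF inj])
  also have "\<dots> \<le> card {y \<in> block_products (\<lambda>i. k i - m i). \<exists>z\<in>block_products m. x = y * z}"
  proof (intro card_mono image_subsetI CollectI conjI)
    fix W assume W: "W \<in> F"
    have "card ((S - W) \<inter> P i) = k i - m i" if i: "i \<in> I" for i
    proof -
      have "(S - W) \<inter> P i = S \<inter> P i - W \<inter> (S \<inter> P i)" by blast
      moreover have "card (S \<inter> P i) = k i" "card (W \<inter> (S \<inter> P i)) = m i"
        using S W i by (auto simp: block_subsets_def F_def)
      ultimately show ?thesis using card_Diff_subset[OF _ Int_lower2[of W "S \<inter> P i"]] pr(1) by simp
    qed
    moreover have "S \<subseteq> (\<Union>i\<in>I. P i)" using S by (simp add: block_subsets_def)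
    ultimately have "S - W \<in> block_subsets I P (\<lambda>i. k i - m i)" by (auto simp: block_subsets_def)
    then show "\<Prod>(S - W) \<in> block_products (\<lambda>i. k i - m i)" by (auto simp: block_products_def)
    have "card (W \<inter> P i) = m i" if i: "i \<in> I" for i
    proof -
      have "W \<inter> P i = W \<inter> (S \<inter> P i)" using sub[OF W] by blast
      then show ?thesis using W i by (simp add: block_subsets_def F_def)
    qed
    then have "W \<in> block_subsets I P m"
      using sub[OF W] \<open>S \<subseteq> _\<close> by (auto simp: block_subsets_def)
    then have "\<Prod>W \<in> block_products m" by (auto simp: block_products_def)
    moreover have "x = \<Prod>(S - W) * \<Prod>W" unfolding S(2) using sub[OF W] pr(1) by (rule prod.subset_diff)
    ultimately show "\<exists>z\<in>block_products m. x = \<Prod>(S - W) * z" by blast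
  qed (simp add: finite_block_products)
  finally show ?thesis .
qed

end

section \<open>Binomial gains and the exponential integral\<close>

lemma ln_fact_le:
  "m \<ge> 1 \<Longrightarrow> ln (fact m) \<le> real m * ln (real m) - real m + 1 + ln (real m)"
proof (induction m rule: nat_induct_at_least)
  case (Suc m)
  have m: "real m > 0" using Suc by simp
  have "ln (real m / (real m + 1)) \<le> real m / (real m + 1) - 1"
    using m by (intro ln_le_minus_one) auto
  then have "1 \<le> (real m + 1) * (ln (real m + 1) - ln (real m))"
    using m by (simp add: ln_div field_simps)
  moreover have "ln (fact (Suc m) :: real) = ln (real m + 1) + ln (fact m)"
    by (simp add: ln_mult add.commute)
  ultimately show ?case using Suc by (simp add: algebra_simps)
qed auto

text \<open>Each of the \<open>m\<close> factors of \<open>fact k / fact (k - m)\<close> exceeds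
  \<open>k - m\<close>.\<close>

lemma power_diff_le_binomial_fact:
  assumes "m \<le> k"
  shows "(k - m) ^ m \<le> (k choose m) * fact m"
proof -
  have "fact a * a ^ j \<le> (fact (a + j) :: nat)" for a j
  proof (induction j)
    case (Suc j)
    have "fact a * a ^ Suc j = a * (fact a * a ^ j)" by simp
    also have "\<dots> \<le> (a + Suc j) * fact (a + j)" using Suc by (intro mult_mono) auto
    finally show ?case by simp
  qed simp
  from this[of "k - m" m] have "fact (k - m) * (k - m) ^ m \<le> (fact k :: nat)" using assms by simp
  also have "\<dots> = fact (k - m) * ((k choose m) * fact m)"
    using binomial_fact_lemma[OF assms] by (simp add: mult_ac)
  finally show ?thesis by simp
qed

text \<open>Going from \<open>j\<close> to \<open>Suc j\<close> multiplies the coefficient by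
  \<open>(s - j) / Suc j\<close>, which is at least \<open>(s - k) / k\<close> as long as
  \<open>j < k\<close>.\<close>

lemma binomial_ratio:
  assumes "m \<le> k" "k \<le> s"
  shows "(s choose (k - m)) * (s - k) ^ m \<le> (s choose k) * k ^ m"
  using assms(1)
proof (induction m)
  case (Suc m)
  define j where "j = k - Suc m"
  have j: "k - m = Suc j" using Suc.prems by (simp add: j_def)
  have "(s choose j) * (s - k) \<le> (s choose j) * (s - j)"
    by (intro mult_left_mono diff_le_mono2) (use Suc.prems in \<open>auto simp: j_def\<close>)
  also have "\<dots> = (s choose Suc j) * Suc j"
  proof (cases s)
    case (Suc s')
    show ?thesis
      using binomial_absorption[of j s] binomial_absorb_comp[of s j] by (simp add: mult.commute)
  qed simp
  also have "\<dots> \<le> (s choose Suc j) * k" by (intro mult_left_mono) (use j in auto)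
  finally have "(s choose j) * (s - k) * (s - k) ^ m \<le> (s choose Suc j) * k * (s - k) ^ m" by simp
  also have "\<dots> \<le> (s choose k) * k ^ m * k" using Suc unfolding j by (simp add: mult_ac)
  finally show ?case unfolding j_def by (simp add: mult_ac)
qed simp

text \<open>The coefficient \<open>k choose m\<close> counts factorizations inside one block, the
  root compares the contributions of the block to the sizes of \<open>X\<close> and
  \<open>Y\<close>. The final \<open>- 1 - ln (real m)\<close> is Stirling's error for
  \<open>fact m\<close>.\<close>

lemma block_gain_lower:
  assumes "1 \<le> m" "m < k" "k < s"
  shows "real m * (1 + ln (real k - real m) - ln (real m) + ln ((real s - real k) / real k) / 2) - 1 - ln (real m)
    \<le> ln (real (k choose m) * sqrt (real (s choose k) / real (s choose (k - m))))"
proof -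
  have pos: "0 < k choose m" "0 < s choose k" "0 < s choose (k - m)" using assms by auto
  have "real ((k - m) ^ m) \<le> real ((k choose m) * fact m)"
    using power_diff_le_binomial_fact[of m k] assms by (simp only: of_nat_le_iff)
  then have "ln ((real k - real m) ^ m) \<le> ln (real (k choose m) * fact m)"
    using assms pos by (intro ln_mono) (auto simp: of_nat_diff)
  then have 1: "real m * ln (real k - real m) \<le> ln (real (k choose m)) + ln (fact m)"
    using assms pos by (simp add: ln_mult ln_realpow)
  have "real ((s choose (k - m)) * (s - k) ^ m) \<le> real ((s choose k) * k ^ m)"
    using binomial_ratio[of m k s] assms by (simp only: of_nat_le_iff)
  then have "ln (real (s choose (k - m)) * (real s - real k) ^ m) \<le> ln (real (s choose k) * real k ^ m)"
    using assms pos by (intro ln_mono) (auto simp: of_nat_diff)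
  then have 2: "ln (real (s choose (k - m))) + real m * ln (real s - real k) \<le> ln (real (s choose k)) + real m * ln (real k)"
    using assms pos by (simp add: ln_mult ln_realpow)
  have e1: "ln (real (k choose m) * sqrt (real (s choose k) / real (s choose (k - m))))
    = ln (real (k choose m)) + (ln (real (s choose k)) - ln (real (s choose (k - m)))) / 2"
    using pos by (simp add: ln_mult ln_sqrt ln_div)
  have e2: "ln ((real s - real k) / real k) = ln (real s - real k) - ln (real k)"
    using assms by (simp add: ln_div)
  have e3: "real m * (1 + a - b + (c - d) / 2) = real m + real m * a - real m * b + (real m * c - real m * d) / 2"
    for a b c d :: real
    by (simp add: algebra_simps diff_divide_distrib)
  have e4: "M + a - b + (c - d) / 2 - 1 - w \<le> C + (X - Y) / 2"
    if "a \<le> C + F" "Y + c \<le> X + d" "F \<le> b - M + 1 + w" for M a b c d w C F X Y :: real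
    using that by (simp add: field_simps)
  show ?thesis unfolding e1 e2 e3 by (rule e4[OF 1 2 ln_fact_le[OF assms(1)]])
qed

lemma ln_one_minus_ge:
  fixes x :: real
  assumes "0 \<le> x" "x \<le> 1 / 2"
  shows "- 2 * x \<le> ln (1 - x)"
proof -
  have "ln (1 / (1 - x)) \<le> 1 / (1 - x) - 1" using assms by (intro ln_le_minus_one) auto
  also have "\<dots> = x / (1 - x)" using assms by (simp add: field_simps)
  also have "\<dots> \<le> x / (1 / 2)" using assms by (intro divide_left_mono) auto
  finally show ?thesis using assms by (simp add: ln_div)
qed

text \<open>At these sizes \<open>sqrt (k * s) / m\<close> is about \<open>exp (u / 2) / b\<close>.
  By \<open>c1\<close> \<open>m\<close> is small against \<open>k\<close>, by \<open>c2\<close>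
  \<open>k\<close> is small against \<open>s\<close>. Neglecting \<open>m\<close>, \<open>k\<close>
  and the rounding of \<open>k\<close> costs \<open>ln (1 - \<epsilon>)\<close> with total
  coefficient 2, hence at most \<open>4 * \<epsilon>\<close>.\<close>

lemma weighted_block_gain:
  fixes s m k :: nat and lam u b \<epsilon> :: real
  assumes lam: "lam > 0" and u: "u > 0" and b: "0 \<le> b" "b \<le> 1" and eps: "0 < \<epsilon>" "\<epsilon> \<le> 1 / 2"
    and k: "k = nat \<lfloor>lam\<^sup>2 * real s * exp (- u) / u\<^sup>2\<rfloor>" and m: "1 \<le> m" "real m \<le> b * lam * real s * exp (- u) / u"
    and c1: "2 * u / lam \<le> \<epsilon>" and c2: "lam\<^sup>2 * exp (- u) \<le> \<epsilon> * u\<^sup>2"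
  shows "real m * (1 + u / 2 - ln b - 4 * \<epsilon>) - 1 - ln (real m)
    \<le> ln (real (k choose m) * sqrt (real (s choose k) / real (s choose (k - m))))"
    and "m < k" "k < s"
proof -
  define k' where "k' = lam\<^sup>2 * real s * exp (- u) / u\<^sup>2"
  define m' where "m' = b * lam * real s * exp (- u) / u"
  have m'1: "real m \<le> m'" "1 \<le> m'" using m by (auto simp: m'_def)
  have b0: "b > 0" using m'1 b by (cases "b = 0") (auto simp: m'_def)
  have s0: "real s > 0" using m'1 by (cases "s = 0") (auto simp: m'_def)
  have km: "k' = m' * lam / (b * u)" using b0 u lam by (simp add: k'_def m'_def power2_eq_square)
  have "m' * lam / u \<le> k'" unfolding km using m'1 lam u b b0 by (intro divide_left_mono) auto
  then have mk: "m' \<le> k' * (u / lam)" using lam u by (simp add: field_simps)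
  have ul: "u / lam \<le> \<epsilon> / 2" "u / lam > 0" using c1 u lam by (auto simp: field_simps)
  \<comment> \<open>Since \<open>m \<ge> 1\<close>, \<open>k'\<close> is at least
    \<open>2 / \<epsilon>\<close>, so taking the floor reduces it by a factor of at least
    \<open>1 - \<epsilon>\<close>.\<close>
  have "1 \<le> k' * (u / lam)" using mk m'1 by simp
  also have "\<dots> \<le> k' * (\<epsilon> / 2)" using ul mk m'1 lam u by (intro mult_left_mono) (auto simp: k'_def)
  finally have k'e: "2 \<le> \<epsilon> * k'" by (simp add: mult.commute)
  have k'0: "k' > 0" using s0 lam u by (simp add: k'_def)
  have kk': "real k \<le> k'" "k' - 1 \<le> real k"
  proof -
    have "real k = of_int \<lfloor>k'\<rfloor>" unfolding k k'_def[symmetric] using k'0 by simp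
    then show "real k \<le> k'" "k' - 1 \<le> real k" by linarith+
  qed
  have k'4: "k' \<ge> 4" 
  proof -
    have "\<epsilon> * k' \<le> 1 / 2 * k'" using eps k'0 by (intro mult_right_mono) auto
    then show ?thesis using k'e by simp
  qed
  have k'eps: "k' * (1 - \<epsilon>) \<le> real k" using kk' k'e by (simp add: algebra_simps)
  have mk2: "real m \<le> \<epsilon> * real k"
  proof -
    have "real m \<le> k' * (\<epsilon> / 2)"
      using m'1 mk mult_left_mono[OF ul(1), of k'] k'0 by linarith
    also have "\<dots> \<le> \<epsilon> * real k"
    proof -
      have "k' / 2 \<le> real k" using kk' k'4 by linarith
      then have "\<epsilon> * (k' / 2) \<le> \<epsilon> * real k" using eps by (intro mult_left_mono) auto
      then show ?thesis by (simp add: mult_ac)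
    qed
    finally show ?thesis .
  qed
  have k0: "real k > 0" using kk' k'4 by linarith
  have ks2: "real k \<le> \<epsilon> * real s"
  proof -
    have "k' = lam\<^sup>2 * exp (- u) / u\<^sup>2 * real s" by (simp add: k'_def)
    also have "\<dots> \<le> \<epsilon> * real s" using c2 u by (intro mult_right_mono) (auto simp: field_simps)
    finally show ?thesis using kk' by linarith
  qed
  have "real m \<le> 1 / 2 * real k" using mk2 eps k0 mult_right_mono[of \<epsilon> "1/2" "real k"] by linarith
  then show mk3: "m < k" using k0 by linarith
  have "real k \<le> 1 / 2 * real s" using ks2 eps s0 mult_right_mono[of \<epsilon> "1/2" "real s"] by linarith
  then show ks3: "k < s" using s0 by linarith
  have le: "ln (1 - \<epsilon>) \<ge> - 2 * \<epsilon>" using eps by (intro ln_one_minus_ge) auto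
  have l1: "ln (real k) + ln (1 - \<epsilon>) \<le> ln (real k - real m)"
  proof -
    have "ln (real k * (1 - \<epsilon>)) \<le> ln (real k - real m)"
      using k0 mk2 eps by (intro ln_mono) (auto simp: algebra_simps)
    then show ?thesis using k0 eps by (simp add: ln_mult)
  qed
  have l2: "ln (real s) + ln (1 - \<epsilon>) - ln (real k) \<le> ln ((real s - real k) / real k)"
  proof -
    have "ln (real s * (1 - \<epsilon>)) \<le> ln (real s - real k)"
      using s0 ks2 eps by (intro ln_mono) (auto simp: algebra_simps)
    then show ?thesis using k0 s0 eps ks3 by (simp add: ln_mult ln_div)
  qed
  have l3: "ln k' + ln (1 - \<epsilon>) \<le> ln (real k)"
    using ln_mono[OF k'eps] k'0 eps by (simp add: ln_mult)
  have l4: "ln (real m) \<le> ln m'" using m m'1 by (intro ln_mono) auto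
  have l5: "ln k' = 2 * ln lam + ln (real s) - u - 2 * ln u"
    using lam s0 u by (simp add: k'_def ln_mult ln_div ln_realpow)
  have l6: "ln m' = ln b + ln lam + ln (real s) - u - ln u"
    using lam s0 u b0 by (simp add: m'_def ln_mult ln_div)
  have "u / 2 - ln b - 4 * \<epsilon> \<le> ln (real k - real m) - ln (real m) + ln ((real s - real k) / real k) / 2"
    using l1 l2 l3 l4 l5 l6 le by (simp add: field_simps)
  then have "real m * (1 + u / 2 - ln b - 4 * \<epsilon>) \<le> real m * (1 + ln (real k - real m) - ln (real m) + ln ((real s - real k) / real k) / 2)"
    by (intro mult_left_mono) auto
  then show "real m * (1 + u / 2 - ln b - 4 * \<epsilon>) - 1 - ln (real m)
    \<le> ln (real (k choose m) * sqrt (real (s choose k) / real (s choose (k - m))))"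
    using block_gain_lower[OF m(1) mk3 ks3] by linarith
qed

section \<open>Comparison of sums with integrals\<close>

text \<open>Abel summation: bounded partial sums against decreasing weights.\<close>

lemma abs_weighted_sum_le:
  fixes a f :: "nat \<Rightarrow> real"
  assumes "\<And>n. n \<le> N \<Longrightarrow> \<bar>\<Sum>j=1..n. a j\<bar> \<le> K" "\<And>j. 1 \<le> j \<Longrightarrow> f (Suc j) \<le> f j" "\<And>j. 0 \<le> f j"
  shows "\<bar>\<Sum>j=1..N. a j * f j\<bar> \<le> K * f 1"
proof -
  define E where "E = (\<lambda>n. \<Sum>j=1..n. a j)"
  have K0: "K \<ge> 0" using assms(1)[of 0] by simp
  have "(\<Sum>j=1..n. a j * f j) = (\<Sum>j=1..n. E j * (f j - f (Suc j))) + E n * f (Suc n)" for n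
    by (induction n) (auto simp: E_def algebra_simps)
  then have "\<bar>\<Sum>j=1..N. a j * f j\<bar> \<le> \<bar>\<Sum>j=1..N. E j * (f j - f (Suc j))\<bar> + \<bar>E N * f (Suc N)\<bar>"
    by (metis abs_triangle_ineq)
  also have "\<bar>\<Sum>j=1..N. E j * (f j - f (Suc j))\<bar> \<le> (\<Sum>j=1..N. K * (f j - f (Suc j)))"
  proof (rule order.trans[OF sum_abs], rule sum_mono)
    fix j assume "j \<in> {1..N}"
    then show "\<bar>E j * (f j - f (Suc j))\<bar> \<le> K * (f j - f (Suc j))"
      using assms(1)[of j] assms(2)[of j] unfolding E_def by (auto simp: abs_mult intro!: mult_right_mono)
  qed
  also have "\<bar>E N * f (Suc N)\<bar> \<le> K * f (Suc N)"
    using assms(1)[of N] assms(3) unfolding E_def by (auto simp: abs_mult intro!: mult_right_mono)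
  also have "(\<Sum>j=1..N. K * (f j - f (Suc j))) + K * f (Suc N) = K * f 1"
  proof -
    have "(\<Sum>j=1..n. K * (f j - f (Suc j))) + K * f (Suc n) = K * f 1" for n
      by (induction n) (auto simp: algebra_simps)
    then show ?thesis .
  qed
  finally show ?thesis by simp
qed

text \<open>For a decreasing function the Riemann sums at right endpoints stay below the
  integral.\<close>

lemma sum_le_tail_integral:
  fixes f :: "real \<Rightarrow> real"
  assumes int: "(f has_integral T) {A..}" and anti: "\<And>x y. A \<le> x \<Longrightarrow> x \<le> y \<Longrightarrow> f y \<le> f x"
    and nn: "\<And>x. A \<le> x \<Longrightarrow> 0 \<le> f x" and h: "0 \<le> h"
  shows "(\<Sum>j=1..n. h * f (A + real j * h)) \<le> T"
proof -
  have ii: "f integrable_on {a..b}" if "A \<le> a" for a b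
    by (rule integrable_on_subinterval[of f "{A..}"]) (use int that in auto)
  have "(\<Sum>j=1..n. h * f (A + real j * h)) \<le> integral {A..A + real n * h} f"
  proof (induction n)
    case (Suc n)
    let ?a = "A + real n * h" and ?b = "A + real (Suc n) * h"
    have ab: "A \<le> ?a" "?a \<le> ?b" using h by (auto simp: algebra_simps)
    have "h * f ?b = integral {?a..?b} (\<lambda>_. f ?b)" using ab by (simp add: algebra_simps)
    also have "\<dots> \<le> integral {?a..?b} f"
      using ab anti by (intro integral_le ii) auto
    finally have "h * f ?b \<le> integral {?a..?b} f" .
    moreover have "integral {A..?a} f + integral {?a..?b} f = integral {A..?b} f"
      using ab by (intro Henstock_Kurzweil_Integration.integral_combine ii) auto
    ultimately show ?case using Suc by simp
  qed simp
  also have "\<dots> \<le> integral {A..} f"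
    using int nn ii by (intro integral_subset_le) auto
  also have "\<dots> = T" using int by (rule integral_unique)
  finally show ?thesis .
qed

lemma exp_over_antiderivative:
  fixes x :: real
  assumes "x > 0"
  shows "((\<lambda>x. - exp (- x) / x) has_field_derivative (exp (- x) / x + exp (- x) / x ^ 2)) (at x within S)"
proof -
  have "((\<lambda>x. - exp (- x) / x) has_field_derivative (- ((- (exp (- x) * x) - exp (- x)) / (x * x)))) (at x within S)"
    using assms by (auto intro!: derivative_eq_intros)
  moreover have "- ((- (exp (- x) * x) - exp (- x)) / (x * x)) = exp (- x) / x + exp (- x) / x ^ 2"
    using assms by (simp add: divide_simps power2_eq_square)
  ultimately show ?thesis by metis
qed

text \<open>The sum of the two integrands has the antiderivative \<open>- exp (- x) / x\<close>. The
  second claim uses \<open>1 / x \<le> 1 / A\<close> on the range of integration, that is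
  \<open>A * T' \<le> T\<close>.\<close>

lemma exponential_integrals:
  fixes A T T' :: real
  assumes A: "A > 0" and T: "((\<lambda>x. exp (- x) / x) has_integral T) {A..}"
    and T': "((\<lambda>x. exp (- x) / x ^ 2) has_integral T') {A..}"
  shows "A * (T + T') = exp (- A)" "exp (- A) \<le> (A + 1) * T" "T > 0"
proof -
  have "((\<lambda>x. exp (- x) / x + exp (- x) / x ^ 2) has_integral (0 - (- exp (- A) / A))) {A..}"
  proof (rule has_integral_to_inf)
    have I: "((\<lambda>x. exp (- x) / x + exp (- x) / x ^ 2) has_integral (- exp (- y) / y - (- exp (- A) / A))) {A..y}"
      if "A \<le> y" for y
      by (intro fundamental_theorem_of_calculus that exp_over_antiderivative[THEN has_real_derivative_iff_has_vector_derivative[THEN iffD1]])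
        (use A in auto)
    show "(\<lambda>x. exp (- x) / x + exp (- x) / x ^ 2) integrable_on {A..y}" for y
      using I[of y] by (cases "A \<le> y") auto
    have "((\<lambda>y. - exp (- y) / y - (- exp (- A) / A)) \<longlongrightarrow> 0 - (- exp (- A) / A)) at_top"
      by (intro tendsto_diff tendsto_const) real_asymp
    then show "((\<lambda>y. integral {A..y} (\<lambda>x. exp (- x) / x + exp (- x) / x ^ 2)) \<longlongrightarrow> 0 - (- exp (- A) / A)) at_top"
      by (rule Lim_transform_eventually) (use I in \<open>auto simp: eventually_at_top_linorder intro!: exI[of _ A] integral_unique[symmetric]\<close>)
  qed (use A in auto)
  moreover have "((\<lambda>x. exp (- x) / x + exp (- x) / x ^ 2) has_integral (T + T')) {A..}"
    by (intro has_integral_add T T')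
  ultimately have eq: "T + T' = exp (- A) / A" using has_integral_unique[of "\<lambda>x. exp (- x) / x + exp (- x) / x ^ 2" "0 - (- exp (- A) / A)" "{A..}" "T + T'"] by simp
  then show 1: "A * (T + T') = exp (- A)" using A by simp
  have "T' \<le> T / A"
  proof (rule has_integral_le[OF T'])
    show "((\<lambda>x. exp (- x) / x / A) has_integral (T / A)) {A..}" by (intro has_integral_divide T)
    fix x assume "x \<in> {A..}"
    then show "exp (- x) / x ^ 2 \<le> exp (- x) / x / A"
      using A by (simp add: power2_eq_square divide_simps)
  qed
  then have "A * T' \<le> T" using A by (simp add: field_simps)
  then show 2: "exp (- A) \<le> (A + 1) * T" using 1 by (simp add: algebra_simps)
  then have "0 < (A + 1) * T" by (smt (verit) exp_gt_zero)
  then show "T > 0" using A by (simp add: zero_less_mult_iff)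
qed

section \<open>The resonating sets\<close>

text \<open>The weight \<open>exp (- \<alpha> * z) * (1 + \<alpha> * z) / z\<^sup>2\<close>
  decreases and is minus the derivative of \<open>exp (- \<alpha> * z) / z\<close>, so the mean
  value theorem encloses the differences of the latter. This lets the weighted block sums
  telescope.\<close>

lemma exp_over_difference_bounds:
  fixes \<alpha> x y :: real
  assumes "0 \<le> \<alpha>" "0 < x" "x \<le> y"
  shows "(y - x) * (exp (- \<alpha> * y) * (1 + \<alpha> * y) / y\<^sup>2) \<le> exp (- \<alpha> * x) / x - exp (- \<alpha> * y) / y"
    and "exp (- \<alpha> * x) / x - exp (- \<alpha> * y) / y \<le> (y - x) * (exp (- \<alpha> * x) * (1 + \<alpha> * x) / x\<^sup>2)"
    and "exp (- \<alpha> * y) * (1 + \<alpha> * y) / y\<^sup>2 \<le> exp (- \<alpha> * x) * (1 + \<alpha> * x) / x\<^sup>2"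
proof -
  define f where "f = (\<lambda>z. exp (- \<alpha> * z) * (1 + \<alpha> * z) / z\<^sup>2)"
  have anti: "f b \<le> f a" if "0 < a" "a \<le> b" for a b
  proof -
    have "(1 + \<alpha> * b) / b\<^sup>2 = 1 / b\<^sup>2 + \<alpha> / b" using that by (simp add: add_divide_distrib power2_eq_square)
    also have "\<dots> \<le> 1 / a\<^sup>2 + \<alpha> / a"
      using that assms by (intro add_mono divide_left_mono power_mono) auto
    also have "\<dots> = (1 + \<alpha> * a) / a\<^sup>2" using that by (simp add: add_divide_distrib power2_eq_square)
    finally have "exp (- \<alpha> * b) * ((1 + \<alpha> * b) / b\<^sup>2) \<le> exp (- \<alpha> * a) * ((1 + \<alpha> * a) / a\<^sup>2)"
      using that assms by (intro mult_mono) (auto intro!: mult_left_mono)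
    then show ?thesis by (simp add: f_def)
  qed
  show "exp (- \<alpha> * y) * (1 + \<alpha> * y) / y\<^sup>2 \<le> exp (- \<alpha> * x) * (1 + \<alpha> * x) / x\<^sup>2"
    using anti[OF assms(2,3)] by (simp add: f_def)
  have "(y - x) * f y \<le> exp (- \<alpha> * x) / x - exp (- \<alpha> * y) / y \<and> exp (- \<alpha> * x) / x - exp (- \<alpha> * y) / y \<le> (y - x) * f x"
  proof (cases "x = y")
    case False
    have der: "((\<lambda>z. exp (- \<alpha> * z) / z) has_field_derivative - f z) (at z)" if "x \<le> z" for z
    proof -
      have "((\<lambda>z. exp (- \<alpha> * z) / z) has_field_derivative ((exp (- \<alpha> * z) * - \<alpha>) * z - exp (- \<alpha> * z) * 1) / (z * z)) (at z)"
        by (rule derivative_eq_intros refl | use that assms in simp)+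
      moreover have "((exp (- \<alpha> * z) * - \<alpha>) * z - exp (- \<alpha> * z) * 1) / (z * z) = - f z"
        by (simp add: f_def power2_eq_square algebra_simps minus_divide_left)
      ultimately show ?thesis by metis
    qed
    obtain z where z: "x < z" "z < y" "exp (- \<alpha> * y) / y - exp (- \<alpha> * x) / x = (y - x) * - f z"
      using MVT2[of x y "\<lambda>z. exp (- \<alpha> * z) / z" "\<lambda>z. - f z"] der assms False by auto
    have "f y \<le> f z" "f z \<le> f x" using z assms by (auto intro!: anti)
    then have "(y - x) * f y \<le> (y - x) * f z" "(y - x) * f z \<le> (y - x) * f x"
      using assms by (auto intro!: mult_left_mono)
    then show ?thesis using z(3) by linarith
  qed auto
  then show "(y - x) * (exp (- \<alpha> * y) * (1 + \<alpha> * y) / y\<^sup>2) \<le> exp (- \<alpha> * x) / x - exp (- \<alpha> * y) / y"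
    "exp (- \<alpha> * x) / x - exp (- \<alpha> * y) / y \<le> (y - x) * (exp (- \<alpha> * x) * (1 + \<alpha> * x) / x\<^sup>2)"
    by (auto simp: f_def)
qed

lemma sqrt_prod: "sqrt (\<Prod>j\<in>S. f j) = (\<Prod>j\<in>S. sqrt (f j))"
  by (induction S rule: infinite_finite_induct) (auto simp: real_sqrt_mult)

lemma mult_exp_minus_antimono:
  fixes x u :: real
  assumes "1 \<le> x" "x \<le> u"
  shows "u * exp (- u) \<le> x * exp (- x)"
proof -
  have "u = x * (1 + (u - x) / x)" using assms by (simp add: field_simps)
  also have "\<dots> \<le> x * (1 + (u - x))"
    using assms by (intro mult_left_mono add_left_mono) (auto simp: divide_simps mult_le_cancel_left1)
  also have "\<dots> \<le> x * exp (u - x)" using assms by (intro mult_left_mono exp_ge_add_one_self) auto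
  finally have "u * exp (- u) \<le> x * exp (u - x) * exp (- u)" by (intro mult_right_mono) auto
  also have "\<dots> = x * exp (- x)" by (simp add: mult.assoc flip: exp_add)
  finally show ?thesis .
qed

text \<open>Here \<open>lam\<close> and \<open>u0\<close> are close to \<open>sqrt (\<theta> log q log log q)\<close> and \<open>log log q\<close>, and \<open>L\<close> is \<open>log N\<close> up to a
  constant. Since \<open>e\<^sup>u\<^sup>0\<close> exceeds \<open>log q\<close>, leaving out the prime divisors of \<open>q\<close> changes the
  Mertens sums by at most 1.\<close>

locale resonator_params =
  fixes q J :: nat and \<eta> lam u0 A T L :: real
  assumes q: "q > 0" and eta: "0 < \<eta>" "\<eta> \<le> 1 / 8" and lam: "1 \<le> lam" and u0: "1 \<le> u0"
    and lnq: "ln (real q) \<le> exp u0" and A: "A > 0"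
    and T: "((\<lambda>x. exp (- x) / x) has_integral T) {A..}" and expA: "exp (- A) \<le> (A + 1) * T"
    and uJ_ge: "u0 / \<eta> \<le> u0 + real J * \<eta>"
    and uJ_lam: "2 * (u0 + real J * \<eta>) / lam \<le> \<eta> / 4"
    and lam_u0: "lam\<^sup>2 * exp (- u0) \<le> \<eta> / 4 * u0\<^sup>2"
    and A_u0: "16 * (1 + A) \<le> \<eta> * u0"
    and uJ_T: "u0 + real J * \<eta> + 9 \<le> \<eta> / 4 * (lam * T)"
    and L: "lam * T - 2 \<le> L" "L \<le> lam * T" and T_lam: "T \<le> lam"
    and err: "12 + ln lam + real J * (2 + 2 * ln lam + A * (u0 + real J * \<eta>) / u0) \<le> \<eta> * (lam * exp (- A) / u0)"
begin

text \<open>The index 0 belongs to the single large prime, chosen such that \<open>z\<close> is close to \<open>e\<^sup>L\<close>;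
  the blocks proper are numbered from 1.\<close>

definition u where "u j = u0 + real j * \<eta>"
text \<open>With this scaling \<open>\<alpha> * u j = A + j * (\<alpha> * \<eta>)\<close>, so sums
  over blocks become Riemann sums starting at \<open>A\<close>.\<close>

definition \<alpha> where "\<alpha> = A / u0"
definition blk where "blk j = {p. prime p \<and> \<not> p dvd q \<and> u j - \<eta> < ln (real p) \<and> ln (real p) \<le> u j}"
definition s where "s j = card (blk j)"
definition k where "k j = (if j = 0 then 1 else nat \<lfloor>lam\<^sup>2 * real (s j) * exp (- u j) / (u j)\<^sup>2\<rfloor>)"
text \<open>The factor \<open>1 - \<eta>\<close> reserves a share of \<open>L\<close> for the filler
  prime.\<close>

definition m where "m j = (if j = 0 then 1 else nat \<lfloor>((1 - \<eta>) * exp (- \<alpha> * u j)) * lam * real (s j) * exp (- u j) / u j\<rfloor>)"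
definition F where "F = L - (\<Sum>j=1..J. real (m j) * u j)"
text \<open>Length 8 beats the error 7 of \<open>mertens_interval_coprime\<close>, so the interval
  contains such primes.\<close>

definition filler where "filler = {p. prime p \<and> \<not> p dvd q \<and> F - 8 < ln (real p) \<and> ln (real p) \<le> F}"
definition P where "P j = (if j = 0 then filler else blk j)"
definition sig where "sig j = (\<Sum>p\<in>blk j. ln (real p) / real p)"
text \<open>The scale of the logarithmic gain beyond \<open>L / 2\<close>.\<close>

definition W where "W = lam * exp (- A) / u0"

lemma u_mono: "i \<le> j \<Longrightarrow> u i \<le> u j"
  using eta by (simp add: u_def mult_right_mono)

lemma u_facts: "u0 \<le> u j" "1 \<le> u j" "0 < u j" "u (Suc j) = u j + \<eta>"
proof -
  show a: "u0 \<le> u j" using eta by (simp add: u_def)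
  then show "1 \<le> u j" "0 < u j" using u0 by auto
  show "u (Suc j) = u j + \<eta>" by (simp add: u_def algebra_simps)
qed

lemma alpha: "0 \<le> \<alpha>" "\<alpha> * u0 = A" "A \<le> \<alpha> * u j"
proof -
  show 1: "0 \<le> \<alpha>" using A u0 by (simp add: \<alpha>_def)
  show 2: "\<alpha> * u0 = A" using u0 by (simp add: \<alpha>_def)
  show "A \<le> \<alpha> * u j" using mult_left_mono[OF u_facts(1) 1, of j] 2 by simp
qed

lemma T_pos: "T > 0"
proof -
  have "0 < (A + 1) * T" using expA by (smt (verit) exp_gt_zero)
  then show ?thesis using A by (simp add: zero_less_mult_iff)
qed

lemma finite_blk: "finite (blk j)"
proof (rule finite_subset)
  show "blk j \<subseteq> {..nat \<lfloor>exp (u j)\<rfloor>}"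
  proof
    fix p assume p: "p \<in> blk j"
    then have "real p > 0" "ln (real p) \<le> u j" by (auto simp: blk_def prime_gt_0_nat)
    then have "real p \<le> exp (u j)" by (metis exp_ln exp_le_cancel_iff)
    then show "p \<in> {..nat \<lfloor>exp (u j)\<rfloor>}" by (simp add: le_nat_iff le_floor_iff)
  qed
qed auto

section \<open>Mertens sums over the blocks\<close>

lemma sum_sig:
  assumes "n \<le> N" shows "\<bar>\<Sum>j=1..n. (sig j - \<eta>)\<bar> \<le> 7"
proof -
  let ?S = "\<lambda>n. {p. prime p \<and> \<not> p dvd q \<and> u0 < ln (real p) \<and> ln (real p) \<le> u n}"
  have M: "finite (?S n) \<and> \<bar>(\<Sum>p\<in>?S n. ln (real p) / real p) - (u n - u0)\<bar> \<le> 7" for n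
    using mertens_interval_coprime[of u0 "u n" q] u_facts(1)[of n] u0 lnq q by auto
  have "(\<Sum>j=1..n. sig j) = (\<Sum>p\<in>?S n. ln (real p) / real p)"
  proof (induction n)
    case 0
    have "?S 0 = {}" by (auto simp: u_def)
    then show ?case by (simp only: sum.empty) simp
  next
    case (Suc n)
    have "?S (Suc n) = ?S n \<union> blk (Suc n)"
      using u_facts(1)[of n] u_facts(4)[of n] eta by (auto simp: blk_def)
    moreover have "?S n \<inter> blk (Suc n) = {}" using u_facts(4)[of n] by (auto simp: blk_def)
    ultimately have "(\<Sum>p\<in>?S (Suc n). ln (real p) / real p) = (\<Sum>p\<in>?S n. ln (real p) / real p) + sig (Suc n)"
      unfolding sig_def using M finite_blk by (metis (no_types, lifting) sum.union_disjoint)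
    then show ?case using Suc by simp
  qed
  then show ?thesis using M[of n] by (simp add: sum_subtractf u_def)
qed

text \<open>In sums with decreasing weights the masses \<open>sig j\<close> may be replaced by their
  mean \<open>\<eta>\<close>; the error is governed by the first weight alone.\<close>

lemma weighted_sum_sig:
  assumes "\<And>j. 1 \<le> j \<Longrightarrow> f (Suc j) \<le> f j" "\<And>j. 0 \<le> f j"
  shows "\<bar>(\<Sum>j=1..J. sig j * f j) - \<eta> * (\<Sum>j=1..J. f j)\<bar> \<le> 7 * f 1"
proof -
  have "(\<Sum>j=1..J. sig j * f j) - \<eta> * (\<Sum>j=1..J. f j) = (\<Sum>j=1..J. (sig j - \<eta>) * f j)"
    by (simp add: sum_subtractf sum_distrib_left left_diff_distrib)
  then show ?thesis using abs_weighted_sum_le[of J "\<lambda>j. sig j - \<eta>" 7 f] sum_sig assms by simp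
qed

text \<open>Inside a block \<open>ln p\<close> varies by at most \<open>\<eta>\<close>, and
  \<open>x * exp (- x)\<close> decreases for \<open>x \<ge> 1\<close>, so every term of
  \<open>sig j\<close> is \<open>u j * exp (- u j)\<close> up to a factor
  \<open>exp \<eta>\<close>.\<close>

lemma sig_bounds:
  assumes "j \<ge> 1"
  shows "real (s j) * exp (- u j) * u j \<le> sig j" "sig j \<le> exp \<eta> * (real (s j) * exp (- u j) * u j)"
proof -
  have "u j * exp (- u j) \<le> ln (real p) / real p \<and> ln (real p) / real p \<le> exp \<eta> * (u j * exp (- u j))"
    if p: "p \<in> blk j" for p
  proof -
    have p0: "real p > 0" "u j - \<eta> < ln (real p)" "ln (real p) \<le> u j" using p by (auto simp: blk_def prime_gt_0_nat)
    have eq: "ln (real p) / real p = ln (real p) * exp (- ln (real p))"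
      using p0 by (simp add: exp_minus field_simps)
    have "u j - \<eta> = u (j - 1)" using u_facts(4)[of "j - 1"] assms by simp
    then have 1: "1 \<le> ln (real p)" using p0 u_facts(2)[of "j - 1"] by linarith
    have "ln (real p) * exp (- ln (real p)) \<le> u j * exp (\<eta> - u j)"
      using p0 1 u_facts(3)[of j] by (intro mult_mono) auto
    also have "\<dots> = exp \<eta> * (u j * exp (- u j))" by (simp add: exp_diff exp_minus field_simps)
    finally show ?thesis using mult_exp_minus_antimono[OF 1 p0(3)] eq by simp
  qed
  then have "(\<Sum>p\<in>blk j. u j * exp (- u j)) \<le> sig j" "sig j \<le> (\<Sum>p\<in>blk j. exp \<eta> * (u j * exp (- u j)))"
    unfolding sig_def by (blast intro: sum_mono)+
  then show "real (s j) * exp (- u j) * u j \<le> sig j" "sig j \<le> exp \<eta> * (real (s j) * exp (- u j) * u j)"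
    by (simp_all add: s_def mult_ac)
qed

lemma sig_nonneg: "0 \<le> sig j"
  unfolding sig_def by (rule sum_nonneg) (auto simp: blk_def ln_prime_nonneg)

text \<open>This controls the logarithms of the elements of \<open>X\<close>. A block contributes at
  most \<open>lam\<^sup>2 * sig j / (u j)\<^sup>2\<close>; the main term is the integral of the
  inverse square from \<open>u0\<close> on, and the second term is the Mertens error.\<close>

lemma sum_k_le: "(\<Sum>j=1..J. real (k j) * u j) \<le> lam\<^sup>2 * (1 / u0 + 7 / u0\<^sup>2)"
proof -
  have "(\<Sum>j=1..J. real (k j) * u j) \<le> (\<Sum>j=1..J. lam\<^sup>2 * (sig j * (1 / (u j)\<^sup>2)))"
  proof (rule sum_mono)
    fix j assume j: "j \<in> {1..J}"
    have "real (k j) \<le> lam\<^sup>2 * real (s j) * exp (- u j) / (u j)\<^sup>2"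
      using j by (simp add: k_def)
    then have "real (k j) * u j \<le> lam\<^sup>2 * real (s j) * exp (- u j) / (u j)\<^sup>2 * u j"
      using u_facts(3)[of j] by (intro mult_right_mono) auto
    also have "\<dots> = lam\<^sup>2 * ((real (s j) * exp (- u j) * u j) * (1 / (u j)\<^sup>2))" by simp
    also have "\<dots> \<le> lam\<^sup>2 * (sig j * (1 / (u j)\<^sup>2))"
      using j by (intro mult_left_mono mult_right_mono sig_bounds) auto
    finally show "real (k j) * u j \<le> lam\<^sup>2 * (sig j * (1 / (u j)\<^sup>2))" .
  qed
  also have "\<dots> = lam\<^sup>2 * (\<Sum>j=1..J. sig j * (1 / (u j)\<^sup>2))" by (simp add: sum_distrib_left)
  also have "(\<Sum>j=1..J. sig j * (1 / (u j)\<^sup>2)) \<le> 1 / u0 + 7 / u0\<^sup>2"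
  proof -
    have sq: "1 / (u j)\<^sup>2 \<le> 1 / (u i)\<^sup>2" if "i \<le> j" for i j
      using u_facts(3)[of i] u_facts(3)[of j] u_mono[OF that] by (intro divide_left_mono power_mono) auto
    have "\<bar>(\<Sum>j=1..J. sig j * (1 / (u j)\<^sup>2)) - \<eta> * (\<Sum>j=1..J. 1 / (u j)\<^sup>2)\<bar> \<le> 7 * (1 / (u 1)\<^sup>2)"
      by (rule weighted_sum_sig) (auto intro!: sq)
    moreover have "7 * (1 / (u 1)\<^sup>2) \<le> 7 / u0\<^sup>2" using sq[of 0 1] by (simp add: u_def)
    moreover have "\<eta> * (\<Sum>j=1..n. 1 / (u j)\<^sup>2) \<le> 1 / u0 - 1 / u n" for n
    proof (induction n)
      case (Suc n)
      \<comment> \<open>As \<open>\<eta>\<close> is the distance of consecutive \<open>u\<close>,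
        the quotient \<open>\<eta> / (u n * u (Suc n))\<close> telescopes.\<close>
      have "\<eta> * (1 / (u (Suc n))\<^sup>2) \<le> \<eta> * (1 / (u n * u (Suc n)))"
        using eta u_facts(3)[of n] u_facts(3)[of "Suc n"] u_mono[of n "Suc n"]
        by (intro mult_left_mono divide_left_mono) (auto simp: power2_eq_square)
      also have "\<dots> = 1 / u n - 1 / u (Suc n)"
        using u_facts(3)[of n] u_facts(3)[of "Suc n"] u_facts(4)[of n] by (simp add: field_simps)
      finally show ?case using Suc by (simp add: distrib_left)
    qed (simp add: u_def)
    moreover have "1 / u J > 0" using u_facts(3) by simp
    ultimately show ?thesis by (smt (verit))
  qed
  finally show ?thesis by (simp add: mult_left_mono)
qed

definition m_hat where "m_hat j = ((1 - \<eta>) * exp (- \<alpha> * u j)) * lam * real (s j) * exp (- u j) / u j"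

lemma m_hat: "j \<ge> 1 \<Longrightarrow> real (m j) \<le> m_hat j" "j \<ge> 1 \<Longrightarrow> m_hat j - 1 \<le> real (m j)" "0 \<le> m_hat j"
proof -
  show nn: "0 \<le> m_hat j" using eta lam u_facts(3)[of j] by (auto simp: m_hat_def intro!: mult_nonneg_nonneg divide_nonneg_nonneg)
  assume "j \<ge> 1"
  then have "m j = nat \<lfloor>m_hat j\<rfloor>" by (simp add: m_def m_hat_def)
  then have "real (m j) = of_int \<lfloor>m_hat j\<rfloor>" using nn by simp
  then show "real (m j) \<le> m_hat j" "m_hat j - 1 \<le> real (m j)" by linarith+
qed

text \<open>Bounds the part of \<open>L\<close> used up by the blocks. In the variable
  \<open>\<alpha> * u j\<close> the main term is a Riemann sum for \<open>T\<close>; the Mertens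
  error consumes only half of the \<open>\<eta>\<close> saved by the factor
  \<open>1 - \<eta>\<close>.\<close>

lemma sum_m_u_le: "(\<Sum>j=1..J. real (m j) * u j) \<le> (1 - \<eta> / 2) * (lam * T)"
proof -
  define f where "f = (\<lambda>j. exp (- \<alpha> * u j) / u j)"
  have fmono: "f j \<le> f i" if "i \<le> j" for i j
    unfolding f_def using u_mono[OF that] u_facts(3)[of i] alpha(1)
    by (intro frac_le) (auto intro: mult_left_mono)
  have fnn: "0 \<le> f j" for j unfolding f_def using u_facts(3)[of j] by simp
  have "(\<Sum>j=1..J. real (m j) * u j) \<le> (\<Sum>j=1..J. ((1 - \<eta>) * lam) * (sig j * f j))"
  proof (rule sum_mono)
    fix j assume j: "j \<in> {1..J}"
    have "real (m j) * u j \<le> m_hat j * u j"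
      using j m_hat(1)[of j] u_facts(3)[of j] by (intro mult_right_mono) auto
    also have "\<dots> = ((1 - \<eta>) * lam) * ((real (s j) * exp (- u j) * u j) * f j)"
      using u_facts(3)[of j] by (simp add: m_hat_def f_def field_simps)
    also have "\<dots> \<le> ((1 - \<eta>) * lam) * (sig j * f j)"
      using j eta lam fnn by (intro mult_left_mono mult_right_mono sig_bounds) auto
    finally show "real (m j) * u j \<le> ((1 - \<eta>) * lam) * (sig j * f j)" .
  qed
  also have "\<dots> = ((1 - \<eta>) * lam) * (\<Sum>j=1..J. sig j * f j)" by (simp add: sum_distrib_left)
  also have "\<dots> \<le> ((1 - \<eta>) * lam) * ((1 + \<eta> / 2) * T)"
  proof (rule mult_left_mono)
    have "\<bar>(\<Sum>j=1..J. sig j * f j) - \<eta> * (\<Sum>j=1..J. f j)\<bar> \<le> 7 * f 1"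
      by (rule weighted_sum_sig) (auto intro!: fmono fnn)
    moreover have "\<eta> * (\<Sum>j=1..J. f j) \<le> T"
    proof -
      have "(\<Sum>j=1..J. (\<alpha> * \<eta>) * (exp (- (A + real j * (\<alpha> * \<eta>))) / (A + real j * (\<alpha> * \<eta>)))) \<le> T"
        using A alpha eta by (intro sum_le_tail_integral[OF T]) (auto intro!: frac_le)
      moreover have "(\<alpha> * \<eta>) * (exp (- (A + real j * (\<alpha> * \<eta>))) / (A + real j * (\<alpha> * \<eta>))) = \<eta> * f j" for j
      proof -
        have "A + real j * (\<alpha> * \<eta>) = \<alpha> * u j" using alpha(2) by (simp add: u_def algebra_simps)
        moreover have "\<alpha> > 0" using A u0 by (simp add: \<alpha>_def)
        ultimately show ?thesis by (simp add: f_def)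
      qed
      ultimately show ?thesis by (simp add: sum_distrib_left)
    qed
    \<comment> \<open>\<open>expA\<close> bounds \<open>exp (- A)\<close> by
      \<open>(A + 1) * T\<close>, and by \<open>A_u0\<close> the denominator \<open>u0\<close>
      outweighs \<open>1 + A\<close>.\<close>
    moreover have "7 * f 1 \<le> \<eta> / 2 * T"
    proof -
      have "7 * f 1 \<le> 7 * (exp (- A) / u0)"
        using fmono[of 0 1] alpha(2) by (simp add: f_def u_def)
      also have "\<dots> \<le> 7 * ((A + 1) * T / u0)"
        using expA u0 by (intro mult_left_mono divide_right_mono) auto
      also have "\<dots> = (7 * (1 + A)) * T / u0" by simp
      also have "\<dots> \<le> (\<eta> / 2 * u0) * T / u0"
        using A_u0 T_pos u0 A by (intro divide_right_mono mult_right_mono) auto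
      also have "\<dots> = \<eta> / 2 * T" using u0 by simp
      finally show ?thesis .
    qed
    ultimately show "(\<Sum>j=1..J. sig j * f j) \<le> (1 + \<eta> / 2) * T" by (simp add: algebra_simps abs_le_iff)
  qed (use eta lam in auto)
  also have "\<dots> = ((1 - \<eta>) * (1 + \<eta> / 2)) * (lam * T)" by simp
  also have "\<dots> \<le> (1 - \<eta> / 2) * (lam * T)"
    using eta lam T_pos by (intro mult_right_mono) (auto simp: algebra_simps)
  finally show ?thesis .
qed

lemma W_pos: "W > 0" using lam u0 by (simp add: W_def)

text \<open>The sum of \<open>\<eta> * phi j\<close> telescopes against \<open>G\<close>, and
  \<open>lam * G 0 = W\<close>. The loss \<open>2 * \<eta>\<close> consists of
  \<open>\<eta> / 2\<close> for the Mertens error, \<open>\<eta> / 2\<close> for \<open>G 1\<close>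
  in place of \<open>G 0\<close>, and \<open>\<eta>\<close> for stopping at
  \<open>J\<close>.\<close>

lemma sum_sig_phi:
  defines "phi \<equiv> (\<lambda>j. exp (- \<alpha> * u j) * (1 + \<alpha> * u j) / (u j)\<^sup>2)"
  shows "(1 - 2 * \<eta>) * W \<le> lam * (\<Sum>j=1..J. sig j * phi j)" "lam * (\<Sum>j=1..J. sig j * phi j) \<le> 2 * W"
proof -
  define G where "G = (\<lambda>j. exp (- \<alpha> * u j) / u j)"
  have step: "\<eta> * phi (Suc j) \<le> G j - G (Suc j)" "G j - G (Suc j) \<le> \<eta> * phi j" "phi (Suc j) \<le> phi j" for j
    using exp_over_difference_bounds[OF alpha(1) u_facts(3)[of j], of "u (Suc j)"] u_mono[of j "Suc j"] u_facts(4)[of j]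
    by (auto simp: phi_def G_def)
  have nn: "0 \<le> phi j" for j unfolding phi_def using alpha(1) u_facts(3)[of j] by simp
  have M: "\<bar>(\<Sum>j=1..J. sig j * phi j) - \<eta> * (\<Sum>j=1..J. phi j)\<bar> \<le> 7 * phi 1"
    by (rule weighted_sum_sig) (auto intro!: step nn)
  have up: "\<eta> * (\<Sum>j=1..n. phi j) \<le> G 0 - G n" for n
    by (induction n) (auto simp: distrib_left intro: order.trans[OF add_mono[OF _ step(1)]])
  have lo: "G 1 - G (Suc n) \<le> \<eta> * (\<Sum>j=1..n. phi j)" for n
  proof (induction n)
    case (Suc n)
    then show ?case using step(2)[of "Suc n"] by (simp add: distrib_left)
  qed simp
  have nu: "0 < exp (- A) / u0" using u0 by simp
  have p1: "7 * phi 1 \<le> 7 * (1 + A) / u0 * (exp (- A) / u0)"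
  proof -
    have "phi 0 = (1 + A) / u0 * (exp (- A) / u0)"
      using alpha(2) by (simp add: phi_def u_def power2_eq_square)
    then have "7 * phi 0 = 7 * (1 + A) / u0 * (exp (- A) / u0)" by (simp only: mult.assoc times_divide_eq_right)
    moreover have "7 * phi 1 \<le> 7 * phi 0" using step(3)[of 0] by simp
    ultimately show ?thesis by linarith
  qed
  have AU: "(1 + A) / u0 \<le> \<eta> / 16" using A_u0 u0 by (simp add: field_simps)
  have "7 * (1 + A) / u0 * (exp (- A) / u0) \<le> \<eta> / 2 * (exp (- A) / u0)"
  proof (rule mult_right_mono)
    have "7 * (1 + A) / u0 = 7 * ((1 + A) / u0)" by simp
    then show "7 * (1 + A) / u0 \<le> \<eta> / 2" using AU eta by linarith
  qed (use nu in auto)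
  with p1 have p1': "7 * phi 1 \<le> \<eta> / 2 * (exp (- A) / u0)" by linarith
  have G0: "G 0 = exp (- A) / u0" using alpha(2) by (simp add: G_def u_def)
  have Gn: "G j \<ge> 0" for j using u_facts(3)[of j] by (simp add: G_def)
  have "(\<Sum>j=1..J. sig j * phi j) \<le> 2 * (exp (- A) / u0)"
  proof -
    have "\<eta> / 2 * (exp (- A) / u0) \<le> 1 * (exp (- A) / u0)" using nu eta by (intro mult_right_mono) auto
    then show ?thesis using M up[of J] p1' G0 Gn[of J] by (simp add: abs_le_iff)
  qed
  then have "lam * (\<Sum>j=1..J. sig j * phi j) \<le> lam * (2 * (exp (- A) / u0))" using lam by (intro mult_left_mono) auto
  then show "lam * (\<Sum>j=1..J. sig j * phi j) \<le> 2 * W" by (simp add: W_def mult_ac)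
  have G1: "(1 - \<eta> / 2) * (exp (- A) / u0) \<le> G 1"
  proof -
    have "exp (- A) * (1 - A * \<eta> / u0) \<le> exp (- A) * exp (- (A * \<eta> / u0))"
      using exp_ge_add_one_self[of "- (A * \<eta> / u0)"] by (intro mult_left_mono) auto
    also have "\<dots> = exp (- \<alpha> * u 1)" using alpha(2) u0 by (simp add: u_def \<alpha>_def algebra_simps add_divide_distrib flip: exp_add)
    finally have e: "exp (- A) * (1 - A * \<eta> / u0) \<le> exp (- \<alpha> * u 1)" .
    have "1 / u 1 = (1 / u0) * (u0 / (u0 + \<eta>))" using u0 eta by (simp add: u_def field_simps)
    moreover have "1 - \<eta> / u0 \<le> u0 / (u0 + \<eta>)"
      using u0 eta by (simp add: field_simps)
    ultimately have f: "(1 / u0) * (1 - \<eta> / u0) \<le> 1 / u 1"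
      using u0 mult_left_mono[of "1 - \<eta> / u0" "u0 / (u0 + \<eta>)" "1 / u0"] by simp
    have x: "A / u0 \<le> \<eta> / 16" "1 / u0 \<le> \<eta> / 16"
      using AU A u0 by (auto simp: add_divide_distrib) (smt (verit) divide_nonneg_nonneg)+
    have "A * \<eta> / u0 \<le> \<eta> / 16" "\<eta> / u0 \<le> \<eta> / 16"
    proof -
      have "\<eta> / 16 * \<eta> \<le> \<eta> / 16 * 1" using eta by (intro mult_left_mono) auto
      moreover have "A / u0 * \<eta> \<le> \<eta> / 16 * \<eta>" "1 / u0 * \<eta> \<le> \<eta> / 16 * \<eta>"
        using x eta by (auto intro!: mult_right_mono simp del: times_divide_eq_left)
      ultimately show "A * \<eta> / u0 \<le> \<eta> / 16" "\<eta> / u0 \<le> \<eta> / 16" by simp_all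
    qed
    then have ge: "1 - \<eta> / 4 \<le> 1 - A * \<eta> / u0" "1 - \<eta> / 4 \<le> 1 - \<eta> / u0" using eta by linarith+
    have ge0: "0 \<le> 1 - A * \<eta> / u0" "0 \<le> 1 - \<eta> / u0" using ge eta by linarith+
    have "(1 - \<eta> / 2) * (exp (- A) / u0) \<le> ((1 - \<eta> / 4) * (1 - \<eta> / 4)) * (exp (- A) / u0)"
      using nu by (intro mult_right_mono) (auto simp: algebra_simps)
    also have "\<dots> = (exp (- A) * (1 - \<eta> / 4)) * ((1 / u0) * (1 - \<eta> / 4))" by simp
    also have "\<dots> \<le> (exp (- A) * (1 - A * \<eta> / u0)) * ((1 / u0) * (1 - \<eta> / u0))"
      using ge ge0 eta u0 by (intro mult_mono mult_left_mono mult_nonneg_nonneg) auto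
    also have "\<dots> \<le> exp (- \<alpha> * u 1) * (1 / u 1)"
      using e f ge0 u0 by (intro mult_mono mult_nonneg_nonneg) auto
    finally show ?thesis by (simp add: G_def)
  qed
  \<comment> \<open>The blocks reach beyond \<open>u0 / \<eta>\<close> by \<open>uJ_ge\<close>,
    where \<open>G\<close> has dropped by a factor \<open>\<eta>\<close>.\<close>
  have GJ: "G (Suc J) \<le> \<eta> * (exp (- A) / u0)"
  proof -
    have "u0 / \<eta> \<le> u (Suc J)" using uJ_ge eta u_facts(4)[of J] by (simp add: u_def)
    then have "exp (- \<alpha> * u (Suc J)) / u (Suc J) \<le> exp (- A) / (u0 / \<eta>)"
      using alpha(3)[of "Suc J"] u0 eta by (intro frac_le) auto
    then show ?thesis by (simp add: G_def mult_ac)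
  qed
  have "(1 - 2 * \<eta>) * (exp (- A) / u0) = (1 - \<eta> / 2) * (exp (- A) / u0) - \<eta> * (exp (- A) / u0) - \<eta> / 2 * (exp (- A) / u0)"
    by (simp add: algebra_simps)
  also have "\<dots> \<le> (\<Sum>j=1..J. sig j * phi j)" using M lo[of J] p1' G1 GJ by (simp add: abs_le_iff)
  finally have "lam * ((1 - 2 * \<eta>) * (exp (- A) / u0)) \<le> lam * (\<Sum>j=1..J. sig j * phi j)" using lam by (intro mult_left_mono) auto
  then show "(1 - 2 * \<eta>) * W \<le> lam * (\<Sum>j=1..J. sig j * phi j)" by (simp add: W_def mult_ac)
qed

text \<open>Before rounding, the terms are \<open>lam * sig j * phi j\<close> up to the factor
  \<open>1 - \<eta>\<close> and the factor \<open>exp \<eta>\<close> of \<open>sig_bounds\<close>;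
  with \<open>1 - 2 * \<eta>\<close> from \<open>sum_sig_phi\<close> this makes at least
  \<open>1 - 4 * \<eta>\<close>. Rounding lowers each \<open>m j\<close> by at most 1.\<close>

lemma sum_m_weighted:
  "(1 - 4 * \<eta>) * W - real J * (1 + A * u J / u0) \<le> (\<Sum>j=1..J. real (m j) * (1 + \<alpha> * u j))"
  "(\<Sum>j=1..J. real (m j)) \<le> 2 * W"
proof -
  define phi where "phi = (\<lambda>j. exp (- \<alpha> * u j) * (1 + \<alpha> * u j) / (u j)\<^sup>2)"
  have nn: "0 \<le> phi j" for j unfolding phi_def using alpha(1) u_facts(3)[of j] by simp
  have eq: "m_hat j * (1 + \<alpha> * u j) = (1 - \<eta>) * lam * ((real (s j) * exp (- u j) * u j) * phi j)" for j
    using u_facts(3)[of j] by (simp add: m_hat_def phi_def power2_eq_square)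
  have au: "0 \<le> \<alpha> * u j" for j using alpha(1) u_facts(3)[of j] by simp
  have "(\<Sum>j=1..J. real (m j)) \<le> (\<Sum>j=1..J. lam * (sig j * phi j))"
  proof (rule sum_mono)
    fix j assume j: "j \<in> {1..J}"
    have "real (m j) \<le> m_hat j * 1" using m_hat j by auto
    also have "\<dots> \<le> m_hat j * (1 + \<alpha> * u j)" using m_hat(3)[of j] au by (intro mult_left_mono) auto
    also have "\<dots> \<le> 1 * lam * (sig j * phi j)"
      unfolding eq using j eta lam nn u_facts(3)[of j] sig_nonneg by (intro mult_mono sig_bounds) auto
    finally show "real (m j) \<le> lam * (sig j * phi j)" by simp
  qed
  also have "\<dots> \<le> 2 * W" using sum_sig_phi(2) unfolding phi_def by (simp add: sum_distrib_left)
  finally show "(\<Sum>j=1..J. real (m j)) \<le> 2 * W" .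
  have e: "1 - \<eta> \<le> exp (- \<eta>)" using exp_ge_add_one_self[of "- \<eta>"] by simp
  have "(1 - 4 * \<eta>) * W \<le> ((1 - \<eta>) * (1 - \<eta>)) * ((1 - 2 * \<eta>) * W)"
  proof -
    have "(1 - 4 * \<eta>) \<le> ((1 - \<eta>) * (1 - \<eta>)) * (1 - 2 * \<eta>)"
    proof -
      have "0 \<le> \<eta> * \<eta> * (5 - 2 * \<eta>)" using eta by (intro mult_nonneg_nonneg) auto
      then show ?thesis by (simp add: algebra_simps)
    qed
    then show ?thesis using mult_right_mono[OF _ less_imp_le[OF W_pos]] by (metis mult.assoc)
  qed
  also have "\<dots> \<le> ((1 - \<eta>) * exp (- \<eta>)) * (lam * (\<Sum>j=1..J. sig j * phi j))"
  proof (rule mult_mono)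
    show "(1 - 2 * \<eta>) * W \<le> lam * (\<Sum>j=1..J. sig j * phi j)" using sum_sig_phi(1) unfolding phi_def .
    show "(1 - \<eta>) * (1 - \<eta>) \<le> (1 - \<eta>) * exp (- \<eta>)" using e eta by (intro mult_left_mono) auto
  qed (use eta W_pos in auto)
  also have "\<dots> = (\<Sum>j=1..J. (1 - \<eta>) * lam * ((exp (- \<eta>) * sig j) * phi j))"
    by (simp add: sum_distrib_left mult_ac)
  also have "\<dots> \<le> (\<Sum>j=1..J. m_hat j * (1 + \<alpha> * u j))"
  proof (rule sum_mono)
    fix j assume j: "j \<in> {1..J}"
    have "exp (- \<eta>) * sig j \<le> exp (- \<eta>) * (exp \<eta> * (real (s j) * exp (- u j) * u j))"
      using j by (intro mult_left_mono sig_bounds) auto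
    also have "\<dots> = real (s j) * exp (- u j) * u j" by (simp add: mult.assoc[symmetric] flip: exp_add)
    finally show "(1 - \<eta>) * lam * ((exp (- \<eta>) * sig j) * phi j) \<le> m_hat j * (1 + \<alpha> * u j)"
      unfolding eq using eta lam nn by (intro mult_left_mono mult_right_mono) auto
  qed
  also have "\<dots> \<le> (\<Sum>j=1..J. real (m j) * (1 + \<alpha> * u j) + (1 + A * u J / u0))"
  proof (rule sum_mono)
    fix j assume j: "j \<in> {1..J}"
    have "m_hat j * (1 + \<alpha> * u j) \<le> (real (m j) + 1) * (1 + \<alpha> * u j)"
      using m_hat(2)[of j] j au by (intro mult_right_mono) auto
    moreover have "\<alpha> * u j \<le> \<alpha> * u J" using j alpha(1) by (intro mult_left_mono u_mono) auto
    ultimately show "m_hat j * (1 + \<alpha> * u j) \<le> real (m j) * (1 + \<alpha> * u j) + (1 + A * u J / u0)"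
      by (simp add: \<alpha>_def algebra_simps)
  qed
  also have "\<dots> = (\<Sum>j=1..J. real (m j) * (1 + \<alpha> * u j)) + real J * (1 + A * u J / u0)"
    by (simp add: sum.distrib)
  finally show "(1 - 4 * \<eta>) * W - real J * (1 + A * u J / u0) \<le> (\<Sum>j=1..J. real (m j) * (1 + \<alpha> * u j))"
    by simp
qed

section \<open>The filler prime and the total gain\<close>

lemma sum_split: "(\<Sum>j\<in>{0..J}. f j) = f 0 + (\<Sum>j=1..J. f j)"
  by (simp add: sum.atLeast_Suc_atMost)

lemma F_bounds: "u J + 9 \<le> F + 1" "F \<le> L" "L \<le> lam\<^sup>2" "0 < F"
proof -
  have "u J + 9 \<le> \<eta> / 4 * (lam * T)" using uJ_T by (simp add: u_def)
  moreover have "L - (1 - \<eta> / 2) * (lam * T) \<le> F" using sum_m_u_le by (simp add: F_def)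
  moreover have "(1 - \<eta> / 2) * (lam * T) = lam * T - \<eta> / 2 * (lam * T)" by (simp add: algebra_simps)
  ultimately show 1: "u J + 9 \<le> F + 1" using L u_facts(2)[of J] by linarith
  show "0 < F" using 1 u_facts(2)[of J] by linarith
  show "F \<le> L" unfolding F_def using u_facts(3) by (simp add: sum_nonneg less_imp_le)
  have "lam * T \<le> lam * lam" using T_lam lam by (intro mult_left_mono) auto
  then show "L \<le> lam\<^sup>2" using L by (simp add: power2_eq_square)
qed

text \<open>The Mertens sum over the interval is at least \<open>8 - 7 = 1\<close>, and each of its
  terms is at most \<open>F / exp (F - 8)\<close>.\<close>

lemma finite_filler: "finite filler"
  and card_filler: "0 < card filler" "F - 8 - ln F \<le> ln (real (card filler))"
proof -
  have F8: "u J \<le> F - 8" using F_bounds(1) by simp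
  have u0F: "u0 \<le> F - 8" using F8 u_facts(1)[of J] by linarith
  then have "exp u0 \<le> exp (F - 8)" by simp
  then have "ln (real q) \<le> exp (F - 8)" using lnq by linarith
  then have M: "finite filler" "\<bar>(\<Sum>p\<in>filler. ln (real p) / real p) - 8\<bar> \<le> 7"
    using mertens_interval_coprime[of "F - 8" F q] u0F u0 q by (auto simp: filler_def)
  show "finite filler" by fact
  have "1 \<le> (\<Sum>p\<in>filler. ln (real p) / real p)" using M(2) by linarith
  also have "\<dots> \<le> (\<Sum>p\<in>filler. F / exp (F - 8))"
  proof (rule sum_mono)
    fix p assume p: "p \<in> filler"
    then have p0: "real p > 0" "F - 8 \<le> ln (real p)" "ln (real p) \<le> F" by (auto simp: filler_def prime_gt_0_nat)
    then have "exp (F - 8) \<le> real p" by (metis exp_ln exp_le_cancel_iff)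
    then show "ln (real p) / real p \<le> F / exp (F - 8)" using p0 F_bounds(4) by (intro frac_le) auto
  qed
  also have "\<dots> = real (card filler) * F / exp (F - 8)" by simp
  finally have c: "exp (F - 8) \<le> real (card filler) * F" by (simp add: pos_le_divide_eq)
  then show c0: "0 < card filler" using F_bounds(4) by (cases "card filler = 0") auto
  have "F - 8 \<le> ln (real (card filler) * F)" using ln_mono[OF c] by simp
  then show "F - 8 - ln F \<le> ln (real (card filler))" using c0 F_bounds(4) by (simp add: ln_mult)
qed

sublocale prime_blocks "{0..J}" P
proof
  show "disjoint_family_on P {0..J}"
    unfolding disjoint_family_on_def
  proof (intro ballI impI)
    have *: "P i \<inter> P j = {}" if ij: "i < j" "j \<le> J" for i j
    proof (rule ccontr)
      assume "P i \<inter> P j \<noteq> {}"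
      then obtain p where p: "p \<in> P i" "p \<in> blk j" using ij by (auto simp: P_def)
      then have pj: "u j - \<eta> < ln (real p)" "ln (real p) \<le> u j" by (auto simp: blk_def)
      show False
      proof (cases "i = 0")
        case True
        then have "F - 8 < ln (real p)" using p by (simp add: P_def filler_def)
        then show False using pj u_mono[OF ij(2)] F_bounds(1) by linarith
      next
        case False
        then have "ln (real p) \<le> u i" using p by (simp add: P_def blk_def)
        moreover have "u i + \<eta> \<le> u j" using u_mono[of "Suc i" j] ij u_facts(4)[of i] by simp
        ultimately show False using pj by linarith
      qed
    qed
    fix i j assume "i \<in> {0..J}" "j \<in> {0..J}" "i \<noteq> j"
    then show "P i \<inter> P j = {}" using *[of i j] *[of j i] by (cases "i < j") auto
  qed
  show "finite (P i)" for i by (simp add: P_def finite_filler finite_blk)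
  show "prime p" if "p \<in> P i" for i p using that by (auto simp: P_def filler_def blk_def split: if_splits)
qed simp

text \<open>Blocks with \<open>m j \<ge> 1\<close> are covered by \<open>weighted_block_gain\<close>
  with \<open>b = (1 - \<eta>) * exp (- \<alpha> * u j)\<close> and \<open>\<eta> / 4\<close> for
  \<open>\<epsilon>\<close>; if \<open>m j = 0\<close>, the gain is \<open>ln 1 = 0\<close>.\<close>

lemma m_le_k: "j \<le> J \<Longrightarrow> m j \<le> k j" and k_le_card: "j \<le> J \<Longrightarrow> k j \<le> card (P j)"
  and ln_gain: "j \<in> {1..J} \<Longrightarrow> real (m j) * (1 + u j / 2 + \<alpha> * u j - \<eta>) - (1 + 2 * ln lam)
    \<le> ln (real (k j choose m j) * sqrt (real (card (P j) choose k j) / real (card (P j) choose (k j - m j))))"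
proof -
  have pos: "m j < k j \<and> k j < s j \<and> real (m j) * (1 + u j / 2 + \<alpha> * u j - \<eta>) - 1 - ln (real (m j))
    \<le> ln (real (k j choose m j) * sqrt (real (s j choose k j) / real (s j choose (k j - m j))))"
    if j: "j \<in> {1..J}" and m1: "m j \<ge> 1" for j
  proof -
    define b where "b = (1 - \<eta>) * exp (- \<alpha> * u j)"
    have au: "0 \<le> \<alpha> * u j" using alpha(1) u_facts(3)[of j] by simp
    have b: "0 < b" "b \<le> 1" using eta au by (auto simp: b_def intro!: mult_le_one)
    have lnb: "ln b \<le> - \<alpha> * u j" using eta by (simp add: b_def ln_mult)
    have kj: "k j = nat \<lfloor>lam\<^sup>2 * real (s j) * exp (- u j) / (u j)\<^sup>2\<rfloor>" using j by (simp add: k_def)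
    have mj: "real (m j) \<le> b * lam * real (s j) * exp (- u j) / u j"
      using m_hat(1)[of j] j by (simp add: m_hat_def b_def)
    have c1: "2 * u j / lam \<le> \<eta> / 4"
    proof -
      have "2 * u j / lam \<le> 2 * u J / lam" using u_mono[of j J] j lam by (intro divide_right_mono) auto
      also have "\<dots> \<le> \<eta> / 4" using uJ_lam unfolding u_def .
      finally show ?thesis .
    qed
    have c2: "lam\<^sup>2 * exp (- u j) \<le> \<eta> / 4 * (u j)\<^sup>2"
    proof -
      have "lam\<^sup>2 * exp (- u j) \<le> lam\<^sup>2 * exp (- u0)" using u_facts(1)[of j] by (intro mult_left_mono) auto
      also have "\<dots> \<le> \<eta> / 4 * u0\<^sup>2" by (rule lam_u0)
      also have "\<dots> \<le> \<eta> / 4 * (u j)\<^sup>2" using u_facts(1)[of j] u0 eta by (intro mult_left_mono power_mono) auto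
      finally show ?thesis .
    qed
    note G = weighted_block_gain[OF _ u_facts(3) _ b(2) _ _ kj m1 mj c1 c2]
    have "real (m j) * (1 + u j / 2 + \<alpha> * u j - \<eta>) \<le> real (m j) * (1 + u j / 2 - ln b - 4 * (\<eta> / 4))"
      using lnb by (intro mult_left_mono) auto
    then show ?thesis using G lam b eta by force
  qed
  have k0: "k j \<le> s j" if j: "j \<ge> 1" for j
  proof -
    have "real (k j) \<le> lam\<^sup>2 * real (s j) * exp (- u j) / (u j)\<^sup>2" using j by (simp add: k_def)
    also have "\<dots> = (lam\<^sup>2 * exp (- u j)) * real (s j) / (u j)\<^sup>2" by simp
    also have "\<dots> \<le> (lam\<^sup>2 * exp (- u0)) * real (s j) / (u j)\<^sup>2"
      using u_facts(1)[of j] by (intro divide_right_mono mult_right_mono mult_left_mono) auto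
    also have "\<dots> \<le> (1 * (u j)\<^sup>2) * real (s j) / (u j)\<^sup>2"
    proof (intro divide_right_mono mult_right_mono)
      have "lam\<^sup>2 * exp (- u0) \<le> \<eta> / 4 * u0\<^sup>2" by (rule lam_u0)
      also have "\<dots> \<le> 1 * (u j)\<^sup>2" using u_facts(1)[of j] u0 eta by (intro mult_mono power_mono) auto
      finally show "lam\<^sup>2 * exp (- u0) \<le> 1 * (u j)\<^sup>2" .
    qed auto
    also have "\<dots> = real (s j)" using u_facts(3)[of j] by simp
    finally show ?thesis by simp
  qed
  show "m j \<le> k j" if "j \<le> J"
  proof -
    consider "j = 0" | "m j = 0" | "j \<in> {1..J}" "m j \<ge> 1" using \<open>j \<le> J\<close> by fastforce
    then show ?thesis using pos[of j] by cases (auto simp: m_def[of 0] k_def[of 0])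
  qed
  show "j \<le> J \<Longrightarrow> k j \<le> card (P j)"
    using k0[of j] card_filler(1) by (cases "j = 0") (auto simp: k_def P_def s_def Suc_le_eq)
  show "real (m j) * (1 + u j / 2 + \<alpha> * u j - \<eta>) - (1 + 2 * ln lam)
    \<le> ln (real (k j choose m j) * sqrt (real (card (P j) choose k j) / real (card (P j) choose (k j - m j))))"
    if j: "j \<in> {1..J}"
  proof (cases "m j = 0")
    case True
    have "(s j choose k j) > 0" using k0[of j] j by simp
    moreover have "0 \<le> ln lam" using lam by simp
    ultimately show ?thesis using True j by (simp add: P_def flip: s_def)
  next
    case False
    \<comment> \<open>As \<open>u j \<ge> 1\<close>, the block alone shows
      \<open>m j \<le> L \<le> lam\<^sup>2\<close>; this is the source of
      \<open>2 * ln lam\<close>.\<close>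
    have "real (m j) * 1 \<le> real (m j) * u j" using u_facts(2)[of j] by (intro mult_left_mono) auto
    also have "\<dots> \<le> (\<Sum>j=1..J. real (m j) * u j)"
      using j u_facts(3) by (intro member_le_sum[of j]) (auto intro!: mult_nonneg_nonneg intro: less_imp_le)
    also have "\<dots> \<le> L" using F_bounds(4) by (simp add: F_def)
    also have "\<dots> \<le> lam\<^sup>2" by (rule F_bounds)
    finally have "ln (real (m j)) \<le> ln (lam\<^sup>2)" using False by (intro ln_mono) auto
    also have "\<dots> = 2 * ln lam" using lam by (simp add: ln_realpow)
    finally show ?thesis using pos[OF j] False j by (simp add: P_def flip: s_def)
  qed
qed

lemma P_bounds:
  assumes "p \<in> P j"
  shows "ln (real p) \<le> (if j = 0 then F else u j)" "(if j = 0 then F - 8 else u j - \<eta>) \<le> ln (real p)" "\<not> p dvd q"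
  using assms by (auto simp: P_def filler_def blk_def split: if_splits)

lemma products_coprime: "x \<in> block_products g \<Longrightarrow> coprime x q"
  using coprime_block_products[of q x g] P_bounds(3) by blast

text \<open>Serves for \<open>X\<close> with \<open>g = k\<close> and for \<open>Y\<close> with
  \<open>g = k - m\<close>.\<close>

lemma products_le:
  assumes "\<And>j. j \<le> J \<Longrightarrow> g j \<le> k j" "x \<in> block_products g"
  shows "ln (real x) \<le> lam\<^sup>2 * (1 / u0 + 7 / u0\<^sup>2) + lam * T"
proof -
  have "ln (real x) \<le> (\<Sum>j\<in>{0..J}. real (g j) * (if j = 0 then F else u j))"
    using P_bounds(1) by (intro block_product_le[OF _ assms(2)]) blast
  also have "\<dots> \<le> (\<Sum>j\<in>{0..J}. real (k j) * (if j = 0 then F else u j))"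
    using assms(1) u_facts(3) F_bounds(4) by (intro sum_mono mult_right_mono) (auto intro: less_imp_le)
  also have "\<dots> = F + (\<Sum>j=1..J. real (k j) * u j)" unfolding sum_split by (simp add: k_def[of 0])
  finally show ?thesis using sum_k_le F_bounds(2) L by linarith
qed

text \<open>The upper ends of the blocks, weighted by \<open>m\<close>, and of the filler interval
  add up to exactly \<open>L\<close>. From below each block prime loses at most
  \<open>\<eta>\<close>, in all \<open>2 * \<eta> * W\<close>, and the filler at most 8, which is
  below \<open>\<eta> * W\<close>.\<close>

lemma shifts_bounds:
  assumes "z \<in> block_products m"
  shows "ln (real z) \<le> L" "L - 3 * \<eta> * W \<le> ln (real z)"
proof -
  have "ln (real z) \<le> (\<Sum>j\<in>{0..J}. real (m j) * (if j = 0 then F else u j))"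
    using P_bounds(1) by (intro block_product_le[OF _ assms]) blast
  also have "\<dots> = L" unfolding sum_split by (simp add: m_def[of 0] F_def)
  finally show "ln (real z) \<le> L" .
  have "(\<Sum>j\<in>{0..J}. real (m j) * (if j = 0 then F - 8 else u j - \<eta>)) \<le> ln (real z)"
    using P_bounds(2) by (intro block_product_ge[OF _ assms]) blast
  moreover have "(\<Sum>j\<in>{0..J}. real (m j) * (if j = 0 then F - 8 else u j - \<eta>)) = L - 8 - \<eta> * (\<Sum>j=1..J. real (m j))"
    unfolding sum_split by (simp add: m_def[of 0] F_def right_diff_distrib sum_subtractf sum_distrib_left mult.commute[of \<eta>])
  moreover have "\<eta> * (\<Sum>j=1..J. real (m j)) \<le> \<eta> * (2 * W)"
    using sum_m_weighted(2) eta by (intro mult_left_mono) auto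
  moreover have "8 \<le> \<eta> * W"
  proof -
    have "0 \<le> ln lam" using lam by simp
    moreover have "0 \<le> A * (u0 + real J * \<eta>) / u0" using A eta u0 by simp
    ultimately have "0 \<le> real J * (2 + 2 * ln lam + A * (u0 + real J * \<eta>) / u0)" by (intro mult_nonneg_nonneg) auto
    with \<open>0 \<le> ln lam\<close> show ?thesis using err unfolding W_def by linarith
  qed
  ultimately show "L - 3 * \<eta> * W \<le> ln (real z)" by (simp add: algebra_simps)
qed

lemma card_products_pos: "0 < card (block_products k)" "0 < card (block_products (\<lambda>j. k j - m j))"
  using k_le_card m_le_k unfolding card_block_products
  by (auto intro!: prod_pos simp: zero_less_binomial_iff intro: order.trans[OF diff_le_self])

text \<open>The terms \<open>m j * u j / 2\<close> of the blocks add up to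
  \<open>(L - F) / 2\<close> and the filler supplies \<open>F / 2\<close>, which completes
  \<open>L / 2\<close>. The multiple of \<open>W\<close> comes from \<open>sum_m_weighted\<close>,
  with all rounding errors absorbed by \<open>err\<close>.\<close>

lemma total_gain:
  "L / 2 + (1 - 6 * \<eta>) * W \<le> ln (real (\<Prod>j\<in>{0..J}. k j choose m j) *
     sqrt (real (card (block_products k)) / real (card (block_products (\<lambda>j. k j - m j)))))"
proof -
  define g where "g = (\<lambda>j. real (k j choose m j) * sqrt (real (card (P j) choose k j) / real (card (P j) choose (k j - m j))))"
  have pos: "0 < k j choose m j" "0 < card (P j) choose k j" "0 < card (P j) choose (k j - m j)" if "j \<le> J" for j
    using k_le_card[OF that] m_le_k[OF that] by (auto simp: zero_less_binomial_iff)
  have "ln (real (\<Prod>j\<in>{0..J}. k j choose m j) *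
     sqrt (real (card (block_products k)) / real (card (block_products (\<lambda>j. k j - m j)))))
    = ln (\<Prod>j\<in>{0..J}. g j)"
    unfolding g_def card_block_products
    by (simp add: prod.distrib prod_dividef sqrt_prod[symmetric])
  also have "\<dots> = (\<Sum>j\<in>{0..J}. ln (g j))"
  proof (rule ln_prod)
    fix j assume "j \<in> {0..J}"
    then have "0 < g j" unfolding g_def using pos[of j] by simp
    then show "g j \<noteq> 0" by simp
  qed simp
  also have "\<dots> = ln (g 0) + (\<Sum>j=1..J. ln (g j))" by (rule sum_split)
  finally have eq: "ln (real (\<Prod>j\<in>{0..J}. k j choose m j) *
     sqrt (real (card (block_products k)) / real (card (block_products (\<lambda>j. k j - m j)))))
    = ln (g 0) + (\<Sum>j=1..J. ln (g j))" .
  have "ln F \<le> ln (lam\<^sup>2)" using F_bounds by (intro ln_mono) auto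
  then have "ln F \<le> 2 * ln lam" using lam by (simp add: ln_realpow)
  \<comment> \<open>The filler prime of \<open>x\<close> passes to \<open>z\<close> and none remains
    in \<open>y\<close>, so index 0 gains just the square root of the number of fillers.\<close>
  moreover have "ln (g 0) = ln (real (card filler)) / 2"
    using card_filler(1) by (simp add: g_def k_def[of 0] m_def[of 0] P_def ln_sqrt)
  ultimately have g0: "F / 2 - 4 - ln lam \<le> ln (g 0)" using card_filler(2) by linarith
  have "(\<Sum>j=1..J. real (m j) * u j / 2 + (1 - \<eta>) * (real (m j) * (1 + \<alpha> * u j)) - (1 + 2 * ln lam)) \<le> (\<Sum>j=1..J. ln (g j))"
  proof (rule sum_mono)
    fix j assume j: "j \<in> {1..J}"
    have "0 \<le> real (m j) * (\<eta> * (\<alpha> * u j))"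
      using eta alpha(1) u_facts(3)[of j] by (intro mult_nonneg_nonneg) auto
    then have "real (m j) * u j / 2 + (1 - \<eta>) * (real (m j) * (1 + \<alpha> * u j)) \<le> real (m j) * (1 + u j / 2 + \<alpha> * u j - \<eta>)"
      by (simp add: algebra_simps)
    then show "real (m j) * u j / 2 + (1 - \<eta>) * (real (m j) * (1 + \<alpha> * u j)) - (1 + 2 * ln lam) \<le> ln (g j)"
      using ln_gain[OF j] unfolding g_def by linarith
  qed
  also have "(\<Sum>j=1..J. real (m j) * u j / 2 + (1 - \<eta>) * (real (m j) * (1 + \<alpha> * u j)) - (1 + 2 * ln lam))
    = (L - F) / 2 + (1 - \<eta>) * (\<Sum>j=1..J. real (m j) * (1 + \<alpha> * u j)) - real J * (1 + 2 * ln lam)"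
    by (simp add: sum.distrib sum_subtractf sum_distrib_left sum_divide_distrib F_def)
  finally have gs: "(L - F) / 2 + (1 - \<eta>) * (\<Sum>j=1..J. real (m j) * (1 + \<alpha> * u j)) - real J * (1 + 2 * ln lam) \<le> (\<Sum>j=1..J. ln (g j))" .
  define E where "E = real J * (1 + A * u J / u0)"
  have E0: "0 \<le> E" unfolding E_def using A u_facts(3)[of J] u0 by (intro mult_nonneg_nonneg) auto
  have "(1 - \<eta>) * ((1 - 4 * \<eta>) * W - E) \<le> (1 - \<eta>) * (\<Sum>j=1..J. real (m j) * (1 + \<alpha> * u j))"
    using sum_m_weighted(1) eta unfolding E_def by (intro mult_left_mono) auto
  moreover have "(1 - 5 * \<eta>) * W - E \<le> (1 - \<eta>) * ((1 - 4 * \<eta>) * W - E)"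
  proof -
    have "0 \<le> \<eta> * (4 * \<eta> * W + E)" using eta W_pos E0 by (intro mult_nonneg_nonneg add_nonneg_nonneg) auto
    then show ?thesis by (simp add: algebra_simps)
  qed
  moreover have "4 + ln lam + real J * (1 + 2 * ln lam) + E \<le> \<eta> * W"
    using err by (simp add: E_def W_def u_def algebra_simps)
  moreover have "(1 - 6 * \<eta>) * W = (1 - 5 * \<eta>) * W - \<eta> * W" by (simp add: algebra_simps)
  ultimately show ?thesis unfolding eq using g0 gs by argo
qed

text \<open>The sets are the block products with \<open>k\<close>, \<open>k - m\<close> and
  \<open>m\<close> primes per block, and \<open>K\<close> is the number of ways to split off
  \<open>m\<close> primes.\<close>

lemma resonating_sets:
  obtains X Y Z :: "nat set" and K :: real where
    "finite X" "finite Y" "X \<noteq> {}" "Y \<noteq> {}"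
    "\<And>x. x \<in> X \<union> Y \<Longrightarrow> 0 < x \<and> coprime x q \<and> ln (real x) \<le> lam\<^sup>2 * (1 / u0 + 7 / u0\<^sup>2) + lam * T"
    "\<And>z. z \<in> Z \<Longrightarrow> 0 < z \<and> coprime z q \<and> ln (real z) \<le> L \<and> L - 3 * \<eta> * (lam * exp (- A) / u0) \<le> ln (real z)"
    "\<And>x. x \<in> X \<Longrightarrow> K \<le> real (card {y\<in>Y. \<exists>z\<in>Z. x = y * z})"
    "exp (L / 2 + (1 - 6 * \<eta>) * (lam * exp (- A) / u0)) \<le> K * sqrt (real (card X) / real (card Y))"
proof -
  let ?K = "\<Prod>j\<in>{0..J}. k j choose m j"
  have K: "real ?K \<le> real (card {y \<in> block_products (\<lambda>j. k j - m j). \<exists>z\<in>block_products m. x = y * z})"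
    if "x \<in> block_products k" for x
    using card_block_factorizations[OF _ that, of m] m_le_k by (simp only: of_nat_le_iff) auto
  have "0 < ?K" using m_le_k by (intro prod_pos) (auto simp: zero_less_binomial_iff)
  then have pos: "0 < real ?K * sqrt (real (card (block_products k)) / real (card (block_products (\<lambda>j. k j - m j))))"
    using card_products_pos by (intro mult_pos_pos) (auto simp del: of_nat_prod)
  have "exp (L / 2 + (1 - 6 * \<eta>) * W) \<le> real ?K * sqrt (real (card (block_products k)) / real (card (block_products (\<lambda>j. k j - m j))))"
    using total_gain pos by (subst ln_ge_iff[symmetric]) auto
  then have gain: "exp (L / 2 + (1 - 6 * \<eta>) * (lam * exp (- A) / u0)) \<le> real ?K * sqrt (real (card (block_products k)) / real (card (block_products (\<lambda>j. k j - m j))))"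
    unfolding W_def .
  have ne: "block_products k \<noteq> {}" "block_products (\<lambda>j. k j - m j) \<noteq> {}"
    using card_products_pos by (auto simp: card_gt_0_iff)
  have bound: "0 < x \<and> coprime x q \<and> ln (real x) \<le> lam\<^sup>2 * (1 / u0 + 7 / u0\<^sup>2) + lam * T"
    if "x \<in> block_products k \<union> block_products (\<lambda>j. k j - m j)" for x
    using that products_le[of k x, OF order.refl] products_le[of "\<lambda>j. k j - m j" x, OF diff_le_self] block_product_pos products_coprime by blast
  have shift: "0 < z \<and> coprime z q \<and> ln (real z) \<le> L \<and> L - 3 * \<eta> * (lam * exp (- A) / u0) \<le> ln (real z)"
    if "z \<in> block_products m" for z
    using shifts_bounds[OF that] block_product_pos[OF that] products_coprime[OF that] unfolding W_def by blast
  show ?thesis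
    by (rule that[OF finite_block_products finite_block_products ne bound shift K gain])
qed

end

section \<open>A sine kernel for prime moduli\<close>

lemma sum_cos_roots_of_unity:
  assumes "q > 0"
  shows "(\<Sum>s<q. cos (2 * pi * of_int k * real s / real q)) = (if int q dvd k then real q else 0)"
proof -
  define z where "z = cis (2 * pi * of_int k / real q)"
  have zs: "z ^ s = cis (2 * pi * of_int k * real s / real q)" for s
    unfolding z_def Complex.DeMoivre by (simp add: mult_ac)
  have Re: "(\<Sum>s<q. cos (2 * pi * of_int k * real s / real q)) = Re (\<Sum>s<q. z ^ s)"
    unfolding zs by simp
  show ?thesis
  proof (cases "int q dvd k")
    case True
    then obtain m where "k = int q * m" by (elim dvdE)
    then have "2 * pi * of_int k / real q = 2 * pi * of_int m" using assms by simp
    then have "z = 1" unfolding z_def by (simp add: cis_multiple_2pi)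
    then show ?thesis using Re True by simp
  next
    case False
    have "z \<noteq> 1"
    proof
      assume "z = 1"
      then have "cos (2 * pi * of_int k / real q) = 1" by (simp add: z_def complex_eq_iff)
      then obtain n :: int where "2 * pi * of_int k / real q = of_int n * 2 * pi" by (auto simp: cos_one_2pi_int)
      then have "2 * pi * of_int k = 2 * pi * (of_int n * real q)" using assms by (simp add: field_simps)
      then have "of_int k = of_int n * real q" by simp
      then have "of_int k = (of_int (n * int q) :: real)" by simp
      then have "k = n * int q" by (simp only: of_int_eq_iff)
      then show False using False by simp
    qed
    moreover have "z ^ q = 1"
    proof -
      have "2 * pi * of_int k * real q / real q = 2 * pi * of_int k" using assms by simp
      then show ?thesis unfolding zs by (simp add: cis_multiple_2pi)
    qed
    ultimately have "(\<Sum>s<q. z ^ s) = 0" by (simp add: geometric_sum)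
    then show ?thesis using Re False by simp
  qed
qed

text \<open>The product formula leaves two cosine sums, which are non-zero only for
  \<open>t'\<close> congruent to \<open>t\<close> and to \<open>- t\<close>, respectively.\<close>

lemma sum_sin_sin:
  assumes "t \<in> totatives q" "t' \<in> totatives q" "q > 1"
  shows "(\<Sum>s<q. sin (2 * pi * real s * real t / real q) * sin (2 * pi * real s * real t' / real q))
    = (real q / 2) * ((if t = t' then 1 else 0) - (if t + t' = q then 1 else 0))"
proof -
  have "(\<Sum>s<q. sin (2 * pi * real s * real t / real q) * sin (2 * pi * real s * real t' / real q))
    = (\<Sum>s<q. (cos (2 * pi * of_int (int t - int t') * real s / real q) - cos (2 * pi * of_int (int t + int t') * real s / real q)) / 2)"
    by (intro sum.cong refl) (simp add: sin_times_sin algebra_simps add_divide_distrib diff_divide_distrib)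
  also have "\<dots> = ((if int q dvd int t - int t' then real q else 0) - (if int q dvd int t + int t' then real q else 0)) / 2"
    using assms(3) by (simp add: sum_subtractf sum_cos_roots_of_unity flip: sum_divide_distrib del: of_int_add of_int_diff)
  also have "int q dvd int t - int t' \<longleftrightarrow> t = t'"
  proof
    assume "int q dvd int t - int t'"
    then have "[int t = int t'] (mod int q)" by (simp add: cong_iff_dvd_diff)
    then have "[t = t'] (mod q)" by (simp add: cong_int_iff)
    then show "t = t'" using totatives_less[OF _ assms(3)] assms(1,2) by (simp add: cong_less_modulus_unique_nat)
  qed auto
  also have "int q dvd int t + int t' \<longleftrightarrow> t + t' = q"
  proof
    assume "int q dvd int t + int t'"
    then have "q dvd t + t'" by (simp flip: int_dvd_int_iff)
    then obtain r where r: "t + t' = q * r" by (elim dvdE)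
    have "0 < t + t'" "t + t' < 2 * q"
      using assms totatives_less[OF assms(1,3)] totatives_less[OF assms(2,3)] by (auto simp: in_totatives_iff)
    then have "0 < r" "r < 2" using r by (auto intro: Nat.gr0I)
    then show "t + t' = q" using r by (cases "r = 1") auto
  qed (metis dvd_refl of_nat_add)
  also have "((if t = t' then real q else 0) - (if t + t' = q then real q else 0)) / 2
    = (real q / 2) * ((if t = t' then 1 else 0) - (if t + t' = q then 1 else 0))" by simp
  finally show ?thesis .
qed

lemma cos_sin_2pi_nat: "cos (2 * pi * real k) = 1" "sin (2 * pi * real k) = 0"
  using cos_2npi[of k] sin_2npi[of k] by (simp_all add: mult_ac)

text \<open>For odd \<open>chi\<close> this is the classical Gauss sum divided by the imaginary
  unit; for even \<open>chi\<close> it vanishes.\<close>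

definition sine_gauss_sum :: "nat \<Rightarrow> (nat \<Rightarrow> complex) \<Rightarrow> complex" where
  "sine_gauss_sum q chi = (\<Sum>t\<in>totatives q. chi t * of_real (sin (2 * pi * real t / real q)))"

lemma sin_mod_period:
  assumes "q > 0"
  shows "sin (2 * pi * real (n mod q) / real q) = sin (2 * pi * real n / real q)"
proof -
  have "real n = real (n mod q) + real (n div q) * real q"
    by (metis add.commute div_mult_mod_eq of_nat_add of_nat_mult)
  then have "2 * pi * real n / real q = 2 * pi * real (n mod q) / real q + 2 * pi * real (n div q)"
    using assms by (simp add: field_simps)
  then show ?thesis by (simp add: sin_add cos_sin_2pi_nat)
qed

text \<open>Multiplication by \<open>n\<close> permutes the units, which moves the twist into the
  factor \<open>chi n\<close>.\<close>

lemma twisted_sine_gauss_sum: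
  assumes "q > 1" "dirichlet_char q chi" "coprime n q"
  shows "(\<Sum>t\<in>totatives q. chi t * of_real (sin (2 * pi * real n * real t / real q))) = cnj (chi n) * sine_gauss_sum q chi"
proof -
  have "sine_gauss_sum q chi = (\<Sum>t\<in>totatives q. chi (n * t mod q) * of_real (sin (2 * pi * real (n * t mod q) / real q)))"
    unfolding sine_gauss_sum_def by (rule sum_totatives_mult[symmetric]) (use assms in auto)
  also have "\<dots> = (\<Sum>t\<in>totatives q. chi n * (chi t * of_real (sin (2 * pi * real n * real t / real q))))"
  proof (rule sum.cong[OF refl])
    fix t
    have "chi (n * t mod q) = chi (n * t)" using assms(2) by (intro dirichlet_char_cong) auto
    also have "\<dots> = chi n * chi t" using assms(2) by (simp add: dirichlet_char_def)
    finally show "chi (n * t mod q) * of_real (sin (2 * pi * real (n * t mod q) / real q))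
      = chi n * (chi t * of_real (sin (2 * pi * real n * real t / real q)))"
      using sin_mod_period[of q "n * t"] assms(1) by (simp only: of_nat_mult mult.assoc)
  qed
  also have "\<dots> = chi n * (\<Sum>t\<in>totatives q. chi t * of_real (sin (2 * pi * real n * real t / real q)))"
    by (simp add: sum_distrib_left)
  finally have "cnj (chi n) * sine_gauss_sum q chi
    = (cnj (chi n) * chi n) * (\<Sum>t\<in>totatives q. chi t * of_real (sin (2 * pi * real n * real t / real q)))"
    by (simp only: mult.assoc)
  then show ?thesis using dirichlet_char_mult_cnj[of q chi n] assms by simp
qed

text \<open>The twists by \<open>s = 1, ..., q - 1\<close> all have the same absolute value, and
  their second moment over \<open>s < q\<close> is computed with \<open>sum_sin_sin\<close>: for
  each \<open>t\<close> the pairs \<open>t' = t\<close> and \<open>t' = q - t\<close> contribute at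
  most \<open>q / 2\<close> each.\<close>

lemma norm_sine_gauss_sum:
  assumes "prime q" "dirichlet_char q chi"
  shows "cmod (sine_gauss_sum q chi) \<le> sqrt (real q)"
proof -
  let ?T = "totatives q" and ?g = "sine_gauss_sum q chi"
  have q1: "q > 1" using assms(1) prime_gt_1_nat by blast
  define h where "h = (\<lambda>s. \<Sum>t\<in>?T. chi t * of_real (sin (2 * pi * real s * real t / real q)))"
  have T: "?T = {0<..<q}" using assms(1) by (rule totatives_prime)
  have hs: "cmod (h s) = cmod ?g" if "s \<in> {0<..<q}" for s
  proof -
    have "coprime s q" using that T by (metis in_totatives_iff)
    then show ?thesis unfolding h_def
      using twisted_sine_gauss_sum[OF q1 assms(2), of s] norm_dirichlet_char[OF assms(2), of s] q1 by (simp add: norm_mult)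
  qed
  have "real (q - 1) * (cmod ?g)\<^sup>2 = (\<Sum>s\<in>{0<..<q}. (cmod (h s))\<^sup>2)" using hs by simp
  also have "\<dots> \<le> (\<Sum>s<q. (cmod (h s))\<^sup>2)" by (intro sum_mono2) auto
  also have "\<dots> = Re (\<Sum>s<q. h s * cnj (h s))" by (simp only: complex_norm_square[symmetric] of_real_sum[symmetric] Re_complex_of_real)
  also have "(\<Sum>s<q. h s * cnj (h s)) = (\<Sum>s<q. \<Sum>t\<in>?T. \<Sum>t'\<in>?T. chi t * cnj (chi t') *
      of_real (sin (2 * pi * real s * real t / real q) * sin (2 * pi * real s * real t' / real q)))"
    unfolding h_def cnj_sum sum_product by (intro sum.cong refl) simp
  also have "\<dots> = (\<Sum>t\<in>?T. \<Sum>t'\<in>?T. chi t * cnj (chi t') *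
      of_real (\<Sum>s<q. sin (2 * pi * real s * real t / real q) * sin (2 * pi * real s * real t' / real q)))"
    unfolding of_real_sum sum_distrib_left
    by (rule trans[OF sum.swap], rule sum.cong[OF refl], rule sum.swap)
  also have "\<dots> = (\<Sum>t\<in>?T. \<Sum>t'\<in>?T. (if t' = t then of_real (real q / 2) * (chi t * cnj (chi t')) else 0)
      - (if t' = q - t then of_real (real q / 2) * (chi t * cnj (chi t')) else 0))"
  proof (intro sum.cong refl)
    fix t t' assume t: "t \<in> ?T" "t' \<in> ?T"
    then have "t + t' = q \<longleftrightarrow> t' = q - t" using totatives_less[OF t(1) q1] by auto
    then show "chi t * cnj (chi t') * of_real (\<Sum>s<q. sin (2 * pi * real s * real t / real q) * sin (2 * pi * real s * real t' / real q))
      = (if t' = t then of_real (real q / 2) * (chi t * cnj (chi t')) else 0) - (if t' = q - t then of_real (real q / 2) * (chi t * cnj (chi t')) else 0)"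
      unfolding sum_sin_sin[OF t q1] by auto
  qed
  also have "\<dots> = (\<Sum>t\<in>?T. of_real (real q / 2) * (chi t * cnj (chi t)) - of_real (real q / 2) * (chi t * cnj (chi (q - t))))"
  proof (rule sum.cong[OF refl])
    fix t assume t: "t \<in> ?T"
    then have "q - t \<in> ?T" unfolding T by auto
    then show "(\<Sum>t'\<in>?T. (if t' = t then of_real (real q / 2) * (chi t * cnj (chi t')) else 0)
      - (if t' = q - t then of_real (real q / 2) * (chi t * cnj (chi t')) else 0))
      = of_real (real q / 2) * (chi t * cnj (chi t)) - of_real (real q / 2) * (chi t * cnj (chi (q - t)))"
      using t by (simp add: sum_subtractf)
  qed
  also have "Re \<dots> \<le> cmod \<dots>" by (rule complex_Re_le_cmod)
  also have "\<dots> \<le> (\<Sum>t\<in>?T. real q)"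
  proof (rule sum_norm_le)
    fix t
    have n: "cmod (chi a) \<le> 1" for a using norm_dirichlet_char_le[OF assms(2)] q1 by simp
    have "cmod (of_real (real q / 2) * (chi t * cnj (chi t)) - of_real (real q / 2) * (chi t * cnj (chi (q - t))))
      \<le> real q / 2 * (cmod (chi t) * cmod (chi t)) + real q / 2 * (cmod (chi t) * cmod (chi (q - t)))"
      by (rule order.trans[OF norm_triangle_ineq4]) (simp add: norm_mult)
    also have "\<dots> \<le> real q / 2 * 1 + real q / 2 * 1"
      by (intro add_mono mult_left_mono mult_le_one n) auto
    finally show "cmod (of_real (real q / 2) * (chi t * cnj (chi t)) - of_real (real q / 2) * (chi t * cnj (chi (q - t)))) \<le> real q"
      by simp
  qed
  also have "\<dots> = real (q - 1) * real q" unfolding T by simp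
  finally have "(cmod ?g)\<^sup>2 \<le> real q" using q1 by simp
  then show ?thesis by (rule real_le_rsqrt)
qed

section \<open>The kernel: closed form, oddness and character transform\<close>

text \<open>Halving the last term makes the kernel non-negative on \<open>(0, q / 2)\<close>, see the closed form below.\<close>

definition sine_weight :: "nat \<Rightarrow> nat \<Rightarrow> nat \<Rightarrow> real" where
  "sine_weight q M t = (\<Sum>n=1..M. (if n = M then 1 / 2 else 1) * sin (2 * pi * real n * real t / real q))"

text \<open>Telescoping with the product formula evaluates the plain sine sum; removing half of the
  last term combines the cosines into a product which is non-negative for
  \<open>0 < x < pi\<close>.\<close>

lemma half_weighted_sine_sum:
  "2 * sin (x / 2) * (\<Sum>n=1..M. (if n = M then 1 / 2 else 1) * sin (real n * x)) = (1 - cos (real M * x)) * cos (x / 2)"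
proof (cases M)
  case (Suc m)
  have full: "2 * sin (x / 2) * (\<Sum>n=1..k. sin (real n * x)) = cos (x / 2) - cos (real k * x + x / 2)" for k
  proof (induction k)
    case (Suc k)
    have "2 * sin (x / 2) * sin (real (Suc k) * x) = cos (real (Suc k) * x - x / 2) - cos (real (Suc k) * x + x / 2)"
      by (simp add: cos_add cos_diff)
    moreover have "real (Suc k) * x - x / 2 = real k * x + x / 2" by (simp add: field_simps)
    ultimately show ?case using Suc by (simp add: distrib_left add.commute)
  qed simp
  have "(\<Sum>n=1..M. (if n = M then 1 / 2 else 1) * sin (real n * x)) = (\<Sum>n=1..m. sin (real n * x)) + sin (real M * x) / 2"
    unfolding Suc by simp
  also have "(\<Sum>n=1..m. sin (real n * x)) = (\<Sum>n=1..M. sin (real n * x)) - sin (real M * x)"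
    unfolding Suc by simp
  finally have e: "(\<Sum>n=1..M. (if n = M then 1 / 2 else 1) * sin (real n * x))
    = (\<Sum>n=1..M. sin (real n * x)) - sin (real M * x) + sin (real M * x) / 2" .
  have "2 * sin (x / 2) * (\<Sum>n=1..M. (if n = M then 1 / 2 else 1) * sin (real n * x))
    = 2 * sin (x / 2) * (\<Sum>n=1..M. sin (real n * x)) - sin (x / 2) * sin (real M * x)"
    unfolding e by (simp add: algebra_simps)
  also have "\<dots> = (1 - cos (real M * x)) * cos (x / 2)"
    unfolding full by (simp add: cos_add algebra_simps)
  finally show ?thesis .
qed simp

lemma sine_weight_closed_form:
  "2 * sin (pi * real t / real q) * sine_weight q M t = (1 - cos (2 * pi * real M * real t / real q)) * cos (pi * real t / real q)"
  using half_weighted_sine_sum[of "2 * pi * real t / real q" M] unfolding sine_weight_def by (simp add: mult_ac)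

lemma sine_weight_reflect:
  assumes "q > 0" "t \<le> q"
  shows "sine_weight q M (q - t) = - sine_weight q M t"
proof -
  have "sin (2 * pi * real n * real (q - t) / real q) = - sin (2 * pi * real n * real t / real q)" for n
  proof -
    have "2 * pi * real n * real (q - t) / real q = 2 * pi * real n - 2 * pi * real n * real t / real q"
      using assms by (simp add: of_nat_diff field_simps)
    then show ?thesis by (simp add: sin_diff cos_sin_2pi_nat)
  qed
  then show ?thesis unfolding sine_weight_def by (simp add: sum_negf)
qed

text \<open>Oddness under the reflection of \<open>t\<close> to \<open>q - t\<close>. Hence the
  principal character contributes nothing to the resonance inequality.\<close>

lemma sum_sine_weight:
  assumes "q > 1" shows "(\<Sum>t\<in>totatives q. sine_weight q M t) = 0"
proof -
  have "(\<Sum>t\<in>totatives q. sine_weight q M t) = (\<Sum>t\<in>totatives q. sine_weight q M (q - t))"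
  proof (rule sum.reindex_bij_witness[of _ "\<lambda>t. q - t" "\<lambda>t. q - t"])
    fix t assume "t \<in> totatives q"
    then have t: "t < q" "0 < t" "coprime t q" using totatives_less[of t q] assms by (auto simp: in_totatives_iff)
    then show "q - (q - t) = t" by simp
    have "coprime (q - t) q" using t by (metis coprime_diff_one_left_nat gcd_diff1_nat coprime_iff_gcd_eq_1 gcd.commute gcd_diff2_nat less_imp_le)
    then show "q - t \<in> totatives q" using t by (simp add: in_totatives_iff)
    then show "q - t \<in> totatives q" .
    show "q - (q - t) = t" using t by simp
    show "sine_weight q M (q - (q - t)) = sine_weight q M t" using t by simp
  qed
  also have "\<dots> = - (\<Sum>t\<in>totatives q. sine_weight q M t)"
    using assms by (simp add: sine_weight_reflect totatives_le sum_negf)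
  finally show ?thesis by simp
qed

text \<open>Every frequency \<open>n\<close> contributes \<open>cnj (chi n)\<close> times the same
  Gauss sum, since \<open>M < q\<close> keeps \<open>n\<close> coprime to the prime
  \<open>q\<close>. The halved last term accounts for the \<open>1 / 2\<close>.\<close>

lemma norm_sine_weight_transform:
  assumes "prime q" "dirichlet_char q chi" "M < q"
  shows "cmod (\<Sum>t\<in>totatives q. of_real (sine_weight q M t) * chi t) \<le> sqrt (real q) * (cmod (\<Sum>n=1..M. cnj (chi n)) + 1 / 2)"
proof -
  have q1: "q > 1" using assms(1) prime_gt_1_nat by blast
  have "(\<Sum>t\<in>totatives q. of_real (sine_weight q M t) * chi t)
    = (\<Sum>n=1..M. of_real (if n = M then 1 / 2 else 1) * (\<Sum>t\<in>totatives q. chi t * of_real (sin (2 * pi * real n * real t / real q))))"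
    unfolding sine_weight_def of_real_sum sum_distrib_left sum_distrib_right
    by (subst sum.swap) (intro sum.cong refl, simp)
  also have "\<dots> = (\<Sum>n=1..M. of_real (if n = M then 1 / 2 else 1) * (cnj (chi n) * sine_gauss_sum q chi))"
  proof (intro sum.cong refl arg_cong2[where f = "(*)"] twisted_sine_gauss_sum q1 assms)
    fix n assume n: "n \<in> {1..M}"
    then have "\<not> q dvd n" using assms(3) by (auto dest: dvd_imp_le)
    then show "coprime n q" using assms(1) prime_imp_coprime[of q n] by (simp add: coprime_commute)
  qed
  also have "\<dots> = (\<Sum>n=1..M. of_real (if n = M then 1 / 2 else 1) * cnj (chi n)) * sine_gauss_sum q chi"
    by (simp add: sum_distrib_right mult.assoc)
  finally have eq: "cmod (\<Sum>t\<in>totatives q. of_real (sine_weight q M t) * chi t)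
    = cmod (\<Sum>n=1..M. of_real (if n = M then 1 / 2 else 1) * cnj (chi n)) * cmod (sine_gauss_sum q chi)"
    by (simp add: norm_mult)
  have "(\<Sum>n=1..M. of_real (if n = M then 1 / 2 else 1) * cnj (chi n)) = (\<Sum>n=1..M. cnj (chi n)) - (if M = 0 then 0 else cnj (chi M) / 2)"
    by (cases M) auto
  also have "cmod \<dots> \<le> cmod (\<Sum>n=1..M. cnj (chi n)) + 1 / 2"
  proof -
    have "cmod (if M = 0 then 0 else cnj (chi M) / 2) \<le> 1 / 2"
      using norm_dirichlet_char_le[OF assms(2), of M] q1 by (simp add: norm_divide)
    then show ?thesis using norm_triangle_ineq4 by (metis (no_types, lifting) add_left_mono order.trans)
  qed
  finally show ?thesis
    unfolding eq using norm_sine_gauss_sum[OF assms(1,2)]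
    by (subst mult.commute) (intro mult_mono, auto)
qed

lemma sin_ge_half_arg:
  fixes x :: real
  assumes "0 \<le> x" "x \<le> pi / 3"
  shows "x / 2 \<le> sin x"
proof -
  have "(\<lambda>y. sin y - y / 2) 0 \<le> (\<lambda>y. sin y - y / 2) x"
  proof (rule DERIV_nonneg_imp_nondecreasing[OF assms(1)])
    fix y :: real assume y: "0 \<le> y" "y \<le> x"
    have "cos (pi / 3) \<le> cos y" using y assms by (intro cos_monotone_0_pi_le) auto
    then show "\<exists>d. DERIV (\<lambda>y. sin y - y / 2) y :> d \<and> 0 \<le> d"
      by (intro exI[of _ "cos y - 1 / 2"]) (auto intro!: derivative_eq_intros simp: cos_60)
  qed
  then show ?thesis by simp
qed

section \<open>Choice of the parameters\<close>

text \<open>\<open>l\<close> stands for \<open>log log q\<close>, and \<open>\<theta>\<close> is the exponent of \<open>q\<close> up to which the resonator extends: 1 in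
  general and \<open>1 / 2\<close> for prime moduli.\<close>

definition large_enough :: "real \<Rightarrow> real \<Rightarrow> real \<Rightarrow> real \<Rightarrow> bool" where
  "large_enough \<eta> C \<theta> l \<longleftrightarrow>
     1 \<le> l \<and> 16 * l \<le> \<eta>\<^sup>2 * sqrt (\<theta> * exp l * l) \<and> \<theta> * exp (- \<eta> * l) \<le> \<eta> / 4 * l \<and>
     16 * (2 + C * ln l) \<le> \<eta> * l \<and> 2 * l / \<eta> + 9 \<le> \<eta> / 4 * (sqrt (\<theta> * exp l * l) * l powr - C) \<and>
     l powr C \<le> sqrt (\<theta> * exp l * l) \<and> 1 \<le> sqrt (\<theta> * exp l * l) \<and> ln (sqrt (\<theta> * exp l * l)) \<le> l \<and>
     12 + l + (2 * l / \<eta>\<^sup>2) * (2 + 2 * l + (1 + C * ln l) * (2 / \<eta>)) \<le> \<eta> * (sqrt (\<theta> * exp l * l) * l powr - C / (6 * l)) \<and>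
     7 * (\<theta> * exp l) / l + 2 * (sqrt (\<theta> * exp l * l) * l powr C) \<le> \<eta> / 4 * (\<theta> * exp l) \<and>
     2 * exp l + 1 \<le> exp (\<eta> / 4 * (\<theta> * exp l)) \<and> 8 \<le> exp (\<eta> / 4 * (\<theta> * exp l))"

lemma eventually_large_enough:
  assumes "\<eta> > 0" "C > 0" "\<theta> > 0"
  shows "eventually (large_enough \<eta> C \<theta>) at_top"
  unfolding large_enough_def
proof (intro eventually_conj)
  show "eventually (\<lambda>l::real. 1 \<le> l) at_top" by real_asymp
  show "eventually (\<lambda>l. 16 * l \<le> \<eta>\<^sup>2 * sqrt (\<theta> * exp l * l)) at_top" using assms by real_asymp
  show "eventually (\<lambda>l. \<theta> * exp (- \<eta> * l) \<le> \<eta> / 4 * l) at_top" using assms by real_asymp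
  show "eventually (\<lambda>l. 16 * (2 + C * ln l) \<le> \<eta> * l) at_top" using assms by real_asymp
  show "eventually (\<lambda>l. 2 * l / \<eta> + 9 \<le> \<eta> / 4 * (sqrt (\<theta> * exp l * l) * l powr - C)) at_top" using assms by real_asymp
  show "eventually (\<lambda>l. l powr C \<le> sqrt (\<theta> * exp l * l)) at_top" using assms by real_asymp
  show "eventually (\<lambda>l. 1 \<le> sqrt (\<theta> * exp l * l)) at_top" using assms by real_asymp
  show "eventually (\<lambda>l. ln (sqrt (\<theta> * exp l * l)) \<le> l) at_top" using assms by real_asymp
  show "eventually (\<lambda>l. 12 + l + (2 * l / \<eta>\<^sup>2) * (2 + 2 * l + (1 + C * ln l) * (2 / \<eta>)) \<le> \<eta> * (sqrt (\<theta> * exp l * l) * l powr - C / (6 * l))) at_top"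
    using assms by real_asymp
  show "eventually (\<lambda>l. 7 * (\<theta> * exp l) / l + 2 * (sqrt (\<theta> * exp l * l) * l powr C) \<le> \<eta> / 4 * (\<theta> * exp l)) at_top"
    using assms by real_asymp
  show "eventually (\<lambda>l. 2 * exp l + 1 \<le> exp (\<eta> / 4 * (\<theta> * exp l))) at_top" using assms by real_asymp
  show "eventually (\<lambda>l. 8 \<le> exp (\<eta> / 4 * (\<theta> * exp l))) at_top" using assms by real_asymp
qed

text \<open>Takes \<open>u0 = (1 + \<eta>) * l\<close>. The factor \<open>1 + \<eta>\<close> keeps
  \<open>k\<close> small against the block sizes and brings the resonator length
  \<open>lam\<^sup>2 / u0\<close> below \<open>\<theta> * ln q\<close>, which leaves room for
  \<open>exp (lam * T)\<close> in the second conclusion.\<close>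

lemma resonator_params_large:
  fixes \<eta> C \<theta> l A T T' L :: real
  assumes eta: "0 < \<eta>" "\<eta> \<le> 1 / 8" and C: "C > 0" and theta: "0 < \<theta>" "\<theta> \<le> 1"
    and large: "large_enough \<eta> C \<theta> l" and q: "q > 0" "ln (real q) = exp l"
    and A: "A > 0" and int: "((\<lambda>x. exp (- x) / x) has_integral T) {A..}" "((\<lambda>x. exp (- x) / x ^ 2) has_integral T') {A..}"
    and T: "l powr - C \<le> T" "T \<le> l powr C"
    and L: "sqrt (\<theta> * exp l * l) * T - 2 \<le> L" "L \<le> sqrt (\<theta> * exp l * l) * T"
  obtains J where "resonator_params q J \<eta> (sqrt (\<theta> * exp l * l)) ((1 + \<eta>) * l) A T L"
    "(sqrt (\<theta> * exp l * l))\<^sup>2 * (1 / ((1 + \<eta>) * l) + 7 / ((1 + \<eta>) * l)\<^sup>2) + 2 * (sqrt (\<theta> * exp l * l) * T)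
       \<le> (1 - \<eta> / 4) * (\<theta> * exp l)"
    "12 \<le> \<eta> * (sqrt (\<theta> * exp l * l) * exp (- A) / ((1 + \<eta>) * l))"
proof -
  define lam where "lam = sqrt (\<theta> * exp l * l)"
  define u0 where "u0 = (1 + \<eta>) * l"
  \<comment> \<open>With this many steps of length \<open>\<eta>\<close> the blocks reach
    \<open>u0 / \<eta>\<close>, as the truncation in \<open>sum_sig_phi\<close> requires.\<close>
  define J where "J = nat \<lceil>u0 / \<eta>\<^sup>2\<rceil>"
  define uJ where "uJ = u0 + real J * \<eta>"
  note C' = large[unfolded large_enough_def, folded lam_def]
  have l1: "1 \<le> l" using C' by simp
  have l0: "0 < l" using l1 by simp
  have lnl: "0 \<le> ln l" using l1 by simp
  have lam1: "1 \<le> lam" using C' by simp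
  have lam2: "lam\<^sup>2 = \<theta> * exp l * l" unfolding lam_def using theta l1 by simp
  have u0: "l \<le> u0" "u0 \<le> 9 / 8 * l" "1 \<le> u0"
  proof -
    show 1: "l \<le> u0" using eta l1 by (simp add: u0_def)
    show "u0 \<le> 9 / 8 * l" unfolding u0_def using eta l1 by (intro mult_right_mono) auto
    show "1 \<le> u0" using 1 l1 by simp
  qed
  note EI = exponential_integrals[OF A int]
  have T'0: "0 \<le> T'" by (rule has_integral_nonneg[OF int(2)]) auto
  have AT: "A * T \<le> exp (- A)" using EI(1) mult_nonneg_nonneg[OF less_imp_le[OF A] T'0] by (simp add: distrib_left)
  \<comment> \<open>For \<open>A > 1\<close> the chain
    \<open>l powr - C \<le> T \<le> A * T \<le> exp (- A)\<close> limits the growth of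
    \<open>A\<close>.\<close>
  have A_le: "A \<le> 1 + C * ln l"
  proof (cases "A \<le> 1")
    case True
    then show ?thesis using C lnl by (simp add: add_increasing2)
  next
    case False
    have "T \<le> A * T" using False EI(3) by (simp add: mult_le_cancel_right1)
    moreover have "exp (- C * ln l) \<le> T" using T(1) l0 by (simp add: powr_def)
    ultimately have "exp (- C * ln l) \<le> exp (- A)" using AT by linarith
    then show ?thesis by simp
  qed
  have expA: "l powr - C / 3 \<le> exp (- A)"
  proof -
    have "exp (1::real) \<le> 3" by (rule exp_le)
    have "l powr - C / 3 \<le> l powr - C / exp 1" using \<open>exp 1 \<le> 3\<close> by (intro divide_left_mono) auto
    also have "\<dots> = exp (- (1 + C * ln l))" using l0 by (simp add: powr_def exp_diff exp_minus field_simps flip: exp_add)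
    also have "\<dots> \<le> exp (- A)" using A_le by simp
    finally show ?thesis .
  qed
  have J: "u0 / \<eta>\<^sup>2 \<le> real J" "real J \<le> u0 / \<eta>\<^sup>2 + 1"
  proof -
    have "0 \<le> u0 / \<eta>\<^sup>2" using u0 by simp
    then show "u0 / \<eta>\<^sup>2 \<le> real J" "real J \<le> u0 / \<eta>\<^sup>2 + 1" unfolding J_def by linarith+
  qed
  have e2: "\<eta>\<^sup>2 \<le> 1 / 8" using eta mult_mono[of \<eta> "1/8" \<eta> 1] by (simp add: power2_eq_square)
  have J2: "real J \<le> 2 * l / \<eta>\<^sup>2"
  proof -
    have "u0 / \<eta>\<^sup>2 \<le> (9 / 8 * l) / \<eta>\<^sup>2" using u0 by (intro divide_right_mono) auto
    moreover have "1 \<le> (7 / 8 * l) / \<eta>\<^sup>2" using e2 l1 eta by (simp add: field_simps)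
    moreover have "(9 / 8 * l) / \<eta>\<^sup>2 + (7 / 8 * l) / \<eta>\<^sup>2 = 2 * l / \<eta>\<^sup>2" by (simp add: field_simps)
    ultimately show ?thesis using J(2) by linarith
  qed
  have uJ1: "u0 / \<eta> \<le> uJ"
  proof -
    have "u0 / \<eta>\<^sup>2 * \<eta> \<le> real J * \<eta>" using J(1) eta by (intro mult_right_mono) auto
    moreover have "u0 / \<eta>\<^sup>2 * \<eta> = u0 / \<eta>" using eta by (simp add: power2_eq_square)
    ultimately show ?thesis using u0 unfolding uJ_def by linarith
  qed
  have uJ2: "uJ \<le> 2 * l / \<eta>"
  proof -
    have "real J * \<eta> \<le> (u0 / \<eta>\<^sup>2 + 1) * \<eta>" using J(2) eta by (intro mult_right_mono) auto
    also have "\<dots> = u0 / \<eta> + \<eta>" using eta by (simp add: power2_eq_square field_simps)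
    finally have "uJ \<le> u0 + u0 / \<eta> + \<eta>" by (simp add: uJ_def)
    also have "\<dots> \<le> 9 / 8 * l + 9 / 8 * l / \<eta> + 1 / 8 * l"
      using u0 eta l1 by (intro add_mono divide_right_mono) auto
    also have "\<dots> = (5 / 4 * \<eta> + 9 / 8) * l / \<eta>" using eta by (simp add: field_simps)
    also have "\<dots> \<le> 2 * l / \<eta>" using eta l1 by (intro divide_right_mono mult_right_mono) auto
    finally show ?thesis .
  qed
  have lamT: "0 \<le> lam * T" using lam1 EI(3) by simp
  have c_lam: "2 * uJ / lam \<le> \<eta> / 4"
  proof -
    have "2 * uJ \<le> 4 * l / \<eta>" using uJ2 by simp
    also have "\<dots> \<le> \<eta> / 4 * lam"
    proof -
      have "16 * l \<le> \<eta> * \<eta> * lam" using C' by (simp add: power2_eq_square)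
      then show ?thesis using eta by (simp add: field_simps)
    qed
    finally show ?thesis using lam1 by (simp add: field_simps)
  qed
  have c_u0: "lam\<^sup>2 * exp (- u0) \<le> \<eta> / 4 * u0\<^sup>2"
  proof -
    have "lam\<^sup>2 * exp (- u0) = (\<theta> * exp (- \<eta> * l)) * l"
      unfolding lam2 u0_def by (simp add: algebra_simps flip: exp_add)
    also have "\<dots> \<le> (\<eta> / 4 * l) * l" using C' l1 by (intro mult_right_mono) auto
    also have "\<dots> \<le> (\<eta> / 4 * u0) * u0" using u0 eta l1 by (intro mult_mono) auto
    finally show ?thesis by (simp add: power2_eq_square)
  qed
  have c_A: "16 * (1 + A) \<le> \<eta> * u0"
  proof -
    have "16 * (1 + A) \<le> \<eta> * l" using A_le C' by (smt (verit))
    also have "\<dots> \<le> \<eta> * u0" using u0 eta by (intro mult_left_mono) auto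
    finally show ?thesis .
  qed
  have c_T: "uJ + 9 \<le> \<eta> / 4 * (lam * T)"
  proof -
    have "uJ + 9 \<le> \<eta> / 4 * (lam * l powr - C)" using uJ2 C' by linarith
    also have "\<dots> \<le> \<eta> / 4 * (lam * T)" using T(1) eta lam1 by (intro mult_left_mono) auto
    finally show ?thesis .
  qed
  have c_err: "12 + ln lam + real J * (2 + 2 * ln lam + A * uJ / u0) \<le> \<eta> * (lam * exp (- A) / u0)"
  proof -
    have Au: "A * uJ / u0 \<le> (1 + C * ln l) * (2 / \<eta>)"
    proof -
      have "A * uJ / u0 \<le> A * (2 * l / \<eta>) / l"
        using uJ2 u0 l1 A eta by (intro frac_le mult_left_mono) auto
      also have "\<dots> = A * (2 / \<eta>)" using l0 by simp
      also have "\<dots> \<le> (1 + C * ln l) * (2 / \<eta>)" using A_le eta by (intro mult_right_mono) auto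
      finally show ?thesis .
    qed
    have lnlam: "0 \<le> ln lam" "ln lam \<le> l" using lam1 C' by auto
    have "0 \<le> A * uJ / u0" using A uJ1 u0 eta by (smt (verit) divide_nonneg_nonneg mult_nonneg_nonneg)
    then have "real J * (2 + 2 * ln lam + A * uJ / u0) \<le> (2 * l / \<eta>\<^sup>2) * (2 + 2 * l + (1 + C * ln l) * (2 / \<eta>))"
      using J2 lnlam Au l1 eta by (intro mult_mono add_mono) auto
    then have "12 + ln lam + real J * (2 + 2 * ln lam + A * uJ / u0) \<le> \<eta> * (lam * l powr - C / (6 * l))"
      using C' lnlam by linarith
    also have "lam * l powr - C / (6 * l) = lam * (l powr - C / 3) / (2 * l)" by simp
    also have "\<eta> * (lam * (l powr - C / 3) / (2 * l)) \<le> \<eta> * (lam * exp (- A) / u0)"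
      using expA lam1 u0 l1 eta by (intro mult_left_mono frac_le) auto
    finally show ?thesis .
  qed
  have c_Tlam: "T \<le> lam" using T(2) C' by linarith
  have lnq: "ln (real q) \<le> exp u0" using q u0 by simp
  have P: "resonator_params q J \<eta> lam u0 A T L"
    using q eta lam1 u0 lnq A int(1) EI(2) uJ1 c_lam c_u0 c_A c_T L c_Tlam c_err
    by unfold_locales (auto simp: uJ_def lam_def)
  \<comment> \<open>Dividing by \<open>1 + \<eta>\<close> saves a share \<open>\<eta> / 2\<close> of
    \<open>\<theta> * exp l\<close>; half of the saving pays for the lower-order terms.\<close>
  have B: "lam\<^sup>2 * (1 / u0 + 7 / u0\<^sup>2) + 2 * (lam * T) \<le> (1 - \<eta> / 4) * (\<theta> * exp l)"
  proof -
    have "lam\<^sup>2 * (1 / u0) = \<theta> * exp l * (1 / (1 + \<eta>))"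
    proof -
      have "\<theta> * exp l * l * (1 / ((1 + \<eta>) * l)) = \<theta> * exp l * (l * 1 / (l * (1 + \<eta>)))"
        by (simp only: mult.commute[of "1 + \<eta>" l] times_divide_eq_right mult.assoc)
      then show ?thesis unfolding lam2 u0_def using l0 by simp
    qed
    also have "\<dots> \<le> \<theta> * exp l * (1 - \<eta> / 2)"
    proof (rule mult_left_mono)
      have "1 \<le> (1 - \<eta> / 2) * (1 + \<eta>)" using eta mult_left_mono[of \<eta> 1 \<eta>] by (simp add: algebra_simps)
      then show "1 / (1 + \<eta>) \<le> 1 - \<eta> / 2" using eta by (simp add: pos_divide_le_eq)
    qed (use theta in auto)
    finally have 1: "lam\<^sup>2 * (1 / u0) \<le> \<theta> * exp l * (1 - \<eta> / 2)" .
    have "lam\<^sup>2 * (7 / u0\<^sup>2) = 7 * (\<theta> * exp l) * (l / u0\<^sup>2)" unfolding lam2 by simp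
    also have "\<dots> \<le> 7 * (\<theta> * exp l) * (l / l\<^sup>2)"
      using u0 l1 theta by (intro mult_left_mono divide_left_mono power_mono) auto
    also have "\<dots> = 7 * (\<theta> * exp l) / l" using l0 by (simp add: power2_eq_square)
    finally have 2: "lam\<^sup>2 * (7 / u0\<^sup>2) \<le> 7 * (\<theta> * exp l) / l" .
    have "lam * T \<le> lam * l powr C" using T(2) lam1 by (intro mult_left_mono) auto
    then have "lam\<^sup>2 * (1 / u0) + lam\<^sup>2 * (7 / u0\<^sup>2) + 2 * (lam * T) \<le> \<theta> * exp l * (1 - \<eta> / 2) + \<eta> / 4 * (\<theta> * exp l)"
      using 1 2 C' by linarith
    also have "\<dots> = (1 - \<eta> / 4) * (\<theta> * exp l)" by (simp add: algebra_simps)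
    finally show ?thesis by (simp add: distrib_left)
  qed
  have "12 \<le> \<eta> * (lam * exp (- A) / u0)"
  proof -
    have "0 \<le> A * uJ / u0" using A uJ1 u0 eta by (smt (verit) divide_nonneg_nonneg mult_nonneg_nonneg)
    moreover have "0 \<le> ln lam" using lam1 by simp
    ultimately have "0 \<le> real J * (2 + 2 * ln lam + A * uJ / u0)" by (intro mult_nonneg_nonneg) auto
    then show ?thesis using c_err \<open>0 \<le> ln lam\<close> by linarith
  qed
  with P B show ?thesis using that unfolding lam_def u0_def by blast
qed

section \<open>A lower bound for the totient\<close>

text \<open>The \<open>i\<close>-th smallest element is at least \<open>i + 1\<close>, and the
  product of \<open>1 - 1 / (i + 1)\<close> for \<open>i = 1, ..., n\<close> telescopes to
  \<open>1 / (n + 1)\<close>.\<close>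

lemma prod_one_minus_inverse_ge:
  fixes S :: "nat set"
  assumes "finite S" "\<And>p. p \<in> S \<Longrightarrow> 2 \<le> p"
  shows "1 / (real (card S) + 1) \<le> (\<Prod>p\<in>S. 1 - 1 / real p)"
  using assms
proof (induction S rule: finite_linorder_max_induct)
  case (insert b S)
  have "S \<subseteq> {2..<b}" using insert by auto
  then have "card S \<le> b - 2" using card_mono[of "{2..<b}" S] by simp
  then have b: "real (card S) + 2 \<le> real b" using insert.prems[of b] by auto
  have "1 / (real (card (insert b S)) + 1) = (1 - 1 / (real (card S) + 2)) * (1 / (real (card S) + 1))"
  proof -
    have "card (insert b S) = card S + 1" using insert.hyps by (subst card_insert_disjoint) auto
    then show ?thesis by (simp add: field_simps)
  qed
  also have "\<dots> \<le> (1 - 1 / real b) * (\<Prod>p\<in>S. 1 - 1 / real p)"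
    using b insert by (intro mult_mono) (auto intro!: divide_left_mono diff_left_mono)
  finally show ?case using insert.hyps by (subst prod.insert) auto
qed simp

text \<open>As \<open>ln p \<ge> 1 / 2\<close> for every prime, \<open>q\<close> has at most
  \<open>2 * ln q\<close> prime divisors.\<close>

lemma totient_lower_bound:
  assumes "q > 0"
  shows "real q \<le> real (totient q) * (2 * ln (real q) + 1)"
proof -
  have fin: "finite (prime_factors q)" by simp
  have p2: "2 \<le> p" if "p \<in> prime_factors q" for p using that by (auto intro: prime_ge_2_nat)
  have ln2: "1 / 2 \<le> ln (2::real)"
  proof -
    have "exp (1 / 2 :: real) ^ 2 = exp 1" by (simp flip: exp_of_nat_mult)
    also have "\<dots> \<le> 3" by (rule exp_le)
    also have "\<dots> \<le> 2 ^ 2" by simp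
    finally have "exp (1 / 2 :: real) \<le> 2" by (rule power2_le_imp_le) simp
    then have "ln (exp (1 / 2)) \<le> ln (2::real)" by (intro ln_mono) auto
    then show ?thesis by simp
  qed
  have "real (card (prime_factors q)) * (1 / 2) = (\<Sum>p\<in>prime_factors q. 1 / 2)" by simp
  also have "\<dots> \<le> (\<Sum>p\<in>prime_factors q. ln (real p))"
  proof (rule sum_mono)
    fix p assume "p \<in> prime_factors q"
    then have "ln 2 \<le> ln (real p)" using p2[of p] by (intro ln_mono) auto
    then show "1 / 2 \<le> ln (real p)" using ln2 by linarith
  qed
  also have "\<dots> \<le> ln (real q)" by (rule sum_ln_prime_factors_le) fact
  finally have w: "real (card (prime_factors q)) + 1 \<le> 2 * ln (real q) + 1" by simp
  have "1 / (2 * ln (real q) + 1) \<le> 1 / (real (card (prime_factors q)) + 1)"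
    using w by (intro divide_left_mono mult_pos_pos) (auto intro: less_le_trans[OF _ w])
  also have "\<dots> \<le> (\<Prod>p\<in>prime_factors q. 1 - 1 / real p)"
    using p2 by (intro prod_one_minus_inverse_ge fin)
  finally have "real q * (1 / (2 * ln (real q) + 1)) \<le> real q * (\<Prod>p\<in>prime_factors q. 1 - 1 / real p)"
    by (intro mult_left_mono) auto
  also have "\<dots> = real (totient q)" by (simp add: totient_formula2)
  finally have le: "real q / (2 * ln (real q) + 1) \<le> real (totient q)" by simp
  have "0 \<le> ln (real q)" using assms by simp
  then have "0 < 2 * ln (real q) + 1" by linarith
  then show ?thesis using le by (simp only: pos_divide_le_eq)
qed

section \<open>Large character sums\<close>

lemma sqrt_exp: "sqrt (exp x) = exp (x / 2 :: real)"
  by (rule real_sqrt_unique) (simp_all add: power2_eq_square flip: exp_add)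

text \<open>The supremum is over a set bounded by \<open>nat \<lfloor>N\<rfloor>\<close>, so it
  really dominates its members.\<close>

lemma norm_char_sum_le_Delta:
  assumes "q > 0" "dirichlet_char q chi" "chi \<noteq> principal_char q"
  shows "cmod (\<Sum>n\<in>{1..nat \<lfloor>N\<rfloor>}. chi n) \<le> Delta N q"
  unfolding Delta_def
proof (rule cSup_upper)
  show "bdd_above {cmod (\<Sum>n\<in>{1..nat \<lfloor>N\<rfloor>}. chi n) | chi. dirichlet_char q chi \<and> chi \<noteq> principal_char q}"
  proof (rule bdd_aboveI)
    fix v assume "v \<in> {cmod (\<Sum>n\<in>{1..nat \<lfloor>N\<rfloor>}. chi n) | chi. dirichlet_char q chi \<and> chi \<noteq> principal_char q}"
    then obtain psi where psi: "v = cmod (\<Sum>n\<in>{1..nat \<lfloor>N\<rfloor>}. psi n)" "dirichlet_char q psi" by blast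
    show "v \<le> real (nat \<lfloor>N\<rfloor>) * 1"
      unfolding psi(1) using norm_dirichlet_char_le[OF psi(2) assms(1)]
        sum_norm_bound[of "{1..nat \<lfloor>N\<rfloor>}" psi 1] by simp
  qed
qed (use assms in blast)

text \<open>Recasts \<open>resonating_sets\<close> with \<open>l\<close> in place of
  \<open>u0\<close>, which costs one more \<open>\<eta>\<close> (7 instead of 6). The common bound
  \<open>exp b\<close> for elements and set sizes satisfies \<open>exp b * exp (lam * T) \<le> q
  powr ((1 - \<eta> / 4) * \<theta>)\<close>.\<close>

lemma resonating_sets_large:
  fixes \<eta> C \<theta> l A T T' L :: real
  defines "lam \<equiv> sqrt (\<theta> * exp l * l)"
  assumes eta: "0 < \<eta>" "\<eta> \<le> 1 / 11" and C: "C > 0" and theta: "0 < \<theta>" "\<theta> \<le> 1"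
    and large: "large_enough \<eta> C \<theta> l" and q: "q > 0" "ln (real q) = exp l"
    and A: "A > 0" and int: "((\<lambda>x. exp (- x) / x) has_integral T) {A..}" "((\<lambda>x. exp (- x) / x ^ 2) has_integral T') {A..}"
    and T: "l powr - C \<le> T" "T \<le> l powr C"
    and L: "lam * T - 2 \<le> L" "L \<le> lam * T"
  shows "\<exists>X Y Z :: nat set. \<exists>K b. finite X \<and> finite Y \<and> X \<noteq> {} \<and> Y \<noteq> {} \<and>
    (\<forall>x\<in>X \<union> Y. 0 < x \<and> coprime x q \<and> real x \<le> exp b) \<and>
    sqrt (real (card X) * real (card Y)) \<le> exp b \<and>
    b + lam * T \<le> (1 - \<eta> / 4) * (\<theta> * exp l) \<and> 0 < lam * T \<and> lam * T \<le> b \<and>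
    (\<forall>z\<in>Z. 0 < z \<and> coprime z q \<and> real z \<le> exp L \<and> exp (L - 3 * \<eta> * (lam * exp (- A) / l)) \<le> real z) \<and>
    (\<forall>x\<in>X. K \<le> real (card {y\<in>Y. \<exists>z\<in>Z. x = y * z})) \<and>
    exp (L / 2 + (1 - 7 * \<eta>) * (lam * exp (- A) / l)) \<le> K * sqrt (real (card X) / real (card Y)) \<and>
    12 \<le> \<eta> * (lam * exp (- A) / l)"
proof -
  define u0 where "u0 = (1 + \<eta>) * l"
  define W where "W = lam * exp (- A) / u0"
  define V where "V = lam * exp (- A) / l"
  have eta': "\<eta> \<le> 1 / 8" using eta by simp
  obtain J where P: "resonator_params q J \<eta> lam u0 A T L"
    and B: "lam\<^sup>2 * (1 / u0 + 7 / u0\<^sup>2) + 2 * (lam * T) \<le> (1 - \<eta> / 4) * (\<theta> * exp l)"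
    and W12: "12 \<le> \<eta> * W"
    using resonator_params_large[OF eta(1) eta' C theta large q A int T L[unfolded lam_def]]
    unfolding lam_def u0_def W_def by blast
  interpret R: resonator_params q J \<eta> lam u0 A T L by (rule P)
  define b where "b = lam\<^sup>2 * (1 / u0 + 7 / u0\<^sup>2) + lam * T"
  have u0: "1 \<le> u0" "1 \<le> lam" by (rule R.u0, rule R.lam)
  have "0 < (1 + \<eta>) * l" using u0(1) unfolding u0_def by linarith
  then have l0: "0 < l" using eta by (auto simp: zero_less_mult_iff)
  have V0: "0 < V" using u0 l0 by (simp add: V_def)
  have WV: "W \<le> V" "(1 - \<eta>) * V \<le> W"
  proof -
    have eq: "W = V / (1 + \<eta>)" by (simp add: W_def V_def u0_def)
    show "W \<le> V" unfolding eq using V0 eta by (simp add: divide_le_eq)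
    have "(1 - \<eta>) * (1 + \<eta>) * V \<le> 1 * V" using V0 eta by (intro mult_right_mono) (auto simp: algebra_simps)
    then show "(1 - \<eta>) * V \<le> W" unfolding eq using eta by (simp add: pos_le_divide_eq mult_ac)
  qed
  obtain X Y Z :: "nat set" and K :: real where S: "finite X" "finite Y" "X \<noteq> {}" "Y \<noteq> {}"
    and XY: "\<And>x. x \<in> X \<union> Y \<Longrightarrow> 0 < x \<and> coprime x q \<and> ln (real x) \<le> lam\<^sup>2 * (1 / u0 + 7 / u0\<^sup>2) + lam * T"
    and Z: "\<And>z. z \<in> Z \<Longrightarrow> 0 < z \<and> coprime z q \<and> ln (real z) \<le> L \<and> L - 3 * \<eta> * (lam * exp (- A) / u0) \<le> ln (real z)"
    and K: "\<And>x. x \<in> X \<Longrightarrow> K \<le> real (card {y\<in>Y. \<exists>z\<in>Z. x = y * z})"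
    and G: "exp (L / 2 + (1 - 6 * \<eta>) * (lam * exp (- A) / u0)) \<le> K * sqrt (real (card X) / real (card Y))"
    using R.resonating_sets by blast
  have expln: "real x = exp (ln (real x))" if "0 < x" for x :: nat using that by simp
  have XY': "0 < x \<and> coprime x q \<and> real x \<le> exp b" if "x \<in> X \<union> Y" for x
    using XY[OF that] expln[of x] unfolding b_def by (metis exp_le_cancel_iff)
  have card: "real (card S) \<le> exp b" if "S \<subseteq> X \<union> Y" "finite S" for S
  proof -
    have "S \<subseteq> {1..nat \<lfloor>exp b\<rfloor>}" using XY' that by (force simp: le_nat_iff le_floor_iff)
    then have "card S \<le> nat \<lfloor>exp b\<rfloor>" using card_mono[of "{1..nat \<lfloor>exp b\<rfloor>}" S] by simp
    then have "real (card S) \<le> real (nat \<lfloor>exp b\<rfloor>)" by (simp only: of_nat_le_iff)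
    moreover have "real (nat \<lfloor>exp b\<rfloor>) \<le> exp b" by simp
    ultimately show ?thesis by linarith
  qed
  have sq: "sqrt (real (card X) * real (card Y)) \<le> exp b"
  proof -
    have "real (card X) * real (card Y) \<le> exp b * exp b" using card[of X] card[of Y] S by (intro mult_mono) auto
    then have "sqrt (real (card X) * real (card Y)) \<le> sqrt (exp b * exp b)" by (rule real_sqrt_le_mono)
    then show ?thesis by simp
  qed
  have lamT: "0 < lam * T" using R.T_pos u0 by simp
  have b1: "b + lam * T \<le> (1 - \<eta> / 4) * (\<theta> * exp l)" using B unfolding b_def by linarith
  have "0 \<le> lam\<^sup>2 * (1 / u0 + 7 / u0\<^sup>2)" using u0 by simp
  then have b2: "lam * T \<le> b" unfolding b_def by linarith
  have eV: "\<eta> * W \<le> \<eta> * V" using WV eta by (intro mult_left_mono) auto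
  have Z': "0 < z \<and> coprime z q \<and> real z \<le> exp L \<and> exp (L - 3 * \<eta> * (lam * exp (- A) / l)) \<le> real z" if "z \<in> Z" for z
  proof -
    have z: "0 < z" "coprime z q" "ln (real z) \<le> L" "L - 3 * \<eta> * W \<le> ln (real z)" using Z[OF that] unfolding W_def by auto
    have "L - 3 * \<eta> * V \<le> ln (real z)" using z(4) eV by linarith
    then have "exp (L - 3 * \<eta> * V) \<le> exp (ln (real z))" "exp (ln (real z)) \<le> exp L" using z(3) by auto
    then show ?thesis using z(1,2) expln[of z] unfolding V_def by simp
  qed
  have "(1 - 7 * \<eta>) * V \<le> (1 - 6 * \<eta>) * W"
  proof -
    have "(1 - 7 * \<eta>) * V \<le> (1 - 6 * \<eta>) * ((1 - \<eta>) * V)"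
      using V0 eta by (simp add: algebra_simps)
    also have "\<dots> \<le> (1 - 6 * \<eta>) * W" using WV eta by (intro mult_left_mono) auto
    finally show ?thesis .
  qed
  then have "exp (L / 2 + (1 - 7 * \<eta>) * V) \<le> exp (L / 2 + (1 - 6 * \<eta>) * W)" by simp
  also have "\<dots> \<le> K * sqrt (real (card X) / real (card Y))" using G unfolding W_def .
  finally have G': "exp (L / 2 + (1 - 7 * \<eta>) * (lam * exp (- A) / l)) \<le> K * sqrt (real (card X) / real (card Y))"
    unfolding V_def .
  have V12: "12 \<le> \<eta> * (lam * exp (- A) / l)" using W12 eV unfolding V_def by linarith
  have "\<forall>x\<in>X \<union> Y. 0 < x \<and> coprime x q \<and> real x \<le> exp b" using XY' by blast
  moreover have "\<forall>z\<in>Z. 0 < z \<and> coprime z q \<and> real z \<le> exp L \<and> exp (L - 3 * \<eta> * (lam * exp (- A) / l)) \<le> real z"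
    using Z' by blast
  moreover have "\<forall>x\<in>X. K \<le> real (card {y\<in>Y. \<exists>z\<in>Z. x = y * z})" using K by blast
  ultimately show ?thesis
    by (intro exI[of _ X] exI[of _ Y] exI[of _ Z] exI[of _ K] exI[of _ b] conjI S sq b1 lamT b2 G' V12)
qed

text \<open>The kernel is the indicator of \<open>t \<le> N\<close>; it is non-negative, so
  \<open>B = 0\<close>. The principal character contributes at most 1, because
  \<open>N * exp b\<close> is below \<open>q / (2 * ln q + 1)\<close> and so below
  \<open>totient q\<close>.\<close>

lemma Delta_lower_general:
  fixes \<eta> C l A T T' :: real
  defines "lam \<equiv> sqrt (1 * exp l * l)"
  assumes eta: "0 < \<eta>" "\<eta> \<le> 1 / 11" and C: "C > 0"
    and large: "large_enough \<eta> C 1 l" and q: "q > 1" "ln (real q) = exp l"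
    and A: "A > 0" and int: "((\<lambda>x. exp (- x) / x) has_integral T) {A..}" "((\<lambda>x. exp (- x) / x ^ 2) has_integral T') {A..}"
    and T: "l powr - C \<le> T" "T \<le> l powr C"
  shows "sqrt (exp (lam * T)) * exp ((1 - 8 * \<eta>) * (lam * exp (- A) / l)) \<le> Delta (exp (lam * T)) q"
proof -
  define V where "V = lam * exp (- A) / l"
  define N where "N = exp (lam * T)"
  have q0: "q > 0" using q by simp
  have Lc: "sqrt (1 * exp l * l) * T - 2 \<le> lam * T" "lam * T \<le> sqrt (1 * exp l * l) * T"
    unfolding lam_def by simp_all
  obtain X Y Z :: "nat set" and K b :: real where S: "finite X" "finite Y" "X \<noteq> {}" "Y \<noteq> {}"
    and XY: "\<forall>x\<in>X \<union> Y. 0 < x \<and> coprime x q \<and> real x \<le> exp b"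
    and sq: "sqrt (real (card X) * real (card Y)) \<le> exp b"
    and b: "b + lam * T \<le> (1 - \<eta> / 4) * (1 * exp l)" "0 < lam * T" "lam * T \<le> b"
    and Z: "\<forall>z\<in>Z. 0 < z \<and> coprime z q \<and> real z \<le> exp (lam * T) \<and> exp (lam * T - 3 * \<eta> * (lam * exp (- A) / l)) \<le> real z"
    and K: "\<forall>x\<in>X. K \<le> real (card {y\<in>Y. \<exists>z\<in>Z. x = y * z})"
    and G: "exp (lam * T / 2 + (1 - 7 * \<eta>) * (lam * exp (- A) / l)) \<le> K * sqrt (real (card X) / real (card Y))"
    and V12: "12 \<le> \<eta> * (lam * exp (- A) / l)"
    using resonating_sets_large[OF eta C zero_less_one order.refl large q0 q(2) A int T Lc, folded lam_def]
    by (elim exE conjE) (rule that; assumption)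
  have qe: "real q = exp (exp l)" using q by (metis exp_ln of_nat_0_less_iff q0)
  have bq: "exp b < real q" "N \<le> exp b"
  proof -
    have "(1 - \<eta> / 4) * (1 * exp l) \<le> 1 * (1 * exp l)" using eta by (intro mult_right_mono) auto
    then have "b < exp l" using b by linarith
    then show "exp b < real q" unfolding qe by simp
    show "N \<le> exp b" unfolding N_def using b by simp
  qed
  define c where "c = (\<lambda>t::nat. if real t \<le> N then 1 else (0::real))"
  have Npos: "0 < N" by (simp add: N_def)
  have iff: "real t \<le> N \<longleftrightarrow> t \<le> nat \<lfloor>N\<rfloor>" for t using Npos by (simp add: le_nat_iff le_floor_iff)
  have tot: "{t \<in> totatives q. t \<le> nat \<lfloor>N\<rfloor>} = {t \<in> {1..nat \<lfloor>N\<rfloor>}. coprime t q}"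
  proof -
    have "t \<le> q" if "t \<le> nat \<lfloor>N\<rfloor>" for t using that iff[of t] bq by linarith
    then show ?thesis by (auto simp: in_totatives_iff Suc_le_eq)
  qed
  have sumc: "\<bar>\<Sum>t\<in>totatives q. c t\<bar> \<le> N"
  proof -
    have "(\<Sum>t\<in>totatives q. c t) = real (card {t \<in> totatives q. t \<le> nat \<lfloor>N\<rfloor>})"
      unfolding c_def iff by (simp add: sum.inter_filter[symmetric])
    also have "\<dots> \<le> real (card {1..nat \<lfloor>N\<rfloor>})" unfolding tot of_nat_le_iff by (intro card_mono) auto
    also have "\<dots> \<le> N" using Npos by simp
    finally have "(\<Sum>t\<in>totatives q. c t) \<le> N" .
    moreover have "0 \<le> (\<Sum>t\<in>totatives q. c t)" by (intro sum_nonneg) (simp add: c_def)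
    ultimately show ?thesis by simp
  qed
  have phi: "0 < real (totient q)" using q0 by simp
  have small: "\<bar>\<Sum>t\<in>totatives q. c t\<bar> / real (totient q) * sqrt (real (card X) * real (card Y)) \<le> 1"
  proof -
    have "\<bar>\<Sum>t\<in>totatives q. c t\<bar> * sqrt (real (card X) * real (card Y)) \<le> N * exp b"
      using sumc sq by (intro mult_mono) auto
    also have "\<dots> \<le> exp ((1 - \<eta> / 4) * (1 * exp l))" unfolding N_def using b by (simp flip: exp_add)
    also have "\<dots> = real q / exp (\<eta> / 4 * (1 * exp l))" unfolding qe by (simp add: left_diff_distrib exp_diff)
    also have "\<dots> \<le> real q / (2 * ln (real q) + 1)"
      using large unfolding large_enough_def q(2) by (intro divide_left_mono) (auto intro!: mult_pos_pos add_pos_pos)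
    also have "\<dots> \<le> real (totient q)"
    proof -
      have "0 < 2 * ln (real q) + 1" unfolding q(2) by (intro add_pos_pos) auto
      then show ?thesis using totient_lower_bound[OF q0] by (simp only: pos_divide_le_eq)
    qed
    finally show ?thesis using phi by (simp add: divide_le_eq)
  qed
  \<comment> \<open>The 1 is the share of the principal character; passing from
    \<open>7 * \<eta>\<close> to \<open>8 * \<eta>\<close> absorbs it, as
    \<open>\<eta> * V \<ge> 12\<close>.\<close>
  define R where "R = exp (lam * T / 2 + (1 - 7 * \<eta>) * V) - 1"
  define t where "t = exp (lam * T / 2 + (1 - 8 * \<eta>) * V)"
  have V0: "0 < V"
  proof -
    have "0 < \<eta> * V" using V12 unfolding V_def by linarith
    then show ?thesis using eta by (simp add: zero_less_mult_iff)
  qed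
  have t1: "1 \<le> t"
  proof -
    have "0 \<le> (1 - 8 * \<eta>) * V" using V0 eta by (intro mult_nonneg_nonneg) auto
    then show ?thesis unfolding t_def using b by simp
  qed
  have Rt: "t \<le> R"
  proof -
    have "lam * T / 2 + (1 - 7 * \<eta>) * V = (lam * T / 2 + (1 - 8 * \<eta>) * V) + \<eta> * V" by (simp add: algebra_simps)
    then have "exp (lam * T / 2 + (1 - 7 * \<eta>) * V) = t * exp (\<eta> * V)" unfolding t_def by (simp only: exp_add)
    moreover have "2 \<le> exp (\<eta> * V)" using V12 exp_ge_add_one_self[of "\<eta> * V"] unfolding V_def by linarith
    then have "t * 2 \<le> t * exp (\<eta> * V)" using t1 by (intro mult_left_mono) auto
    ultimately show ?thesis using t1 unfolding R_def by linarith
  qed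
  have "\<exists>chi. dirichlet_char q chi \<and> chi \<noteq> principal_char q \<and> R \<le> cmod (\<Sum>t\<in>totatives q. of_real (c t) * chi t)"
  proof (rule resonance[where B = 0 and wt = 1, OF q(1) S])
    show "coprime x q \<and> x < q" if "x \<in> X" for x using bspec[OF XY, of x] that bq by auto
    show "coprime y q \<and> y < q" if "y \<in> Y" for y using bspec[OF XY, of y] that bq by auto
    show "z \<in> totatives q \<and> 1 \<le> c z" if z: "z \<in> Z" for z
    proof -
      have zN: "real z \<le> N" using bspec[OF Z z] by (simp add: N_def)
      then have "real z \<le> real q" using bq by linarith
      then show ?thesis using bspec[OF Z z] zN by (simp add: c_def in_totatives_iff)
    qed
    show "K \<le> real (card {y \<in> Y. \<exists>z\<in>Z. x = y * z})" if "x \<in> X" for x by (rule bspec[OF K that])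
    show "0 < R" using t1 Rt by linarith
    show "R \<le> 1 * (K * sqrt (real (card X) / real (card Y)))
       - (0 + \<bar>\<Sum>t\<in>totatives q. c t\<bar> / real (totient q)) * sqrt (real (card X) * real (card Y))"
      using G small unfolding R_def V_def by simp
  qed (auto simp: c_def)
  then obtain chi where chi: "dirichlet_char q chi" "chi \<noteq> principal_char q" "R \<le> cmod (\<Sum>t\<in>totatives q. of_real (c t) * chi t)"
    by blast
  have "(\<Sum>t\<in>totatives q. of_real (c t) * chi t) = (\<Sum>t\<in>totatives q. if t \<le> nat \<lfloor>N\<rfloor> then chi t else 0)"
    unfolding c_def iff by (intro sum.cong) auto
  also have "\<dots> = (\<Sum>t\<in>{t \<in> totatives q. t \<le> nat \<lfloor>N\<rfloor>}. chi t)" by (simp add: sum.inter_filter)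
  also have "\<dots> = (\<Sum>t\<in>{1..nat \<lfloor>N\<rfloor>}. chi t)"
    unfolding tot using chi(1) by (intro sum.mono_neutral_left) (auto simp: dirichlet_char_def)
  finally have "R \<le> Delta N q" using chi norm_char_sum_le_Delta[OF q0 chi(1,2), of N] by simp
  moreover have "t = sqrt (exp (lam * T)) * exp ((1 - 8 * \<eta>) * V)"
    unfolding t_def exp_add by (simp add: sqrt_exp)
  ultimately show ?thesis using Rt unfolding N_def V_def by linarith
qed

section \<open>Size of the sine kernel and the prime case\<close>

text \<open>Let \<open>x = pi * z / q\<close> and \<open>y = M * z / q\<close>. The closed form is
  estimated by \<open>1 - cos (2 * pi * y) \<ge> 2 * y\<^sup>2\<close>,
  \<open>cos x \<ge> 1 / 2\<close> and \<open>sin x \<le> 4 * z / q\<close>.\<close>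

lemma sine_weight_lower:
  assumes q: "q > 0" and z: "0 < z" "real z / real q \<le> 1 / 3" and M: "real M * real z / real q \<le> 1 / 3"
  shows "(real M * real z / real q)\<^sup>2 * real q / (8 * real z) \<le> sine_weight q M z"
proof -
  define x where "x = pi * real z / real q"
  define y where "y = real M * real z / real q"
  have y: "0 \<le> y" "y \<le> 1 / 3" using M by (auto simp: y_def)
  have x: "0 < x" "x \<le> pi / 3"
  proof -
    show "0 < x" using q z by (simp add: x_def)
    show "x \<le> pi / 3" using mult_left_mono[OF z(2), of pi] by (simp add: x_def)
  qed
  have sx: "0 < sin x" "sin x \<le> 4 * (real z / real q)"
  proof -
    show "0 < sin x" using x pi_gt_zero by (intro sin_gt_zero) linarith+
    have "sin x \<le> x" using x by (intro sin_x_le_x) auto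
    also have "\<dots> = pi * (real z / real q)" by (simp add: x_def)
    also have "\<dots> \<le> 4 * (real z / real q)" using pi_less_4 by (intro mult_right_mono) auto
    finally show "sin x \<le> 4 * (real z / real q)" .
  qed
  have cx: "1 / 2 \<le> cos x"
    using cos_monotone_0_pi_le[of x "pi / 3"] x by (simp add: cos_60)
  have sy: "y \<le> sin (pi * y)"
  proof -
    have "pi * y \<le> pi / 3" using mult_left_mono[OF y(2), of pi] by simp
    then have "pi * y / 2 \<le> sin (pi * y)" using y by (intro sin_ge_half_arg) auto
    moreover have "y * 2 \<le> y * pi" using pi_ge_two y by (intro mult_left_mono) auto
    ultimately show ?thesis by (simp add: mult.commute)
  qed
  have cy: "2 * y\<^sup>2 \<le> 1 - cos (2 * (pi * y))"
  proof -
    have "y\<^sup>2 \<le> (sin (pi * y))\<^sup>2" using sy y by (intro power_mono) auto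
    then show ?thesis by (simp add: cos_double_sin)
  qed
  have "2 * y\<^sup>2 * (1 / 2) \<le> (1 - cos (2 * (pi * y))) * cos x"
    using cx cy by (intro mult_mono) auto
  also have "\<dots> = 2 * sin x * sine_weight q M z"
    using sine_weight_closed_form[of z q M] by (simp add: x_def y_def mult_ac)
  finally have main: "y\<^sup>2 \<le> 2 * sin x * sine_weight q M z" by simp
  then have "0 \<le> (2 * sin x) * sine_weight q M z" by (smt (verit) zero_le_power2)
  then have nn: "0 \<le> sine_weight q M z" using sx(1) by (simp add: zero_le_mult_iff)
  have "y\<^sup>2 \<le> (2 * (4 * (real z / real q))) * sine_weight q M z"
    using main mult_right_mono[OF mult_left_mono[OF sx(2), of 2] nn] by linarith
  then have "y\<^sup>2 * real q \<le> sine_weight q M z * (8 * real z)" using q by (simp add: field_simps)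
  then show ?thesis using z unfolding y_def[symmetric] by (simp add: pos_divide_le_eq)
qed

text \<open>Up to \<open>q / 2\<close> the sine and the cosine in the closed form are non-negative,
  and the sine is at least \<open>t / (2 * q)\<close>.\<close>

lemma sine_weight_bounds:
  assumes q: "q > 0" and t: "0 < t" "2 * t \<le> q"
  shows "0 \<le> sine_weight q M t" "sine_weight q M t \<le> 2 * real q / real t"
proof -
  define x where "x = pi * real t / real q"
  have "2 * real t \<le> real q" using t by linarith
  then have x: "0 < x" "x \<le> pi / 2" using q t by (auto simp: x_def field_simps)
  have "x / 4 \<le> sin (x / 2)" using sin_ge_half_arg[of "x / 2"] x by simp
  moreover have "1 / 2 \<le> cos (x / 2)"
    using cos_monotone_0_pi_le[of "x / 2" "pi / 3"] x by (simp add: cos_60)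
  ultimately have "x / 4 * (1 / 2) \<le> sin (x / 2) * cos (x / 2)" using x by (intro mult_mono) auto
  then have sx: "x / 4 \<le> sin x" using sin_double[of "x / 2"] by simp
  have "2 * (real t / real q) \<le> pi * (real t / real q)" using pi_ge_two by (intro mult_right_mono) auto
  then have sx': "real t / (2 * real q) \<le> sin x" using sx by (simp add: x_def)
  have s0: "0 < sin x" using sx x by linarith
  have c: "0 \<le> cos x" "cos x \<le> 1" using x by (auto intro: cos_ge_zero)
  have eq: "2 * sin x * sine_weight q M t = (1 - cos (2 * pi * real M * real t / real q)) * cos x"
    using sine_weight_closed_form[of t q M] by (simp add: x_def)
  have "0 \<le> (1 - cos (2 * pi * real M * real t / real q)) * cos x" using c by (intro mult_nonneg_nonneg) auto
  then have "0 \<le> (2 * sin x) * sine_weight q M t" using eq by simp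
  then show "0 \<le> sine_weight q M t" using s0 by (simp add: zero_le_mult_iff)
  have "(1 - cos (2 * pi * real M * real t / real q)) * cos x \<le> 2 * 1"
    using c cos_ge_minus_one[of "2 * pi * real M * real t / real q"] by (intro mult_mono) auto
  then have "sine_weight q M t \<le> 1 / sin x" using eq s0 by (simp add: field_simps)
  also have "\<dots> \<le> 1 / (real t / (2 * real q))" using sx' t q s0 by (intro divide_left_mono) auto
  finally show "sine_weight q M t \<le> 2 * real q / real t" by simp
qed

text \<open>If \<open>t > q / 2\<close>, then \<open>s = q - t\<close> satisfies \<open>s y \<equiv> - x\<close>, so \<open>s y \<ge> q - x\<close> and \<open>s\<close> cannot be small.\<close>

lemma sine_weight_congruence_ge:
  fixes E :: real
  assumes q: "q > 1" and t: "t \<in> totatives q" and xy: "real x \<le> E" "real y \<le> E" "0 < y" "2 * E \<le> real q"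
    and cong: "[t * y = x] (mod q)"
  shows "- (4 * E) \<le> sine_weight q M t"
proof -
  have tq: "0 < t" "t < q" using t totatives_less[OF t q] by (auto simp: in_totatives_iff)
  have E0: "0 < E" using xy by (smt (verit) of_nat_0_less_iff)
  show ?thesis
  proof (cases "2 * t \<le> q")
    case True
    then show ?thesis using sine_weight_bounds(1)[of q t M] q tq E0 by linarith
  next
    case False
    define s where "s = q - t"
    have s: "0 < s" "2 * s \<le> q" "t = q - s" "s \<le> q" using False tq by (auto simp: s_def)
    have "[t * y + s * y = x + s * y] (mod q)" using cong by (rule cong_add) simp
    moreover have "t * y + s * y = q * y" using tq by (simp add: s_def flip: add_mult_distrib)
    ultimately have "[x + s * y = 0] (mod q)" by (metis cong_sym cong_trans cong_mult_self_left)
    then have "q dvd x + s * y" by (simp add: cong_0_iff)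
    moreover have "0 < x + s * y" using s xy by simp
    ultimately have "q \<le> x + s * y" by (rule dvd_imp_le)
    then have "real q \<le> real x + real s * real y" by (metis of_nat_add of_nat_le_iff of_nat_mult)
    also have "\<dots> \<le> real q / 2 + real s * E" using xy by (intro add_mono mult_left_mono) auto
    finally have "real q \<le> 2 * (real s * E)" by simp
    then have "2 * real q / real s \<le> 4 * E" using s by (simp add: divide_le_eq mult_ac)
    then have "sine_weight q M s \<le> 4 * E" using sine_weight_bounds(2)[of q s M] s q by linarith
    moreover have "sine_weight q M t = - sine_weight q M s"
      unfolding s(3) using q s by (intro sine_weight_reflect) auto
    ultimately show ?thesis by simp
  qed
qed

text \<open>Resonance with the kernel \<open>sine_weight q M\<close>, whose transform is at most
  \<open>sqrt q\<close> times a character sum of length \<open>M\<close> plus \<open>1 / 2\<close>.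
  Taking \<open>\<theta> = 1 / 2\<close> keeps the elements of \<open>X\<close> and \<open>Y\<close>
  below \<open>sqrt q\<close>, and negative kernel values then cost at most \<open>4 * exp b\<close>
  per pair.\<close>

lemma Delta_lower_prime:
  fixes \<eta> C l A T T' :: real
  defines "lam \<equiv> sqrt (1 / 2 * exp l * l)"
  assumes eta: "0 < \<eta>" "\<eta> \<le> 1 / 11" and C: "C > 0"
    and large: "large_enough \<eta> C (1 / 2) l" and q: "prime q" "ln (real q) = exp l"
    and A: "A > 0" and int: "((\<lambda>x. exp (- x) / x) has_integral T) {A..}" "((\<lambda>x. exp (- x) / x ^ 2) has_integral T') {A..}"
    and T: "l powr - C \<le> T" "T \<le> l powr C"
  shows "sqrt (real q / exp (lam * T)) * exp ((1 - 11 * \<eta>) * (lam * exp (- A) / l)) \<le> Delta (real q / exp (lam * T)) q"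
proof -
  define V where "V = lam * exp (- A) / l"
  define N where "N = exp (lam * T)"
  define M where "M = nat \<lfloor>real q / N\<rfloor>"
  have q1: "q > 1" using q(1) prime_gt_1_nat by blast
  then have q0: "q > 0" "0 < real q" by auto
  have half: "0 < (1 / 2 :: real)" "1 / 2 \<le> (1 :: real)" by auto
  \<comment> \<open>Lowering \<open>L\<close> by 2 gives
    \<open>z \<le> N / exp 2 \<le> N / 3\<close>, hence \<open>M * z / q \<le> 1 / 3\<close> as
    \<open>sine_weight_lower\<close> needs.\<close>
  have Lc: "sqrt (1 / 2 * exp l * l) * T - 2 \<le> lam * T - 2" "lam * T - 2 \<le> sqrt (1 / 2 * exp l * l) * T"
    unfolding lam_def by simp_all
  obtain X Y Z :: "nat set" and K b :: real where S: "finite X" "finite Y" "X \<noteq> {}" "Y \<noteq> {}"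
    and XY: "\<forall>x\<in>X \<union> Y. 0 < x \<and> coprime x q \<and> real x \<le> exp b"
    and sq: "sqrt (real (card X) * real (card Y)) \<le> exp b"
    and b: "b + lam * T \<le> (1 - \<eta> / 4) * (1 / 2 * exp l)" "0 < lam * T" "lam * T \<le> b"
    and Z: "\<forall>z\<in>Z. 0 < z \<and> coprime z q \<and> real z \<le> exp (lam * T - 2) \<and> exp (lam * T - 2 - 3 * \<eta> * (lam * exp (- A) / l)) \<le> real z"
    and K: "\<forall>x\<in>X. K \<le> real (card {y\<in>Y. \<exists>z\<in>Z. x = y * z})"
    and G: "exp ((lam * T - 2) / 2 + (1 - 7 * \<eta>) * (lam * exp (- A) / l)) \<le> K * sqrt (real (card X) / real (card Y))"
    and V12: "12 \<le> \<eta> * (lam * exp (- A) / l)"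
    using resonating_sets_large[OF eta C half large q0(1) q(2) A int T Lc, folded lam_def]
    by (elim exE conjE) (rule that; assumption)
  have qe: "real q = exp (exp l)" using q0 q(2) by (metis exp_ln)
  have sqrtq: "sqrt (real q) = exp (exp l / 2)" unfolding qe by (simp add: sqrt_exp)
  have Eb: "8 * (exp b * N) \<le> sqrt (real q)" "exp b * exp b * N * N \<le> real q / 8"
  proof -
    have e8: "8 \<le> exp (\<eta> / 4 * (1 / 2 * exp l))" using large unfolding large_enough_def by blast
    have eq: "(1 - \<eta> / 4) * (1 / 2 * exp l) = exp l / 2 - \<eta> / 4 * (1 / 2 * exp l)" by (simp add: algebra_simps)
    have "exp b * N = exp (b + lam * T)" unfolding N_def by (simp add: exp_add)
    also have "\<dots> \<le> exp (exp l / 2 - \<eta> / 4 * (1 / 2 * exp l))" using b(1) unfolding eq by simp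
    also have "\<dots> = sqrt (real q) / exp (\<eta> / 4 * (1 / 2 * exp l))" unfolding sqrtq by (rule exp_diff)
    also have "\<dots> \<le> sqrt (real q) / 8" using e8 by (intro divide_left_mono) auto
    finally show 1: "8 * (exp b * N) \<le> sqrt (real q)" by simp
    have "(exp b * N) * (exp b * N) \<le> (sqrt (real q) / 8) * (sqrt (real q) / 8)"
      using 1 by (intro mult_mono) (auto simp: N_def)
    also have "\<dots> \<le> real q / 8" using q0 by simp
    finally show "exp b * exp b * N * N \<le> real q / 8" by (simp add: mult_ac)
  qed
  have N1: "1 < N" unfolding N_def using b by simp
  have b1: "1 \<le> exp b" using b by simp
  have qN: "8 \<le> real q / N" "N \<le> real q / 3" "2 * exp b \<le> real q"
  proof -
    have "8 * (N * N) \<le> 8 * (exp b * exp b * N * N)"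
    proof -
      have "1 * 1 \<le> exp b * exp b" using b1 by (intro mult_mono) auto
      then have "1 * (N * N) \<le> (exp b * exp b) * (N * N)" using N1 by (intro mult_right_mono) auto
      then show ?thesis by (simp add: mult_ac)
    qed
    then have NN: "8 * (N * N) \<le> real q" using Eb(2) by linarith
    have "N * 1 \<le> N * N" using N1 by (intro mult_left_mono) auto
    then have N8: "8 * N \<le> real q" using NN by linarith
    then show "8 \<le> real q / N" using N1 by (simp add: pos_le_divide_eq)
    show "N \<le> real q / 3" using N8 N1 by linarith
    have "exp b * 1 \<le> exp b * N" using N1 by (intro mult_left_mono) auto
    then have "8 * exp b \<le> sqrt (real q)" using Eb(1) by linarith
    moreover have "sqrt (real q) \<le> sqrt (real q * real q)"
      using mult_left_mono[of 1 "real q" "real q"] q1 by (intro real_sqrt_le_mono) auto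
    then have "sqrt (real q) \<le> real q" by simp
    moreover have "0 < exp b" by simp
    ultimately show "2 * exp b \<le> real q" by linarith
  qed
  have M: "real M \<le> real q / N" "real q / (2 * N) \<le> real M" "M < q"
  proof -
    have "real M = of_int \<lfloor>real q / N\<rfloor>" unfolding M_def using qN by simp
    then show 1: "real M \<le> real q / N" and "real q / (2 * N) \<le> real M" using qN by (auto simp: field_simps) linarith+
    have "real q / N < real q / 1" using N1 q0 by (intro divide_strict_left_mono) auto
    then show "M < q" using 1 by simp
  qed
  \<comment> \<open>By \<open>M \<ge> q / (2 * N)\<close> the kernel is at least
    \<open>q * z / (32 * N\<^sup>2)\<close> on \<open>Z\<close>; \<open>c0\<close> is this value at
    the smallest admissible \<open>z\<close>.\<close>
  define c0 where "c0 = real q * exp (- 2 - 3 * \<eta> * V) / (32 * N)"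
  define t where "t = exp ((1 - 11 * \<eta>) * V)"
  define R where "R = c0 * exp ((lam * T - 2) / 2 + (1 - 7 * \<eta>) * V) - 4 * exp b * exp b"
  define r where "r = sqrt (real q / N)"
  have V0: "0 < V"
  proof -
    have "0 < \<eta> * V" using V12 unfolding V_def by linarith
    then show ?thesis using eta by (simp add: zero_less_mult_iff)
  qed
  have t1: "1 \<le> t"
  proof -
    have "0 \<le> (1 - 11 * \<eta>) * V" using V0 eta by (intro mult_nonneg_nonneg) auto
    then show ?thesis unfolding t_def by simp
  qed
  have r1: "1 \<le> r" unfolding r_def using qN by simp
  have cz: "c0 \<le> sine_weight q M z" if z: "z \<in> Z" for z
  proof -
    have z0: "0 < z" "real z \<le> exp (lam * T - 2)" "exp (lam * T - 2 - 3 * \<eta> * V) \<le> real z"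
      using bspec[OF Z z] unfolding V_def by auto
    have e3: "3 \<le> exp (2::real)" using exp_ge_add_one_self[of 2] by simp
    have "exp (lam * T - 2) = N / exp 2" unfolding N_def by (rule exp_diff)
    also have "\<dots> \<le> N / 3" using e3 N1 by (intro divide_left_mono) auto
    finally have zN: "real z \<le> N / 3" using z0 by linarith
    have z3: "real z / real q \<le> 1 / 3" using zN qN(2) N1 q0 by (simp add: divide_le_eq)
    have y1: "real M * real z / real q \<le> 1 / 3"
    proof -
      have "real M * real z \<le> (real q / N) * (N / 3)" using M(1) zN by (intro mult_mono) auto
      also have "\<dots> = real q / 3" using N1 by simp
      finally show ?thesis using q0 by (simp add: divide_le_eq)
    qed
    have y2: "real z / (2 * N) \<le> real M * real z / real q"
    proof -
      have "real q / (2 * N) * real z / real q \<le> real M * real z / real q"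
        using M(2) by (intro divide_right_mono mult_right_mono) auto
      then show ?thesis using q0 by simp
    qed
    have "c0 = exp (lam * T - 2 - 3 * \<eta> * V) * (real q / (32 * N * N))"
      unfolding c0_def N_def by (simp add: field_simps flip: exp_add)
    also have "\<dots> \<le> real z * (real q / (32 * N * N))" using z0 N1 by (intro mult_right_mono) auto
    also have "\<dots> = (real z / (2 * N))\<^sup>2 * (real q / (8 * real z))" using z0 N1 by (simp add: power2_eq_square field_simps)
    also have "\<dots> \<le> (real M * real z / real q)\<^sup>2 * (real q / (8 * real z))"
      using y2 N1 by (intro mult_right_mono power_mono) auto
    also have "\<dots> \<le> sine_weight q M z" using sine_weight_lower[OF q0(1) z0(1) z3 y1] by simp
    finally show ?thesis .
  qed
  have Rr: "sqrt (real q) * (r * t + 1 / 2) \<le> R"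
  proof -
    have expN: "exp (lam * T / 2) = sqrt N" unfolding N_def by (simp add: sqrt_exp)
    \<comment> \<open>The \<open>11 * \<eta>\<close> is made up of 7 from the gain, 3 from the
      smallest \<open>z\<close>, and 1 whose factor \<open>exp (\<eta> * V)\<close> swallows all
      constants.\<close>
    have "- 2 - 3 * \<eta> * V + ((lam * T - 2) / 2 + (1 - 7 * \<eta>) * V) = lam * T / 2 + (1 - 11 * \<eta>) * V + (\<eta> * V - 3)"
      by (simp add: field_simps)
    then have "exp (- 2 - 3 * \<eta> * V) * exp ((lam * T - 2) / 2 + (1 - 7 * \<eta>) * V) = sqrt N * t * exp (\<eta> * V - 3)"
      unfolding t_def expN[symmetric] by (simp only: exp_add[symmetric])
    then have "c0 * exp ((lam * T - 2) / 2 + (1 - 7 * \<eta>) * V) = real q / N * sqrt N * t * (exp (\<eta> * V - 3) / 32)"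
      unfolding c0_def by (simp add: field_simps)
    moreover have qr: "real q / N * sqrt N = sqrt (real q) * r"
    proof -
      have "real q / N * sqrt N = (sqrt (real q) * sqrt (real q)) / (sqrt N * sqrt N) * sqrt N" using q0 N1 by simp
      also have "\<dots> = sqrt (real q) * r"
      proof -
        have "(a * a) / (c * c) * c = a * (a / c)" if "c \<noteq> 0" for a c :: real using that by (simp add: field_simps)
        moreover have "sqrt N \<noteq> 0" using N1 by simp
        ultimately show ?thesis unfolding r_def real_sqrt_divide by blast
      qed
      finally show ?thesis .
    qed
    ultimately have c: "c0 * exp ((lam * T - 2) / 2 + (1 - 7 * \<eta>) * V) = sqrt (real q) * r * t * (exp (\<eta> * V - 3) / 32)" by (simp only:)
    have e9: "4 \<le> exp (\<eta> * V - 3) / 32"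
    proof -
      have "(2::real) \<le> exp 1" using exp_ge_add_one_self[of 1] by simp
      then have "2 ^ 9 \<le> (exp 1 :: real) ^ 9" by (intro power_mono) auto
      also have "\<dots> = exp 9" by (simp flip: exp_of_nat_mult)
      also have "\<dots> \<le> exp (\<eta> * V - 3)" using V12 unfolding V_def by simp
      finally show ?thesis by simp
    qed
    have sq0: "0 < sqrt (real q)" using q0 by simp
    have rt: "1 \<le> r * t" using mult_mono[OF r1 t1] r1 by simp
    have "sqrt (real q) * r * t * 4 \<le> sqrt (real q) * r * t * (exp (\<eta> * V - 3) / 32)"
      using e9 sq0 r1 t1 by (intro mult_left_mono) auto
    \<comment> \<open>The total cost of negative kernel values; \<open>Eb\<close> makes it at most
      \<open>q / N\<^sup>2\<close>.\<close>
    moreover have "4 * exp b * exp b \<le> sqrt (real q) * (r * t)"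
    proof -
      have "4 * exp b * exp b \<le> real q / (N * N)" using Eb(2) N1 by (simp add: field_simps)
      also have "\<dots> \<le> real q / N * 1" using N1 q0 by (simp add: field_simps)
      also have "\<dots> \<le> real q / N * sqrt N" using N1 q0 by (intro mult_left_mono) auto
      also have "\<dots> = sqrt (real q) * r" by (rule qr)
      also have "\<dots> \<le> sqrt (real q) * (r * t)" using t1 r1 sq0 by (intro mult_left_mono) auto
      finally show ?thesis .
    qed
    moreover have "sqrt (real q) * 1 \<le> sqrt (real q) * (r * t)" using rt sq0 by (intro mult_left_mono) auto
    moreover have "sqrt (real q) * r * t * 4 = 4 * (sqrt (real q) * (r * t))" by simp
    moreover have "sqrt (real q) * (r * t + 1 / 2) = sqrt (real q) * (r * t) + sqrt (real q) / 2"
      by (simp add: distrib_left)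
    ultimately show ?thesis unfolding R_def c using sq0 by linarith
  qed
  have rt0: "0 \<le> r * t" using r1 t1 by (intro mult_nonneg_nonneg) auto
  have "\<exists>chi. dirichlet_char q chi \<and> chi \<noteq> principal_char q \<and> R \<le> cmod (\<Sum>t\<in>totatives q. of_real (sine_weight q M t) * chi t)"
  proof (rule resonance[where B = "4 * exp b" and wt = c0 and Z = Z and K = K, OF q1 S])
    show "coprime x q \<and> x < q" if "x \<in> X" for x using bspec[OF XY, of x] that qN(3) b1 by auto
    show "coprime y q \<and> y < q" if "y \<in> Y" for y using bspec[OF XY, of y] that qN(3) b1 by auto
    show "z \<in> totatives q \<and> c0 \<le> sine_weight q M z" if z: "z \<in> Z" for z
    proof
      have "exp (lam * T - 2) \<le> N" unfolding N_def by simp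
      then have "real z \<le> real q" using bspec[OF Z z] qN(2) q0 by linarith
      then show "z \<in> totatives q" using bspec[OF Z z] by (simp add: in_totatives_iff)
    qed (rule cz[OF z])
    show "0 \<le> c0" unfolding c0_def using N1 by simp
    show "- (4 * exp b) \<le> sine_weight q M t"
      if "x \<in> X" "y \<in> Y" "t \<in> totatives q" "[t * y = x] (mod q)" for x y t
      using bspec[OF XY, of x] bspec[OF XY, of y] that qN(3)
      by (intro sine_weight_congruence_ge[OF q1 that(3) _ _ _ _ that(4)]) auto
    show "K \<le> real (card {y \<in> Y. \<exists>z\<in>Z. x = y * z})" if "x \<in> X" for x by (rule bspec[OF K that])
    have "0 < sqrt (real q) * (r * t + 1 / 2)" using rt0 q0 by (intro mult_pos_pos) auto
    then show "0 < R" using Rr by linarith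
    have "c0 * exp ((lam * T - 2) / 2 + (1 - 7 * \<eta>) * V) \<le> c0 * (K * sqrt (real (card X) / real (card Y)))"
      using G N1 unfolding V_def by (intro mult_left_mono) (auto simp: c0_def)
    moreover have "4 * exp b * sqrt (real (card X) * real (card Y)) \<le> 4 * exp b * exp b"
      using sq by (intro mult_left_mono) auto
    ultimately show "R \<le> c0 * (K * sqrt (real (card X) / real (card Y)))
       - (4 * exp b + \<bar>\<Sum>t\<in>totatives q. sine_weight q M t\<bar> / real (totient q)) * sqrt (real (card X) * real (card Y))"
      unfolding R_def sum_sine_weight[OF q1] abs_zero div_0 add_0_right by linarith
  qed simp
  then obtain chi where chi: "dirichlet_char q chi" "chi \<noteq> principal_char q"
    and R: "R \<le> cmod (\<Sum>t\<in>totatives q. of_real (sine_weight q M t) * chi t)" by blast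
  have "sqrt (real q) * (r * t + 1 / 2) \<le> sqrt (real q) * (cmod (\<Sum>n=1..M. cnj (chi n)) + 1 / 2)"
    using Rr R norm_sine_weight_transform[OF q(1) chi(1) M(3)] by linarith
  \<comment> \<open>The \<open>1 / 2\<close> included in \<open>Rr\<close> cancels against the
    halved last term of the kernel.\<close>
  then have "r * t \<le> cmod (\<Sum>n=1..M. cnj (chi n))" using q0 by simp
  also have "\<dots> \<le> Delta (real q / N) q"
    unfolding M_def
  \<comment> \<open>The Gauss sum has replaced \<open>chi\<close> by its conjugate, which is
    non-principal as well.\<close>
  proof (rule norm_char_sum_le_Delta[OF q0(1) dirichlet_char_cnj[OF chi(1)]])
    show "(\<lambda>n. cnj (chi n)) \<noteq> principal_char q"
    proof
      assume e: "(\<lambda>n. cnj (chi n)) = principal_char q"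
      have "chi n = principal_char q n" for n
        using fun_cong[OF e, of n] by (metis complex_cnj_cnj complex_cnj_one complex_cnj_zero principal_char_def)
      then show False using chi(2) by blast
    qed
  qed
  finally show ?thesis unfolding r_def t_def N_def V_def .
qed

text \<open>The condition on \<open>\<tau>\<close> becomes a two-sided power bound with exponent
  \<open>C\<close>, and \<open>o(1)\<close> becomes a threshold for each \<open>\<epsilon>\<close>
  which is uniform in \<open>\<tau>\<close>, \<open>A\<close> and \<open>\<tau>'\<close>.\<close>

theorem theorem3:
  fixes C \<epsilon> :: real
  assumes "C > 0" and "\<epsilon> > 0"
  shows "(\<exists>q0::nat. \<forall>q::nat. q \<ge> q0 \<longrightarrow>
            (\<forall>\<tau> A \<tau>' :: real.
               ln (ln (real q)) powr (- C) \<le> \<tau> \<and> \<tau> \<le> ln (ln (real q)) powr C \<and>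
               A > 0 \<and>
               ((\<lambda>x. exp (- x) / x) has_integral \<tau>) {A..} \<and>
               ((\<lambda>x. exp (- x) / x ^ 2) has_integral \<tau>') {A..} \<longrightarrow>
               Delta (exp (\<tau> * sqrt (ln (real q) * ln (ln (real q))))) q \<ge>
                 sqrt (exp (\<tau> * sqrt (ln (real q) * ln (ln (real q))))) *
                 exp ((1 - \<epsilon>) * A * (\<tau> + \<tau>') * sqrt (ln (real q) / ln (ln (real q))))))
       \<and>
         (\<exists>q0::nat. \<forall>q::nat. q \<ge> q0 \<longrightarrow> prime q \<longrightarrow>
            (\<forall>\<tau> A \<tau>' :: real.
               ln (ln (real q)) powr (- C) \<le> \<tau> \<and> \<tau> \<le> ln (ln (real q)) powr C \<and>
               A > 0 \<and>
               ((\<lambda>x. exp (- x) / x) has_integral (sqrt 2 * \<tau>)) {A..} \<and>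
               ((\<lambda>x. exp (- x) / x ^ 2) has_integral \<tau>') {A..} \<longrightarrow>
               Delta (real q / exp (\<tau> * sqrt (ln (real q) * ln (ln (real q))))) q \<ge>
                 sqrt (real q / exp (\<tau> * sqrt (ln (real q) * ln (ln (real q))))) *
                 exp ((1 - \<epsilon>) * A * (\<tau> + \<tau>' / sqrt 2) *
                      sqrt (ln (real q) / ln (ln (real q))))))"
    (is "?general \<and> ?prime")
proof
  \<comment> \<open>For prime \<open>q\<close> the integral is \<open>sqrt 2 * \<tau>\<close>; one
    more power of \<open>log log q \<ge> 2\<close> absorbs the factor.\<close>
  define D where "D = C + 1"
  have D: "0 < D" using assms by (simp add: D_def)
  \<comment> \<open>\<open>1 / 11\<close> is the range allowed by the lower bounds, and
    \<open>\<epsilon> / 11\<close> keeps the loss \<open>11 * \<eta>\<close> within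
    \<open>\<epsilon>\<close>.\<close>
  define \<eta> where "\<eta> = min (1 / 11) (\<epsilon> / 11)"
  have eta: "0 < \<eta>" "\<eta> \<le> 1 / 11" "11 * \<eta> \<le> \<epsilon>" using assms by (auto simp: \<eta>_def)
  have lim: "filterlim (\<lambda>q::nat. ln (ln (real q))) at_top at_top" by real_asymp
  have ev: "eventually (\<lambda>q::nat. large_enough \<eta> D \<theta> (ln (ln (real q))) \<and> 2 \<le> ln (ln (real q)) \<and> 3 \<le> q) at_top"
    if "\<theta> > 0" for \<theta>
  proof (intro eventually_conj)
    show "eventually (\<lambda>q::nat. large_enough \<eta> D \<theta> (ln (ln (real q)))) at_top"
      using eventually_compose_filterlim[OF eventually_large_enough[OF eta(1) D that] lim] .
    show "eventually (\<lambda>q::nat. 2 \<le> ln (ln (real q))) at_top"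
      using eventually_compose_filterlim[OF eventually_ge_at_top lim] .
  qed (rule eventually_ge_at_top)
  have lnq: "ln (real q) = exp (ln (ln (real q)))" if "3 \<le> q" for q :: nat
  proof -
    have "0 < ln (real q)" using that by simp
    then show ?thesis by simp
  qed
  have weaken: "l powr - D \<le> T" "T \<le> l powr D"
    if "l powr - C \<le> \<tau>" "\<tau> \<le> l powr C" "2 \<le> l" "\<tau> \<le> T" "T \<le> 2 * \<tau>" for l \<tau> T :: real
  proof -
    have "l powr - D \<le> l powr - C" using that by (intro powr_mono) (auto simp: D_def)
    then show "l powr - D \<le> T" using that by linarith
    have "T \<le> 2 * l powr C" using that by linarith
    also have "\<dots> \<le> l * l powr C" using that by (intro mult_right_mono) auto
    also have "\<dots> = l powr D" using that by (simp add: D_def powr_add)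
    finally show "T \<le> l powr D" .
  qed
  have nonneg: "0 \<le> \<tau>" if "l powr - C \<le> \<tau>" for l \<tau> :: real
    using that powr_ge_zero[of l "- C"] by linarith
  obtain q1 :: nat where q1: "\<And>q. q \<ge> q1 \<Longrightarrow> large_enough \<eta> D 1 (ln (ln (real q))) \<and> 2 \<le> ln (ln (real q)) \<and> 3 \<le> q"
    using ev[of 1] unfolding eventually_at_top_linorder by auto
  show ?general
  proof (intro exI[of _ q1] allI impI, elim conjE)
    fix q :: nat and \<tau> A \<tau>' :: real
    assume qq: "q \<ge> q1" and \<tau>: "ln (ln (real q)) powr (- C) \<le> \<tau>" "\<tau> \<le> ln (ln (real q)) powr C"
      and A: "A > 0" and int: "((\<lambda>x. exp (- x) / x) has_integral \<tau>) {A..}" "((\<lambda>x. exp (- x) / x ^ 2) has_integral \<tau>') {A..}"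
    define l where "l = ln (ln (real q))"
    define S where "S = sqrt (ln (real q) * l)"
    have L: "large_enough \<eta> D 1 l" "2 \<le> l" "3 \<le> q" using q1[OF qq] by (auto simp: l_def)
    have q: "ln (real q) = exp l" using lnq[OF L(3)] by (simp add: l_def)
    have S: "sqrt (1 * exp l * l) = S" by (simp add: S_def q)
    have T: "l powr - D \<le> \<tau>" "\<tau> \<le> l powr D"
      using weaken[of l \<tau> \<tau>] \<tau> nonneg[OF \<tau>(1)] L(2) by (auto simp: l_def)
    have "sqrt (exp (S * \<tau>)) * exp ((1 - 8 * \<eta>) * (S * exp (- A) / l)) \<le> Delta (exp (S * \<tau>)) q"
      using Delta_lower_general[OF eta(1,2) D L(1) _ q A int T] L(3) unfolding S by simp
    moreover have "sqrt (exp (S * \<tau>)) * exp ((1 - \<epsilon>) * A * (\<tau> + \<tau>') * sqrt (ln (real q) / l))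
      \<le> sqrt (exp (S * \<tau>)) * exp ((1 - 8 * \<eta>) * (S * exp (- A) / l))"
    proof -
      \<comment> \<open>Together with \<open>A * (\<tau> + \<tau>') = exp (- A)\<close> this leaves
        exponents that differ only in \<open>1 - \<epsilon>\<close> against
        \<open>1 - 8 * \<eta>\<close>.\<close>
      have Sl: "sqrt (ln (real q) / l) = S / l"
        unfolding S_def real_sqrt_mult real_sqrt_divide using L(2) by (simp add: field_simps)
      have "(1 - \<epsilon>) * A * (\<tau> + \<tau>') * sqrt (ln (real q) / l) = (1 - \<epsilon>) * (S * exp (- A) / l)"
        unfolding Sl using exponential_integrals(1)[OF A int] by (simp add: mult.assoc)
      also have "\<dots> \<le> (1 - 8 * \<eta>) * (S * exp (- A) / l)"
        using eta L(2) q by (intro mult_right_mono) (auto simp: S_def)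
      finally show ?thesis by (intro mult_left_mono) auto
    qed
    ultimately show "Delta (exp (\<tau> * sqrt (ln (real q) * ln (ln (real q))))) q \<ge>
                 sqrt (exp (\<tau> * sqrt (ln (real q) * ln (ln (real q))))) *
                 exp ((1 - \<epsilon>) * A * (\<tau> + \<tau>') * sqrt (ln (real q) / ln (ln (real q))))"
      unfolding l_def[symmetric] S_def[symmetric] mult.commute[of \<tau> S] by linarith
  qed
  obtain q2 :: nat where q2: "\<And>q. q \<ge> q2 \<Longrightarrow> large_enough \<eta> D (1 / 2) (ln (ln (real q))) \<and> 2 \<le> ln (ln (real q)) \<and> 3 \<le> q"
    using ev[of "1 / 2"] unfolding eventually_at_top_linorder by auto
  show ?prime
  proof (intro exI[of _ q2] allI impI, elim conjE)
    fix q :: nat and \<tau> A \<tau>' :: real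
    assume qq: "q \<ge> q2" and pr: "prime q" and \<tau>: "ln (ln (real q)) powr (- C) \<le> \<tau>" "\<tau> \<le> ln (ln (real q)) powr C"
      and A: "A > 0" and int: "((\<lambda>x. exp (- x) / x) has_integral (sqrt 2 * \<tau>)) {A..}" "((\<lambda>x. exp (- x) / x ^ 2) has_integral \<tau>') {A..}"
    define l where "l = ln (ln (real q))"
    define S where "S = sqrt (ln (real q) * l)"
    have L: "large_enough \<eta> D (1 / 2) l" "2 \<le> l" "3 \<le> q" using q2[OF qq] by (auto simp: l_def)
    have q: "ln (real q) = exp l" using lnq[OF L(3)] by (simp add: l_def)
    have S: "sqrt (1 / 2 * exp l * l) = S / sqrt 2"
      unfolding S_def q by (simp add: real_sqrt_mult real_sqrt_divide)
    have s2: "1 \<le> sqrt (2::real)" "sqrt (2::real) \<le> 2" by (auto intro: real_le_lsqrt)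
    have T: "l powr - D \<le> sqrt 2 * \<tau>" "sqrt 2 * \<tau> \<le> l powr D"
      using weaken[of l \<tau> "sqrt 2 * \<tau>"] \<tau> mult_right_mono[OF s2(1) nonneg[OF \<tau>(1)]] mult_right_mono[OF s2(2) nonneg[OF \<tau>(1)]] L(2)
      by (auto simp: l_def)
    \<comment> \<open>The factor \<open>sqrt 2\<close> in the integral cancels the one in the
      resonator parameter, so \<open>N\<close> is the intended one.\<close>
    have ST: "S / sqrt 2 * (sqrt 2 * \<tau>) = S * \<tau>" by simp
    have "sqrt (real q / exp (S * \<tau>)) * exp ((1 - 11 * \<eta>) * (S / sqrt 2 * exp (- A) / l)) \<le> Delta (real q / exp (S * \<tau>)) q"
      using Delta_lower_prime[OF eta(1,2) D L(1) pr q A int T] unfolding S ST .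
    moreover have "sqrt (real q / exp (S * \<tau>)) * exp ((1 - \<epsilon>) * A * (\<tau> + \<tau>' / sqrt 2) * sqrt (ln (real q) / l))
      \<le> sqrt (real q / exp (S * \<tau>)) * exp ((1 - 11 * \<eta>) * (S / sqrt 2 * exp (- A) / l))"
    proof -
      have Sl: "sqrt (ln (real q) / l) = S / l"
        unfolding S_def real_sqrt_mult real_sqrt_divide using L(2) by (simp add: field_simps)
      have "A * (\<tau> + \<tau>' / sqrt 2) = A * (sqrt 2 * \<tau> + \<tau>') / sqrt 2" by (simp add: field_simps)
      also have "\<dots> = exp (- A) / sqrt 2" using exponential_integrals(1)[OF A int] by simp
      finally have "A * (\<tau> + \<tau>' / sqrt 2) = exp (- A) / sqrt 2" .
      then have "(1 - \<epsilon>) * A * (\<tau> + \<tau>' / sqrt 2) * sqrt (ln (real q) / l) = (1 - \<epsilon>) * (S / sqrt 2 * exp (- A) / l)"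
        unfolding Sl by (simp add: mult.assoc)
      also have "\<dots> \<le> (1 - 11 * \<eta>) * (S / sqrt 2 * exp (- A) / l)"
        using eta L(2) q by (intro mult_right_mono) (auto simp: S_def)
      finally show ?thesis by (intro mult_left_mono) auto
    qed
    ultimately show "Delta (real q / exp (\<tau> * sqrt (ln (real q) * ln (ln (real q))))) q \<ge>
                 sqrt (real q / exp (\<tau> * sqrt (ln (real q) * ln (ln (real q))))) *
                 exp ((1 - \<epsilon>) * A * (\<tau> + \<tau>' / sqrt 2) *
                      sqrt (ln (real q) / ln (ln (real q))))"
      unfolding l_def[symmetric] S_def[symmetric] mult.commute[of \<tau> S] by linarith
  qed
qed

end
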